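(* For every admissible pair $(f,g)$ of functions $\mathbb{R}\to\mathbb{R}$, the closure in the strong operator topology of $$\mathcal{M}(\mathcal{S}_{(f,g)})=\{[e^{i(\lambda_1f+\lambda_2g)}H^2(\mathbb{R})]:(\lambda_1,\lambda_2)\in\mathbb{R}^2\}$$ is homeomorphic to the closed unit disc $\overline{\mathbb{D}}$.
   Context: $H^2(\mathbb{R})\subseteq L^2(\mathbb{R})$ is the Hardy space of the upper half plane. For a closed subspace $K$ of $L^2(\mathbb{R})$, $[K]$ is the orthogonal projection onto $K$. The set of projections on $L^2(\mathbb{R})$ carries the strong operator topology. A function $\psi:\mathbb{R}\to\mathbb{R}$ is admissible if the following subsets of $\mathbb{R}$ are discrete (have no accumulation points): (1) the set $\Gamma(\psi)$ of points at which $\psi$ fails to be twice continuously differentiable; (2) $(\psi')^{-1}(0)$; (3) the set $\Lambda(\psi)$ of points at which $\operatorname{sgn}(\psi'')$ is not locally constant. A pair $(f,g)$ of functions $\mathbb{R}\to\mathbb{R}$, with $\mathcal{S}_{(f,g)}=\{\lambda_1f+\lambda_2g:\lambda\in\mathbb{R}^2\}$, is admissible if (1) $\{f,g\}$ is linearly independent over $\mathbb{R}$; (2) every nonzero function in $\mathcal{S}_{(f,g)}$ is admissible; and (3) $\sup_{h\in\mathcal{S}_{(f,g)}\setminus\{0\}}|K\cap\Lambda(h)|<\infty$ for each compact set $K\subseteq\mathbb{R}$. *)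

theory Defs
  imports "HOL-Analysis.Analysis"
begin

section \<open>The Hilbert space of square-integrable functions on the real line\<close>

definition square_integrable :: "(real \<Rightarrow> complex) \<Rightarrow> bool" where
  "square_integrable f \<longleftrightarrow>
     f \<in> borel_measurable lborel \<and> integrable lborel (\<lambda>x. (cmod (f x))\<^sup>2)"

definition L2_rel :: "(real \<Rightarrow> complex) \<Rightarrow> (real \<Rightarrow> complex) \<Rightarrow> bool" where
  "L2_rel f g \<longleftrightarrow>
     square_integrable f \<and> square_integrable g \<and> (AE x in lborel. f x = g x)"

lemma square_integrable_zero [simp]: "square_integrable (\<lambda>x. 0)"
  by (simp add: square_integrable_def)

lemma square_integrable_mult_left:
  assumes "square_integrable f"
  shows "square_integrable (\<lambda>x. c * f x)"
  using assms by (auto simp: square_integrable_def norm_mult power_mult_distrib)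

lemma borel_measurable_mult_cnj:
  fixes f g :: "'a \<Rightarrow> complex"
  assumes [measurable]: "f \<in> borel_measurable M" "g \<in> borel_measurable M"
  shows "(\<lambda>x. f x * cnj (g x)) \<in> borel_measurable M"
proof -
  have "(\<lambda>x. cnj (g x)) \<in> borel_measurable M"
    using assms(2) by (rule borel_measurable_continuous_on[OF continuous_on_cnj[OF continuous_on_id]])
  then show ?thesis
    by measurable
qed

lemma integrable_mult_cnj:
  assumes "square_integrable f" "square_integrable g"
  shows "integrable lborel (\<lambda>x. f x * cnj (g x))"
proof (rule Bochner_Integration.integrable_bound)
  show "integrable lborel (\<lambda>x. (cmod (f x))\<^sup>2 + (cmod (g x))\<^sup>2)"
    using assms by (auto simp: square_integrable_def)
  show "(\<lambda>x. f x * cnj (g x)) \<in> borel_measurable lborel"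
    using assms by (intro borel_measurable_mult_cnj) (auto simp: square_integrable_def)
  have "a * b \<le> a\<^sup>2 + b\<^sup>2" if "a \<ge> 0" "b \<ge> 0" for a b :: real
    using sum_squares_bound[of a b] mult_nonneg_nonneg[OF that] by linarith
  then show "AE x in lborel. norm (f x * cnj (g x)) \<le> norm ((cmod (f x))\<^sup>2 + (cmod (g x))\<^sup>2)"
    by (auto simp: norm_mult)
qed

lemma square_integrable_add:
  assumes "square_integrable f" "square_integrable g"
  shows "square_integrable (\<lambda>x. f x + g x)"
proof -
  have [measurable]: "f \<in> borel_measurable borel" "g \<in> borel_measurable borel"
    using assms by (auto simp: square_integrable_def)
  have "integrable lborel (\<lambda>x. (cmod (f x + g x))\<^sup>2)"
  proof (rule Bochner_Integration.integrable_bound)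
    show "integrable lborel (\<lambda>x. 2 * (cmod (f x))\<^sup>2 + 2 * (cmod (g x))\<^sup>2)"
      using assms by (auto simp: square_integrable_def)
    have "(cmod (a + b))\<^sup>2 \<le> 2 * (cmod a)\<^sup>2 + 2 * (cmod b)\<^sup>2" for a b
    proof -
      have "(cmod (a + b))\<^sup>2 \<le> (cmod a + cmod b)\<^sup>2"
        by (intro power_mono norm_triangle_ineq) auto
      also have "\<dots> \<le> 2 * (cmod a)\<^sup>2 + 2 * (cmod b)\<^sup>2"
        using sum_squares_bound[of "cmod a" "cmod b"] by (simp add: power2_sum)
      finally show ?thesis .
    qed
    then show "AE x in lborel. norm ((cmod (f x + g x))\<^sup>2)
                 \<le> norm (2 * (cmod (f x))\<^sup>2 + 2 * (cmod (g x))\<^sup>2)"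
      by auto
  qed measurable
  then show ?thesis
    by (auto simp: square_integrable_def)
qed

quotient_type L2 = "real \<Rightarrow> complex" / partial: L2_rel
  morphisms rep_L2 abs_L2
proof (rule part_equivpI)
  show "\<exists>f. L2_rel f f"
    by (rule exI[of _ "\<lambda>x. 0"]) (simp add: L2_rel_def)
  show "symp L2_rel"
    by (auto simp: symp_def L2_rel_def)
  show "transp L2_rel"
    by (intro transpI) (auto simp: L2_rel_def elim: AE_mp)
qed

instantiation L2 :: real_vector
begin

lift_definition zero_L2 :: L2 is "\<lambda>x. 0"
  by (simp add: L2_rel_def)

lift_definition plus_L2 :: "L2 \<Rightarrow> L2 \<Rightarrow> L2" is "\<lambda>f g x. f x + g x"
  by (auto simp: L2_rel_def square_integrable_add)

lift_definition uminus_L2 :: "L2 \<Rightarrow> L2" is "\<lambda>f x. - f x"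
  using square_integrable_mult_left[of _ "-1"] by (auto simp: L2_rel_def)

definition minus_L2 :: "L2 \<Rightarrow> L2 \<Rightarrow> L2" where
  "minus_L2 u v = u + - v"

lift_definition scaleR_L2 :: "real \<Rightarrow> L2 \<Rightarrow> L2" is "\<lambda>r f x. complex_of_real r * f x"
  by (auto simp: L2_rel_def square_integrable_mult_left)

instance
proof
  fix a b c :: L2 and r s :: real
  show "a + b + c = a + (b + c)"
    by transfer (auto simp: L2_rel_def add.assoc square_integrable_add)
  show "a + b = b + a"
    by transfer (auto simp: L2_rel_def add.commute square_integrable_add)
  show "0 + a = a"
    by transfer (auto simp: L2_rel_def)
  show "- a + a = 0"
    by transfer (auto simp: L2_rel_def)
  show "a - b = a + - b"
    by (simp add: minus_L2_def)
  show "r *\<^sub>R (a + b) = r *\<^sub>R a + r *\<^sub>R b"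
    by transfer (auto simp: L2_rel_def distrib_left square_integrable_add square_integrable_mult_left)
  show "(r + s) *\<^sub>R a = r *\<^sub>R a + s *\<^sub>R a"
    by transfer (auto simp: L2_rel_def distrib_right square_integrable_add square_integrable_mult_left)
  show "r *\<^sub>R s *\<^sub>R a = (r * s) *\<^sub>R a"
    by transfer (auto simp: L2_rel_def mult.assoc square_integrable_mult_left)
  show "1 *\<^sub>R a = a"
    by transfer (auto simp: L2_rel_def)
qed

end

lift_definition scaleC_L2 :: "complex \<Rightarrow> L2 \<Rightarrow> L2" is "\<lambda>c f x. c * f x"
  by (auto simp: L2_rel_def square_integrable_mult_left)

lift_definition cinner_L2 :: "L2 \<Rightarrow> L2 \<Rightarrow> complex"
  is "\<lambda>f g. LINT x|lborel. f x * cnj (g x)"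
  by (rule integral_cong_AE)
    (auto simp: L2_rel_def square_integrable_def intro: borel_measurable_mult_cnj)

text \<open>The real inner product is the real part of the complex one; both induce the
  norm of \<open>L\<^sup>2(\<real>)\<close>, which determines the metric and the topology.\<close>

instantiation L2 :: real_inner
begin

definition inner_L2 :: "L2 \<Rightarrow> L2 \<Rightarrow> real" where
  "inner_L2 u v = Re (cinner_L2 u v)"

definition norm_L2 :: "L2 \<Rightarrow> real" where
  "norm_L2 u = sqrt (inner u u)"

definition sgn_L2 :: "L2 \<Rightarrow> L2" where
  "sgn_L2 u = u /\<^sub>R norm u"

definition dist_L2 :: "L2 \<Rightarrow> L2 \<Rightarrow> real" where
  "dist_L2 u v = norm (u - v)"

definition uniformity_L2 :: "(L2 \<times> L2) filter" where
  "uniformity_L2 = (INF e\<in>{0<..}. principal {(u, v). dist u v < e})"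

definition open_L2 :: "L2 set \<Rightarrow> bool" where
  "open_L2 U \<longleftrightarrow> (\<forall>u\<in>U. \<forall>\<^sub>F (u', v) in uniformity. u' = u \<longrightarrow> v \<in> U)"

instance
proof
  fix x y z :: L2 and r :: real
  show "dist x y = norm (x - y)" by (rule dist_L2_def)
  show "sgn x = x /\<^sub>R norm x" by (rule sgn_L2_def)
  show "(uniformity :: (L2 \<times> L2) filter) = (INF e\<in>{0<..}. principal {(x, y). dist x y < e})"
    by (rule uniformity_L2_def)
  show "open U \<longleftrightarrow> (\<forall>x\<in>U. \<forall>\<^sub>F (x', y) in uniformity. x' = x \<longrightarrow> y \<in> U)" for U :: "L2 set"
    by (rule open_L2_def)
  show "norm x = sqrt (inner x x)" by (rule norm_L2_def)
  have "cinner_L2 x y = cnj (cinner_L2 y x)"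
    by transfer (subst Bochner_Integration.integral_cnj [symmetric], simp add: mult.commute)
  then show "inner x y = inner y x"
    by (simp add: inner_L2_def)
  have "cinner_L2 (x + y) z = cinner_L2 x z + cinner_L2 y z"
    by transfer (auto simp: L2_rel_def distrib_right integrable_mult_cnj
        intro!: Bochner_Integration.integral_add)
  then show "inner (x + y) z = inner x z + inner y z"
    by (simp add: inner_L2_def)
  have "cinner_L2 (r *\<^sub>R x) y = complex_of_real r * cinner_L2 x y"
    by transfer (simp add: mult.assoc)
  then show "inner (r *\<^sub>R x) y = r * inner x y"
    by (simp add: inner_L2_def)
  show "0 \<le> inner x x"
    unfolding inner_L2_def
    by transfer (simp add: complex_norm_square[symmetric] del: of_real_power)
  show "inner x x = 0 \<longleftrightarrow> x = 0"
    unfolding inner_L2_def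
  proof transfer
    fix f assume f: "L2_rel f f"
    have "Re (LINT x|lborel. f x * cnj (f x)) = (LINT x|lborel. (cmod (f x))\<^sup>2)"
      by (simp add: complex_norm_square[symmetric] del: of_real_power)
    moreover have "(LINT x|lborel. (cmod (f x))\<^sup>2) = 0 \<longleftrightarrow> (AE x in lborel. f x = 0)"
      using f by (subst integral_nonneg_eq_0_iff_AE) (auto simp: L2_rel_def square_integrable_def)
    ultimately show "Re (LINT x|lborel. f x * cnj (f x)) = 0 \<longleftrightarrow> L2_rel f (\<lambda>x. 0)"
      using f by (simp add: L2_rel_def)
  qed
qed

end


section \<open>Closed subspaces, projections and the strong operator topology\<close>

definition closed_csubspace :: "L2 set \<Rightarrow> bool" where
  "closed_csubspace K \<longleftrightarrow>
     subspace K \<and> (\<forall>c. \<forall>u\<in>K. scaleC_L2 c u \<in> K) \<and> closed K"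

text \<open>The orthogonal projection onto \<open>K\<close>. The values of the type \<open>L2 \<Rightarrow>\<^sub>L L2\<close> are only required to
  be real-linear; this one is complex-linear because orthogonality refers to the complex inner
  product. Meaningful for closed subspaces \<open>K\<close>.\<close>

definition proj :: "L2 set \<Rightarrow> L2 \<Rightarrow>\<^sub>L L2" where
  "proj K = (THE P. \<forall>u. blinfun_apply P u \<in> K \<and>
                        (\<forall>v\<in>K. cinner_L2 (u - blinfun_apply P u) v = 0))"

definition projections :: "(L2 \<Rightarrow>\<^sub>L L2) set" where
  "projections = {proj K | K. closed_csubspace K}"

definition projection_topology :: "(L2 \<Rightarrow>\<^sub>L L2) topology" where
  "projection_topology = subtopology strong_operator_topology projections"


section \<open>The Hardy space\<close>

text \<open>Boundary functions of the holomorphic functions on the upper half plane whose \<open>L\<^sup>2\<close> norms on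
  horizontal lines are bounded. The boundary function is the \<open>L\<^sup>2\<close> limit of \<open>F(\<cdot> + iy)\<close>
  as \<open>y\<close> decreases to \<open>0\<close>, which agrees with the a.e. nontangential limit.\<close>

definition H2 :: "L2 set" where
  "H2 = {u. \<exists>F C. F holomorphic_on {z. Im z > 0} \<and>
            (\<forall>y>0. square_integrable (\<lambda>x. F (Complex x y)) \<and>
                   (LINT x|lborel. (cmod (F (Complex x y)))\<^sup>2) \<le> C) \<and>
            ((\<lambda>y. abs_L2 (\<lambda>x. F (Complex x y))) \<longlongrightarrow> u) (at_right 0)}"

text \<open>The subspace \<open>e\<^sup>i\<^sup>\<psi> H\<^sup>2(\<real>)\<close>. For Borel measurable \<open>\<psi>\<close> the product is square-integrable
  and its class does not depend on the representative that \<^const>\<open>rep_L2\<close> chooses.\<close>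

definition phase_H2 :: "(real \<Rightarrow> real) \<Rightarrow> L2 set" where
  "phase_H2 \<psi> = {abs_L2 (\<lambda>x. exp (\<i> * complex_of_real (\<psi> x)) * rep_L2 u x) | u. u \<in> H2}"


section \<open>Admissible functions and admissible pairs\<close>

definition twice_cont_diff_at :: "(real \<Rightarrow> real) \<Rightarrow> real \<Rightarrow> bool" where
  "twice_cont_diff_at \<psi> x \<longleftrightarrow>
     (\<exists>U. open U \<and> x \<in> U \<and>
          (\<forall>y\<in>U. \<psi> differentiable (at y)) \<and>
          (\<forall>y\<in>U. deriv \<psi> differentiable (at y)) \<and>
          continuous_on U (deriv (deriv \<psi>)))"

definition Gamma_set :: "(real \<Rightarrow> real) \<Rightarrow> real set" where
  "Gamma_set \<psi> = {x. \<not> twice_cont_diff_at \<psi> x}"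

text \<open>\<^const>\<open>deriv\<close> is unspecified where a derivative does not exist. Hence local constancy of
  the sign of the second derivative near \<open>x\<close> includes that the second derivative exists near \<open>x\<close>.
  Replacing this by another convention changes the set only at points of \<^const>\<open>Gamma_set\<close>,
  which does not affect admissibility of functions or pairs.\<close>

definition Lambda_set :: "(real \<Rightarrow> real) \<Rightarrow> real set" where
  "Lambda_set \<psi> = {x. \<not> (\<exists>U c. open U \<and> x \<in> U \<and>
          (\<forall>y\<in>U. \<psi> differentiable (at y) \<and> deriv \<psi> differentiable (at y) \<and>
                 sgn (deriv (deriv \<psi>) y) = c))}"

definition no_accumulation_points :: "real set \<Rightarrow> bool" where
  "no_accumulation_points A \<longleftrightarrow> (\<forall>x. \<not> x islimpt A)"

definition admissible :: "(real \<Rightarrow> real) \<Rightarrow> bool" where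
  "admissible \<psi> \<longleftrightarrow>
     no_accumulation_points (Gamma_set \<psi>) \<and>
     no_accumulation_points {x. (\<psi> has_real_derivative 0) (at x)} \<and>
     no_accumulation_points (Lambda_set \<psi>)"

definition pair_span :: "(real \<Rightarrow> real) \<Rightarrow> (real \<Rightarrow> real) \<Rightarrow> (real \<Rightarrow> real) set" where
  "pair_span f g = {\<lambda>x. a * f x + b * g x | a b. True}"

definition admissible_pair :: "(real \<Rightarrow> real) \<Rightarrow> (real \<Rightarrow> real) \<Rightarrow> bool" where
  "admissible_pair f g \<longleftrightarrow>
     (\<forall>a b. (\<forall>x. a * f x + b * g x = 0) \<longrightarrow> a = 0 \<and> b = 0) \<and>
     (\<forall>h \<in> pair_span f g - {\<lambda>x. 0}. admissible h) \<and>
     (\<forall>K. compact K \<longrightarrow>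
        (\<exists>N. \<forall>h \<in> pair_span f g - {\<lambda>x. 0}.
           finite (K \<inter> Lambda_set h) \<and> card (K \<inter> Lambda_set h) \<le> N))"

definition M_set :: "(real \<Rightarrow> real) set \<Rightarrow> (L2 \<Rightarrow>\<^sub>L L2) set" where
  "M_set S = {proj (phase_H2 h) | h. h \<in> S}"

end

theory Submission
  imports Defs "HOL-Complex_Analysis.Cauchy_Integral_Formula"
begin

text \<open>
  Write $P_\lambda$ for the projection onto $e^{i\psi}H^2$ with $\psi = \lambda_1 f + \lambda_2 g$. It depends
  continuously on $\lambda$. If $\psi' \ge ct > 0$ on an interval $I$, then
  $e^{i\psi(x) - \psi'(x)y}$ is almost holomorphic on the strip over $I$ and decays in $y$, so Green's formula
  bounds the pairing of $e^{-i\psi}1_I$ (smoothly cut off) with the Hardy space by $O(1/t)$; by complex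
  conjugation the same holds for the orthogonal complement where $\psi' \le -ct$. Hence, as $\lambda \to \infty$
  in the direction $\omega$, $P_\lambda$ converges strongly to multiplication by the indicator of
  $\{\omega\cdot(f',g') < 0\}$. Together with these limits the plane becomes a compact disc mapping
  continuously onto the closure; the map is injective inside, but directions with the same set
  (up to null sets) are identified. The same identifications are made by the map
  $z \mapsto \int e \frac{z\cdot e}{1-|z|+|z\cdot e|}\,dM$ of the disc, $e$ being the normalised vector $(f',g')$
  and $M$ a finite measure equivalent to Lebesgue measure. On the open disc it is the gradient of
  a strictly convex function, and its image is a compact convex body, hence a disc.
\<close>

subsection \<open>Square-integrable functions and their classes\<close>

text \<open>The obstacle is the boundary circle: directions with the same limit form arcs, and
  nothing is known about how these arcs lie. A homeomorphism is therefore not constructed by hand.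
  Two continuous maps from a compact space into Hausdorff spaces have homeomorphic images as soon as
  their fibres agree, so it suffices to find a second map of the disc that has these fibres and a
  recognisable image. Convexity of that image is obtained without computing it: the open disc fills
  exactly the points lying strictly below a support function in every direction, by invariance of
  domain and connectedness.

  On the Hilbert space side, \<open>H2_iff\<close> describes the Hardy space as the orthogonal
  complement of the Cauchy kernels with pole in the upper half plane. Closedness, conjugation and
  the separation of subspaces then become statements about these kernels. Strong limits are tested
  only on indicators of intervals that avoid a discrete set where the phase is rough or stationary.
  This is enough because all operators involved are contractions and such indicators are
  total.\<close>

lemma square_integrable_rep_L2 [simp]: "square_integrable (rep_L2 u)"
  using Quotient_rep_reflp[OF Quotient_L2] by (auto simp: L2_rel_def)

lemma abs_rep_L2 [simp]: "abs_L2 (rep_L2 u) = u"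
  by (rule Quotient_abs_rep[OF Quotient_L2])

lemma square_integrable_measurable [measurable_dest]:
  "square_integrable f \<Longrightarrow> f \<in> borel_measurable borel"
  by (simp add: square_integrable_def)

lemma measurable_rep_L2 [measurable]: "rep_L2 u \<in> borel_measurable borel"
  by (rule square_integrable_measurable) simp

lemma measurable_cnj [measurable (raw)]:
  "f \<in> borel_measurable M \<Longrightarrow> (\<lambda>x. cnj (f x :: complex)) \<in> borel_measurable M"
  by (rule borel_measurable_continuous_on[OF continuous_on_cnj[OF continuous_on_id]])

lemma abs_L2_eq_iff:
  assumes "square_integrable f" "square_integrable g"
  shows "abs_L2 f = abs_L2 g \<longleftrightarrow> (AE x in lborel. f x = g x)"
  using Quotient_rel[OF Quotient_L2, of f g] assms by (auto simp: L2_rel_def)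

lemma rep_abs_L2:
  assumes "square_integrable f"
  shows "AE x in lborel. rep_L2 (abs_L2 f) x = f x"
  using abs_L2_eq_iff[OF _ assms, of "rep_L2 (abs_L2 f)"] by simp

lemma square_integrable_AE_cong:
  assumes "square_integrable f" "g \<in> borel_measurable borel" "AE x in lborel. f x = g x"
  shows "square_integrable g"
proof -
  have "integrable lborel (\<lambda>x. (cmod (g x))\<^sup>2)"
    using assms by (subst integrable_cong_AE[where g = "\<lambda>x. (cmod (f x))\<^sup>2"])
      (auto simp: square_integrable_def)
  then show ?thesis
    using assms by (simp add: square_integrable_def)
qed

lemma square_integrable_bound:
  assumes "square_integrable f" "g \<in> borel_measurable borel" "\<And>x. cmod (g x) \<le> B * cmod (f x)"
  shows "square_integrable g"
  unfolding square_integrable_def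
proof
  show "integrable lborel (\<lambda>x. (cmod (g x))\<^sup>2)"
  proof (rule Bochner_Integration.integrable_bound)
    show "integrable lborel (\<lambda>x. B\<^sup>2 * (cmod (f x))\<^sup>2)"
      using assms(1) by (auto simp: square_integrable_def)
    have "(cmod (g x))\<^sup>2 \<le> B\<^sup>2 * (cmod (f x))\<^sup>2" for x
      using power_mono[OF assms(3)[of x] norm_ge_zero, of 2] by (simp add: power_mult_distrib)
    then show "AE x in lborel. norm ((cmod (g x))\<^sup>2) \<le> norm (B\<^sup>2 * (cmod (f x))\<^sup>2)"
      by auto
  qed (use assms in measurable)
qed (use assms in auto)

lemma square_integrable_diff:
  "square_integrable f \<Longrightarrow> square_integrable g \<Longrightarrow> square_integrable (\<lambda>x. f x - g x)"
  using square_integrable_add[of f "\<lambda>x. - 1 * g x"] square_integrable_mult_left[of g "-1"]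
  by simp

lemma square_integrable_cnj: "square_integrable f \<Longrightarrow> square_integrable (\<lambda>x. cnj (f x))"
  by (auto simp: square_integrable_def)

lemma cinner_abs_L2:
  "square_integrable f \<Longrightarrow> square_integrable g \<Longrightarrow>
    cinner_L2 (abs_L2 f) (abs_L2 g) = (LINT x|lborel. f x * cnj (g x))"
  by (rule cinner_L2.abs_eq) (auto simp: L2_rel_def)

lemma cinner_rep_L2: "cinner_L2 u v = (LINT x|lborel. rep_L2 u x * cnj (rep_L2 v x))"
  by (rule cinner_L2.rep_eq)

lemma abs_L2_add:
  "square_integrable f \<Longrightarrow> square_integrable g \<Longrightarrow> abs_L2 (\<lambda>x. f x + g x) = abs_L2 f + abs_L2 g"
  by (subst plus_L2.abs_eq) (auto simp: L2_rel_def)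

lemma abs_L2_scaleC:
  "square_integrable f \<Longrightarrow> abs_L2 (\<lambda>x. c * f x) = scaleC_L2 c (abs_L2 f)"
  by (subst scaleC_L2.abs_eq) (auto simp: L2_rel_def)

lemma abs_L2_diff:
  assumes "square_integrable f" "square_integrable g"
  shows "abs_L2 (\<lambda>x. f x - g x) = abs_L2 f - abs_L2 g"
proof -
  have "abs_L2 f = abs_L2 (\<lambda>x. f x - g x) + abs_L2 g"
    using abs_L2_add[OF square_integrable_diff[OF assms] assms(2)] by simp
  then show ?thesis by simp
qed

lemma rep_L2_diff: "AE x in lborel. rep_L2 (u - v) x = rep_L2 u x - rep_L2 v x"
  using rep_abs_L2[OF square_integrable_diff, of "rep_L2 u" "rep_L2 v"] abs_L2_diff[of "rep_L2 u" "rep_L2 v"]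
  by simp

lemma rep_L2_scaleC: "AE x in lborel. rep_L2 (scaleC_L2 c u) x = c * rep_L2 u x"
  using rep_abs_L2[OF square_integrable_mult_left, of "rep_L2 u" c] abs_L2_scaleC[of "rep_L2 u" c]
  by simp

lemma scaleR_eq_scaleC_L2: "r *\<^sub>R u = scaleC_L2 (of_real r) u"
  by transfer (auto simp: L2_rel_def square_integrable_mult_left)

lemma cinner_add_left: "cinner_L2 (u + v) w = cinner_L2 u w + cinner_L2 v w"
  by transfer (auto simp: L2_rel_def distrib_right integrable_mult_cnj
      intro!: Bochner_Integration.integral_add)

lemma cinner_commute: "cinner_L2 u v = cnj (cinner_L2 v u)"
  by transfer (subst Bochner_Integration.integral_cnj [symmetric], simp add: mult.commute)

lemma cinner_scaleC_left: "cinner_L2 (scaleC_L2 c u) v = c * cinner_L2 u v"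
  by transfer (simp add: mult.assoc)

lemma cinner_add_right: "cinner_L2 w (u + v) = cinner_L2 w u + cinner_L2 w v"
  by (metis cinner_add_left cinner_commute complex_cnj_add)

lemma cinner_scaleC_right: "cinner_L2 u (scaleC_L2 c v) = cnj c * cinner_L2 u v"
  by (metis cinner_scaleC_left cinner_commute complex_cnj_mult)

lemma cinner_diff_left: "cinner_L2 (u - v) w = cinner_L2 u w - cinner_L2 v w"
  using cinner_add_left[of "u - v" v w] by simp

lemma cinner_diff_right: "cinner_L2 w (u - v) = cinner_L2 w u - cinner_L2 w v"
  using cinner_add_right[of w "u - v" v] by simp

lemma cinner_scaleR_left: "cinner_L2 (r *\<^sub>R u) v = of_real r * cinner_L2 u v"
  by (simp add: scaleR_eq_scaleC_L2 cinner_scaleC_left)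

lemma cinner_zero_left [simp]: "cinner_L2 0 v = 0"
  using cinner_diff_left[of 0 0 v] by simp

lemma norm_L2_square: "(norm u)\<^sup>2 = (LINT x|lborel. (cmod (rep_L2 u x))\<^sup>2)"
proof -
  have "(norm u)\<^sup>2 = Re (cinner_L2 u u)"
    by (simp add: power2_norm_eq_inner inner_L2_def)
  also have "\<dots> = (LINT x|lborel. (cmod (rep_L2 u x))\<^sup>2)"
    by (simp add: cinner_rep_L2 complex_norm_square[symmetric] del: of_real_power)
  finally show ?thesis .
qed

lemma norm_abs_L2_square:
  assumes "square_integrable f"
  shows "(norm (abs_L2 f))\<^sup>2 = (LINT x|lborel. (cmod (f x))\<^sup>2)"
  unfolding norm_L2_square
  by (rule integral_cong_AE) (use rep_abs_L2[OF assms] assms in \<open>auto elim!: eventually_mono\<close>)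

lemma cinner_self: "cinner_L2 u u = of_real ((norm u)\<^sup>2)"
proof -
  have "Im (cinner_L2 u u) = 0"
    using cinner_commute[of u u] by (simp add: complex_eq_iff)
  then show ?thesis
    by (simp add: complex_eq_iff power2_norm_eq_inner inner_L2_def)
qed

lemma norm_scaleC_L2 [simp]: "norm (scaleC_L2 c u) = cmod c * norm u"
proof -
  have "cinner_L2 (scaleC_L2 c u) (scaleC_L2 c u) = (c * cnj c) * cinner_L2 u u"
    by (simp add: cinner_scaleC_left cinner_scaleC_right)
  then have "(of_real ((norm (scaleC_L2 c u))\<^sup>2) :: complex) = of_real ((cmod c * norm u)\<^sup>2)"
    unfolding cinner_self complex_norm_square[symmetric] power_mult_distrib of_real_mult .
  then have "(norm (scaleC_L2 c u))\<^sup>2 = (cmod c * norm u)\<^sup>2"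
    by (simp only: of_real_eq_iff)
  then show ?thesis
    by (simp add: power2_eq_iff_nonneg)
qed

lemma cinner_Cauchy_Schwarz: "cmod (cinner_L2 u v) \<le> norm u * norm v"
proof (cases "cinner_L2 u v = 0")
  case False
  define c where "c = cnj (sgn (cinner_L2 u v))"
  have c: "cmod c = 1"
    using False by (simp add: c_def norm_sgn)
  have "c * cinner_L2 u v = of_real (cmod (cinner_L2 u v))"
    using False by (simp add: c_def sgn_div_norm scaleR_conv_of_real complex_norm_square[symmetric]
        mult.commute power2_eq_square field_simps)
  then have "cmod (cinner_L2 u v) = inner (scaleC_L2 c u) v"
    by (simp add: inner_L2_def cinner_scaleC_left)
  also have "\<dots> \<le> norm (scaleC_L2 c u) * norm v"
    by (rule norm_cauchy_schwarz)
  finally show ?thesis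
    by (simp add: c)
qed auto

lemma bounded_linear_cinner_left: "bounded_linear (\<lambda>u. cinner_L2 u v)"
  by (rule bounded_linear_intro[where K = "norm v"])
    (auto simp: cinner_add_left cinner_scaleR_left scaleR_conv_of_real cinner_Cauchy_Schwarz)

lemma bounded_linear_scaleC_L2: "bounded_linear (scaleC_L2 c)"
proof (rule bounded_linear_intro[where K = "cmod c"])
  show "scaleC_L2 c (u + v) = scaleC_L2 c u + scaleC_L2 c v" for u v
    by transfer (auto simp: L2_rel_def square_integrable_add square_integrable_mult_left algebra_simps)
  show "scaleC_L2 c (r *\<^sub>R u) = r *\<^sub>R scaleC_L2 c u" for r u
    by transfer (auto simp: L2_rel_def square_integrable_mult_left mult.left_commute)
qed (simp add: mult.commute)

lemma tendsto_L2_iff_integral: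
  assumes "\<forall>\<^sub>F n in F. square_integrable (g n)" "square_integrable h"
  shows "((\<lambda>n. abs_L2 (g n)) \<longlongrightarrow> abs_L2 h) F \<longleftrightarrow>
    ((\<lambda>n. LINT x|lborel. (cmod (g n x - h x))\<^sup>2) \<longlongrightarrow> 0) F"
proof -
  have "((\<lambda>n. abs_L2 (g n)) \<longlongrightarrow> abs_L2 h) F \<longleftrightarrow> ((\<lambda>n. norm (abs_L2 (g n) - abs_L2 h)) \<longlongrightarrow> 0) F"
    by (subst Lim_null, subst tendsto_norm_zero_iff) rule
  also have "\<dots> \<longleftrightarrow> ((\<lambda>n. (norm (abs_L2 (g n) - abs_L2 h))\<^sup>2) \<longlongrightarrow> 0) F"
  proof
    assume "((\<lambda>n. norm (abs_L2 (g n) - abs_L2 h)) \<longlongrightarrow> 0) F"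
    from tendsto_power[OF this, of 2]
    show "((\<lambda>n. (norm (abs_L2 (g n) - abs_L2 h))\<^sup>2) \<longlongrightarrow> 0) F" by simp
  next
    assume "((\<lambda>n. (norm (abs_L2 (g n) - abs_L2 h))\<^sup>2) \<longlongrightarrow> 0) F"
    from tendsto_real_sqrt[OF this]
    show "((\<lambda>n. norm (abs_L2 (g n) - abs_L2 h)) \<longlongrightarrow> 0) F" by simp
  qed
  also have "\<dots> \<longleftrightarrow> ((\<lambda>n. LINT x|lborel. (cmod (g n x - h x))\<^sup>2) \<longlongrightarrow> 0) F"
  proof (rule tendsto_cong)
    show "\<forall>\<^sub>F n in F. (norm (abs_L2 (g n) - abs_L2 h))\<^sup>2 = (LINT x|lborel. (cmod (g n x - h x))\<^sup>2)"
      using assms(1)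
      by eventually_elim (simp add: assms(2) norm_abs_L2_square square_integrable_diff
          flip: abs_L2_diff)
  qed
  finally show ?thesis .
qed

subsection \<open>The Poisson kernel\<close>

lemma DERIV_arctan_Poisson:
  fixes c y x :: real
  assumes "y > 0"
  shows "((\<lambda>x. arctan ((x - c) / y)) has_real_derivative y / ((x - c)\<^sup>2 + y\<^sup>2)) (at x)"
proof -
  have "((\<lambda>x. arctan ((x - c) / y)) has_real_derivative (1 / y) * inverse (1 + ((x - c) / y)\<^sup>2)) (at x)"
    using assms by (auto intro!: derivative_eq_intros)
  moreover have "1 + ((x - c) / y)\<^sup>2 = ((x - c)\<^sup>2 + y\<^sup>2) / y\<^sup>2"
    using assms by (simp add: power_divide divide_simps)
  then have "(1 / y) * inverse (1 + ((x - c) / y)\<^sup>2) = y / ((x - c)\<^sup>2 + y\<^sup>2)"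
    using assms by (simp add: power2_eq_square)
  ultimately show ?thesis
    by simp
qed

lemma has_bochner_integral_Poisson:
  fixes c y :: real
  assumes y: "y > 0"
  shows "has_bochner_integral lborel (\<lambda>x. y / ((x - c)\<^sup>2 + y\<^sup>2)) pi"
proof -
  let ?f = "\<lambda>x. y / ((x - c)\<^sup>2 + y\<^sup>2)" and ?F = "\<lambda>x. arctan ((x - c) / y)"
  have D: "DERIV ?F x :> ?f x" for x
    using y by (rule DERIV_arctan_Poisson)
  have t1: "filterlim (\<lambda>x. (x - c) / y) at_top at_top"
    using y by real_asymp
  have t2: "filterlim (\<lambda>x. (x - c) / y) at_bot at_bot"
    using y by real_asymp
  have pos: "(x - c)\<^sup>2 + y\<^sup>2 \<noteq> 0" for x
    using y by (simp add: add_nonneg_eq_0_iff)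
  have B: "((?F \<circ> real_of_ereal) \<longlongrightarrow> pi / 2) (at_left \<infinity>)"
    unfolding ereal_tendsto_simps by (rule filterlim_compose[OF tendsto_arctan_at_top t1])
  have A: "((?F \<circ> real_of_ereal) \<longlongrightarrow> - (pi / 2)) (at_right (-\<infinity>))"
    unfolding ereal_tendsto_simps by (rule filterlim_compose[OF tendsto_arctan_at_bot t2])
  have C: "isCont ?f x" for x
    using pos by (intro continuous_intros)
  have N: "AE x in lborel. -\<infinity> < ereal x \<longrightarrow> ereal x < \<infinity> \<longrightarrow> 0 \<le> ?f x"
    using y by simp
  note * = interval_integral_FTC_nonneg[OF _ D C N A B, simplified]
  have [simp]: "einterval (-\<infinity>) \<infinity> = UNIV"
    by (auto simp: einterval_def)
  show ?thesis
    using * by (simp add: has_bochner_integral_iff interval_lebesgue_integral_def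
        set_integrable_def set_lebesgue_integral_def)
qed

lemma integral_Poisson_interval:
  fixes c y :: real
  assumes y: "y > 0" and pq: "p \<le> q"
  shows "(LINT t|lborel. indicator {p..q} t * (y / ((t - c)\<^sup>2 + y\<^sup>2))) =
    arctan ((q - c) / y) - arctan ((p - c) / y)"
proof -
  have D: "DERIV (\<lambda>x. arctan ((x - c) / y)) x :> y / ((x - c)\<^sup>2 + y\<^sup>2)" for x
    using y by (rule DERIV_arctan_Poisson)
  show ?thesis
    using integral_FTC_Icc_real[OF pq, of "\<lambda>x. arctan ((x - c) / y)" "\<lambda>x. y / ((x - c)\<^sup>2 + y\<^sup>2)"] D y
    by (simp add: mult.commute add_nonneg_eq_0_iff)
qed

text \<open>Cauchy kernel with pole \<open>w\<close>. Its class lies in \<open>H2\<close> for poles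
  in the lower half plane and is orthogonal to \<open>H2\<close> for poles in the upper one
  (\<open>ker_L2_in_H2\<close>, \<open>H2_orthogonal_ker\<close>). As it has no zeros for nonreal
  \<open>w\<close>, it also serves as a test function that sees almost every point.\<close>

definition cker :: "complex \<Rightarrow> real \<Rightarrow> complex" where
  "cker w t = 1 / (of_real t - w)"

lemma measurable_cker [measurable]: "cker w \<in> borel_measurable borel"
  unfolding cker_def by measurable

lemma cmod_cker_square: "(cmod (cker w t))\<^sup>2 = 1 / ((t - Re w)\<^sup>2 + (Im w)\<^sup>2)"
  by (simp add: cker_def norm_divide cmod_power2 power_divide)

lemma square_integrable_cker_norm:
  assumes "Im w \<noteq> 0"
  shows "square_integrable (cker w)" "(LINT t|lborel. (cmod (cker w t))\<^sup>2) = pi / \<bar>Im w\<bar>"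
proof -
  have "has_bochner_integral lborel (\<lambda>x. (1 / \<bar>Im w\<bar>) * (\<bar>Im w\<bar> / ((x - Re w)\<^sup>2 + \<bar>Im w\<bar>\<^sup>2))) ((1 / \<bar>Im w\<bar>) * pi)"
    using assms by (intro has_bochner_integral_mult_right has_bochner_integral_Poisson) auto
  then have *: "has_bochner_integral lborel (\<lambda>x. (cmod (cker w x))\<^sup>2) (pi / \<bar>Im w\<bar>)"
    using assms by (simp add: cmod_cker_square)
  then show "square_integrable (cker w)" "(LINT t|lborel. (cmod (cker w t))\<^sup>2) = pi / \<bar>Im w\<bar>"
    by (auto simp: square_integrable_def has_bochner_integral_iff)
qed

lemma cnj_cker: "cnj (cker w t) = cker (cnj w) t"
  by (simp add: cker_def)

lemma cker_nonzero:
  assumes "Im w \<noteq> 0"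
  shows "cker w t \<noteq> 0"
proof -
  have "of_real t - w \<noteq> 0"
    using assms by (auto simp: complex_eq_iff)
  then show ?thesis
    by (simp add: cker_def)
qed

subsection \<open>Completeness and orthogonal projections\<close>

lemma norm_abs_L2_cmod:
  assumes "square_integrable f"
  shows "square_integrable (\<lambda>x. of_real (cmod (f x)))"
    "norm (abs_L2 (\<lambda>x. of_real (cmod (f x)))) = norm (abs_L2 f)"
proof -
  show *: "square_integrable (\<lambda>x. of_real (cmod (f x)))"
    using assms by (intro square_integrable_bound[OF assms, where B = 1]) (auto simp: square_integrable_def)
  have "(norm (abs_L2 (\<lambda>x. of_real (cmod (f x)))))\<^sup>2 = (norm (abs_L2 f))\<^sup>2"
    using assms * by (simp add: norm_abs_L2_square)
  then show "norm (abs_L2 (\<lambda>x. of_real (cmod (f x)))) = norm (abs_L2 f)"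
    by (simp add: power2_eq_iff_nonneg)
qed

lemma integral_cmod_mult_le:
  assumes "square_integrable f" "square_integrable g"
  shows "integrable lborel (\<lambda>x. cmod (f x) * cmod (g x))"
    "(LINT x|lborel. cmod (f x) * cmod (g x)) \<le> norm (abs_L2 f) * norm (abs_L2 g)"
proof -
  show "integrable lborel (\<lambda>x. cmod (f x) * cmod (g x))"
    using integrable_norm[OF integrable_mult_cnj[OF assms]] by (simp add: norm_mult)
  have "complex_of_real (LINT x|lborel. cmod (f x) * cmod (g x)) =
    cinner_L2 (abs_L2 (\<lambda>x. of_real (cmod (f x)))) (abs_L2 (\<lambda>x. of_real (cmod (g x))))"
    using assms by (simp add: cinner_abs_L2 norm_abs_L2_cmod flip: integral_complex_of_real of_real_mult)
  then have "\<bar>LINT x|lborel. cmod (f x) * cmod (g x)\<bar> \<le> norm (abs_L2 f) * norm (abs_L2 g)"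
    using cinner_Cauchy_Schwarz[of "abs_L2 (\<lambda>x. of_real (cmod (f x)))" "abs_L2 (\<lambda>x. of_real (cmod (g x)))"]
      assms by (metis norm_abs_L2_cmod(2) norm_of_real)
  then show "(LINT x|lborel. cmod (f x) * cmod (g x)) \<le> norm (abs_L2 f) * norm (abs_L2 g)"
    by simp
qed

lemma nn_integral_cmod_square:
  "square_integrable f \<Longrightarrow> (\<integral>\<^sup>+x. ennreal ((cmod (f x))\<^sup>2) \<partial>lborel) = ennreal ((norm (abs_L2 f))\<^sup>2)"
  by (subst nn_integral_eq_integral) (auto simp: norm_abs_L2_square square_integrable_def)

lemma square_integrable_of_nn_integral:
  assumes [measurable]: "f \<in> borel_measurable borel"
    and "(\<integral>\<^sup>+x. ennreal ((cmod (f x))\<^sup>2) \<partial>lborel) \<le> ennreal (B\<^sup>2)" "B \<ge> 0"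
  shows "square_integrable f" "norm (abs_L2 f) \<le> B"
proof -
  show *: "square_integrable f"
    using assms(2) by (auto simp: square_integrable_def integrable_iff_bounded intro: le_less_trans)
  have "(norm (abs_L2 f))\<^sup>2 \<le> B\<^sup>2"
    using assms(2) by (simp add: nn_integral_cmod_square[OF *])
  then show "norm (abs_L2 f) \<le> B"
    using assms(3) by (rule power2_le_imp_le)
qed

text \<open>Fatou's lemma gives the square-integrability of the limit together with its norm bound.
  The completeness proof needs both, since the limit is known there only pointwise.\<close>

lemma L2_Fatou:
  assumes g: "\<And>n. square_integrable (g n)" "\<forall>\<^sub>F n in sequentially. norm (abs_L2 (g n)) \<le> B"
    and [measurable]: "h \<in> borel_measurable borel"
    and lim: "AE x in lborel. (\<lambda>n. g n x) \<longlonglongrightarrow> h x" and B: "B \<ge> 0"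
  shows "square_integrable h" "norm (abs_L2 h) \<le> B"
proof -
  have [measurable]: "g n \<in> borel_measurable borel" for n
    using g(1) by (rule square_integrable_measurable)
  have "(\<integral>\<^sup>+x. ennreal ((cmod (h x))\<^sup>2) \<partial>lborel) =
    (\<integral>\<^sup>+x. liminf (\<lambda>n. ennreal ((cmod (g n x))\<^sup>2)) \<partial>lborel)"
  proof (rule nn_integral_cong_AE, use lim in eventually_elim)
    case (elim x)
    have "(\<lambda>n. ennreal ((cmod (g n x))\<^sup>2)) \<longlonglongrightarrow> ennreal ((cmod (h x))\<^sup>2)"
      by (intro tendsto_intros tendsto_ennrealI elim)
    then show ?case
      by (rule lim_imp_Liminf[OF sequentially_bot, symmetric])
  qed
  also have "\<dots> \<le> liminf (\<lambda>n. \<integral>\<^sup>+x. ennreal ((cmod (g n x))\<^sup>2) \<partial>lborel)"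
    by (rule nn_integral_liminf) measurable
  also have "\<dots> \<le> ennreal (B\<^sup>2)"
  proof (rule Liminf_le)
    show "\<forall>\<^sub>F n in sequentially. (\<integral>\<^sup>+x. ennreal ((cmod (g n x))\<^sup>2) \<partial>lborel) \<le> ennreal (B\<^sup>2)"
      using g(2) by eventually_elim (simp add: nn_integral_cmod_square g(1) power_mono)
  qed simp
  finally show "square_integrable h" "norm (abs_L2 h) \<le> B"
    using B by (intro square_integrable_of_nn_integral; simp)+
qed

text \<open>Riesz-Fischer: a subsequence with increments of norm at most \<open>(1/2) ^ k\<close>
  converges almost everywhere, and \<open>L2_Fatou\<close>, applied to the differences from a fixed
  term, turns the pointwise limit into a norm limit.\<close>

instance L2 :: complete_space
proof
  fix X :: "nat \<Rightarrow> L2" assume X: "Cauchy X"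
  have "\<exists>N. \<forall>m\<ge>N. \<forall>k\<ge>N. norm (X m - X k) < (1/2) ^ n" for n :: nat
    using CauchyD[OF X, of "(1/2) ^ n"] by simp
  then obtain N where N: "\<And>n m k. m \<ge> N n \<Longrightarrow> k \<ge> N n \<Longrightarrow> norm (X m - X k) < (1/2) ^ n"
    by metis
  \<comment> \<open>Summing makes \<open>r\<close> strictly increasing and at least
    \<open>N\<close>, which itself need not be monotone.\<close>
  define r where "r n = n + (\<Sum>i\<le>n. N i)" for n
  have r_ge: "r n \<ge> N n" "r n \<ge> n" for n
    using member_le_sum[of n "{..n}" N] by (auto simp: r_def)
  have r_mono: "strict_mono r"
    by (rule strict_monoI_Suc) (simp add: r_def)
  define d where "d k = X (r (Suc k)) - X (r k)" for k
  have d: "norm (d k) \<le> (1/2) ^ k" for k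
    using N[of k "r (Suc k)" "r k"] r_ge[of k] strict_monoD[OF r_mono, of k "Suc k"] by (simp add: d_def)
  \<comment> \<open>A square-integrable weight without zeros. Cauchy-Schwarz bounds the integrals of
    the weighted increments by a geometric series, so the weighted series converges absolutely
    almost everywhere; dividing by the weight removes it again.\<close>
  let ?w = "cker \<i>"
  have w: "square_integrable ?w"
    by (rule square_integrable_cker_norm) simp
  have "(\<integral>\<^sup>+x. (\<Sum>k. ennreal (cmod (rep_L2 (d k) x) * cmod (?w x))) \<partial>lborel) =
      (\<Sum>k. \<integral>\<^sup>+x. ennreal (cmod (rep_L2 (d k) x) * cmod (?w x)) \<partial>lborel)"
    by (rule nn_integral_suminf) measurable
  also have "\<dots> \<le> (\<Sum>k. ennreal ((1/2) ^ k * norm (abs_L2 ?w)))"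
  proof (rule suminf_le)
    fix k
    have "(\<integral>\<^sup>+x. ennreal (cmod (rep_L2 (d k) x) * cmod (?w x)) \<partial>lborel) =
        ennreal (LINT x|lborel. cmod (rep_L2 (d k) x) * cmod (?w x))"
      by (rule nn_integral_eq_integral) (auto intro: integral_cmod_mult_le w)
    also have "\<dots> \<le> ennreal ((1/2) ^ k * norm (abs_L2 ?w))"
      using integral_cmod_mult_le(2)[OF square_integrable_rep_L2[of "d k"] w] d[of k]
      by (intro ennreal_leI order.trans[OF _ mult_right_mono[OF d]]) auto
    finally show "(\<integral>\<^sup>+x. ennreal (cmod (rep_L2 (d k) x) * cmod (?w x)) \<partial>lborel)
        \<le> ennreal ((1/2) ^ k * norm (abs_L2 ?w))" .
  qed auto
  also have "\<dots> < \<infinity>"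
    by (subst suminf_ennreal2) (auto intro!: summable_mult2 summable_geometric)
  finally have "AE x in lborel. (\<Sum>k. ennreal (cmod (rep_L2 (d k) x) * cmod (?w x))) \<noteq> \<infinity>"
    by (intro nn_integral_PInf_AE) auto
  moreover have "AE x in lborel. \<forall>k. rep_L2 (d k) x = rep_L2 (X (r (Suc k))) x - rep_L2 (X (r k)) x"
    unfolding AE_all_countable d_def by (intro allI rep_L2_diff)
  ultimately have conv: "AE x in lborel. convergent (\<lambda>n. rep_L2 (X (r n)) x)"
  proof eventually_elim
    case (elim x)
    have "summable (\<lambda>k. cmod (rep_L2 (d k) x) * cmod (?w x))"
      using elim(1) by (intro summable_suminf_not_top) auto
    then have "summable (\<lambda>k. (cmod (rep_L2 (d k) x) * cmod (?w x)) * inverse (cmod (?w x)))"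
      by (rule summable_mult2)
    then have "summable (\<lambda>k. cmod (rep_L2 (d k) x))"
      using cker_nonzero[of \<i> x] by (simp add: mult.assoc)
    then have "summable (\<lambda>k. rep_L2 (d k) x)"
      by (rule summable_norm_cancel)
    then have "convergent (\<lambda>n. rep_L2 (X (r 0)) x + (\<Sum>k<n. rep_L2 (d k) x))"
      by (intro convergent_add convergent_const) (simp add: summable_iff_convergent)
    moreover have "(\<Sum>k<n. rep_L2 (d k) x) = rep_L2 (X (r n)) x - rep_L2 (X (r 0)) x" for n
      using elim(2) sum_lessThan_telescope[of "\<lambda>k. rep_L2 (X (r k)) x" n] by simp
    ultimately show ?case by simp
  qed
  define h where "h x = lim (\<lambda>n. rep_L2 (X (r n)) x)" for x
  have [measurable]: "h \<in> borel_measurable borel"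
    unfolding h_def by measurable
  have h: "AE x in lborel. (\<lambda>n. rep_L2 (X (r n)) x) \<longlonglongrightarrow> h x"
    using conv by eventually_elim (simp add: h_def convergent_LIMSEQ_iff)
  have F: "square_integrable (\<lambda>x. h x - rep_L2 (X (r n)) x)"
      "norm (abs_L2 (\<lambda>x. h x - rep_L2 (X (r n)) x)) \<le> (1/2) ^ n" for n
  proof -
    have "\<forall>\<^sub>F m in sequentially. norm (abs_L2 (\<lambda>x. rep_L2 (X (r m)) x - rep_L2 (X (r n)) x)) \<le> (1/2) ^ n"
      using eventually_ge_at_top[of n]
    proof eventually_elim
      case (elim m)
      have "r n \<le> r m"
        using elim r_mono by (simp add: strict_mono_less_eq)
      then show ?case
        using N[of n "r m" "r n"] r_ge[of n] by (simp add: abs_L2_diff)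
    qed
    moreover have "AE x in lborel. (\<lambda>m. rep_L2 (X (r m)) x - rep_L2 (X (r n)) x) \<longlonglongrightarrow> h x - rep_L2 (X (r n)) x"
      using h by eventually_elim (intro tendsto_intros)
    moreover have "square_integrable (\<lambda>x. rep_L2 (X (r m)) x - rep_L2 (X (r n)) x)" for m
      by (simp add: square_integrable_diff)
    moreover have "(\<lambda>x. h x - rep_L2 (X (r n)) x) \<in> borel_measurable borel" "(1/2) ^ n \<ge> (0::real)"
      by simp_all
    ultimately show "square_integrable (\<lambda>x. h x - rep_L2 (X (r n)) x)"
      "norm (abs_L2 (\<lambda>x. h x - rep_L2 (X (r n)) x)) \<le> (1/2) ^ n"
      using L2_Fatou[of "\<lambda>m x. rep_L2 (X (r m)) x - rep_L2 (X (r n)) x" "(1/2) ^ n"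
          "\<lambda>x. h x - rep_L2 (X (r n)) x"] by blast+
  qed
  have sh: "square_integrable h"
    using square_integrable_add[OF F(1)[of 0] square_integrable_rep_L2[of "X (r 0)"]] by simp
  have "norm (abs_L2 h - X (r n)) \<le> (1/2) ^ n" for n
    using F(2)[of n] sh by (simp add: abs_L2_diff)
  then have "(\<lambda>n. abs_L2 h - X (r n)) \<longlonglongrightarrow> 0"
    by (intro Lim_null_comparison[OF _ LIMSEQ_realpow_zero[of "1/2"]]) auto
  then have "(\<lambda>n. X (r n)) \<longlonglongrightarrow> abs_L2 h"
    using tendsto_diff[OF tendsto_const[of "abs_L2 h"], of "\<lambda>n. abs_L2 h - X (r n)" 0] by simp
  then have "X \<longlonglongrightarrow> abs_L2 h"
    using X r_mono Cauchy_converges_subseq[of X r] by (auto simp: comp_def)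
  then show "convergent X"
    by (auto simp: convergent_def)
qed

text \<open>By the parallelogram law (\<open>par\<close>) every sequence minimising the distance to
  \<open>u\<close> is Cauchy. At its limit, the distance cannot decrease along any direction in
  \<open>K\<close>, which is orthogonality.\<close>

lemma orthogonal_projection_exists:
  fixes K :: "'a::{real_inner, complete_space} set"
  assumes K: "subspace K" "closed K"
  shows "\<exists>p\<in>K. \<forall>v\<in>K. inner (u - p) v = 0"
proof -
  define d where "d = (INF p\<in>K. (norm (u - p))\<^sup>2)"
  have K0: "K \<noteq> {}"
    using K(1) subspace_0 by blast
  have bdd: "bdd_below ((\<lambda>p. (norm (u - p))\<^sup>2) ` K)"
    by (rule bdd_belowI[of _ 0]) auto
  have dle: "d \<le> (norm (u - p))\<^sup>2" if "p \<in> K" for p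
    unfolding d_def using bdd that by (rule cINF_lower)
  define r where "r n = inverse (real (Suc n))" for n
  have "\<exists>p\<in>K. (norm (u - p))\<^sup>2 < d + r n" for n
    using K0 bdd by (subst cINF_less_iff[symmetric]) (auto simp: d_def r_def)
  then obtain p where p: "\<And>n. p n \<in> K" "\<And>n. (norm (u - p n))\<^sup>2 < d + r n"
    by metis
  have par: "(norm (a - b))\<^sup>2 \<le> 2 * ((norm (u - a))\<^sup>2 - d) + 2 * ((norm (u - b))\<^sup>2 - d)"
    if "a \<in> K" "b \<in> K" for a b
  proof -
    have "(1/2) *\<^sub>R (a + b) \<in> K"
      using that K(1) by (simp add: subspace_add subspace_mul)
    from dle[OF this] have "4 * d \<le> 4 * (norm (u - (1/2) *\<^sub>R (a + b)))\<^sup>2"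
      by simp
    also have "\<dots> = 2 * (norm (u - a))\<^sup>2 + 2 * (norm (u - b))\<^sup>2 - (norm (a - b))\<^sup>2"
      by (simp add: power2_norm_eq_inner inner_diff_left inner_diff_right inner_add_left inner_add_right
          inner_commute algebra_simps)
    finally show ?thesis by simp
  qed
  have "Cauchy p"
  proof (rule CauchyI)
    fix e :: real assume e: "e > 0"
    obtain N where N: "r N < e\<^sup>2 / 4"
      using reals_Archimedean[of "e\<^sup>2 / 4"] e by (auto simp: r_def)
    have aux: "x < e2" if "x \<le> 2 * (A - d) + 2 * (B - d)" "A < d + a" "B < d + b" "a \<le> c" "b \<le> c" "c < e2 / 4"
      for x A B a b c e2 :: real
      using that by argo
    have "norm (p m - p n) < e" if "m \<ge> N" "n \<ge> N" for m n
    proof -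
      have "r m \<le> r N" "r n \<le> r N"
        using that by (simp_all add: r_def le_imp_inverse_le)
      then have "(norm (p m - p n))\<^sup>2 < e\<^sup>2"
        by (rule aux[OF par[OF p(1)[of m] p(1)[of n]] p(2)[of m] p(2)[of n] _ _ N])
      then show ?thesis
        using e by (simp add: power2_less_imp_less)
    qed
    then show "\<exists>N. \<forall>m\<ge>N. \<forall>n\<ge>N. norm (p m - p n) < e" by blast
  qed
  then obtain q where q: "p \<longlonglongrightarrow> q"
    using Cauchy_convergent convergent_def by blast
  have qK: "q \<in> K"
    using K(2) p(1) q by (rule closed_sequentially)
  have "(norm (u - q))\<^sup>2 \<le> d"
  proof (rule LIMSEQ_le)
    show "(\<lambda>n. (norm (u - p n))\<^sup>2) \<longlonglongrightarrow> (norm (u - q))\<^sup>2"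
      by (intro tendsto_intros q)
    show "(\<lambda>n. d + inverse (real (Suc n))) \<longlonglongrightarrow> d"
      using LIMSEQ_inverse_real_of_nat_add .
    show "\<exists>N. \<forall>n\<ge>N. (norm (u - p n))\<^sup>2 \<le> d + inverse (real (Suc n))"
      using p(2) less_imp_le unfolding r_def by blast
  qed
  then have dq: "(norm (u - q))\<^sup>2 = d"
    using dle[OF qK] by simp
  have ex: "(norm (w - t *\<^sub>R v))\<^sup>2 = (norm w)\<^sup>2 - 2 * t * inner w v + t\<^sup>2 * (norm v)\<^sup>2"
    for w v :: 'a and t :: real
    unfolding power2_norm_eq_inner
    by (simp add: inner_diff_left inner_diff_right inner_commute power2_eq_square)
  have "inner (u - q) v = 0" if v: "v \<in> K" for v
  proof (cases "v = 0")
    case False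
    \<comment> \<open>The parameter that minimises the quadratic polynomial \<open>ex\<close> in
      \<open>t\<close> for \<open>w = u - q\<close>.\<close>
    let ?t = "inner (u - q) v / (norm v)\<^sup>2"
    have "q + ?t *\<^sub>R v \<in> K"
      using qK v K(1) by (simp add: subspace_add subspace_mul)
    from dle[OF this] have "d \<le> (norm (u - q - ?t *\<^sub>R v))\<^sup>2"
      by (simp add: algebra_simps)
    also have "\<dots> = (norm (u - q))\<^sup>2 - 2 * ?t * inner (u - q) v + ?t\<^sup>2 * (norm v)\<^sup>2"
      by (rule ex)
    also have "\<dots> = d - (inner (u - q) v)\<^sup>2 / (norm v)\<^sup>2"
      unfolding dq using False by (simp add: power2_eq_square)
    finally have "(inner (u - q) v)\<^sup>2 / (norm v)\<^sup>2 \<le> 0" by simp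
    then show ?thesis
      using False by (simp add: divide_le_0_iff)
  qed simp
  with qK show ?thesis by blast
qed

text \<open>Testing with \<open>v\<close> kills the real part of the complex inner product, testing
  with i times \<open>v\<close> its imaginary part.\<close>

lemma csubspace_orthogonalI:
  assumes K: "closed_csubspace K" and o: "\<And>v. v \<in> K \<Longrightarrow> inner w v = 0" and v: "v \<in> K"
  shows "cinner_L2 w v = 0"
proof -
  have "scaleC_L2 \<i> v \<in> K"
    using K v by (simp add: closed_csubspace_def)
  from o[OF this] o[OF v] show ?thesis
    by (simp add: inner_L2_def cinner_scaleC_right complex_eq_iff)
qed

lemma proj_unique:
  assumes K: "closed_csubspace K" and "p \<in> K" "\<And>v. v \<in> K \<Longrightarrow> cinner_L2 (u - p) v = 0"
    and "q \<in> K" "\<And>v. v \<in> K \<Longrightarrow> cinner_L2 (u - q) v = 0"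
  shows "p = q"
proof -
  have "p - q \<in> K"
    using assms by (simp add: closed_csubspace_def subspace_diff)
  then have "cinner_L2 ((u - q) - (u - p)) (p - q) = 0"
    using cinner_diff_left[of "u - q" "u - p" "p - q"] assms(3,5) by (metis diff_zero)
  then show ?thesis
    by (simp add: cinner_self)
qed

text \<open>Justifies the definite description in \<open>proj\<close>. The nearest point for the
  real inner product is orthogonal for the complex one as well; uniqueness makes it depend linearly
  on \<open>u\<close>, and Cauchy-Schwarz makes it bounded.\<close>

lemma proj_props:
  assumes K: "closed_csubspace K"
  shows "blinfun_apply (proj K) u \<in> K" "v \<in> K \<Longrightarrow> cinner_L2 (u - blinfun_apply (proj K) u) v = 0"
proof -
  have "\<exists>p\<in>K. \<forall>v\<in>K. cinner_L2 (u - p) v = 0" for u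
    using orthogonal_projection_exists[of K u] csubspace_orthogonalI[OF K] K
    by (meson closed_csubspace_def)
  then obtain p where p: "\<And>u. p u \<in> K" "\<And>u v. v \<in> K \<Longrightarrow> cinner_L2 (u - p u) v = 0"
    by metis
  have sub: "subspace K"
    using K by (simp add: closed_csubspace_def)
  have bl: "bounded_linear p"
  proof (rule bounded_linear_intro[where K = 1])
    fix u v :: L2 and r :: real
    show "p (u + v) = p u + p v"
      by (rule proj_unique[OF K, of _ "u + v"])
        (use sub p in \<open>auto simp: subspace_add add_diff_add cinner_add_left\<close>)
    show "p (r *\<^sub>R u) = r *\<^sub>R p u"
      by (rule proj_unique[OF K, of _ "r *\<^sub>R u"])
        (use sub p in \<open>auto simp: subspace_mul cinner_scaleR_left simp flip: scaleR_diff_right\<close>)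
    have "cinner_L2 u (p u) = cinner_L2 (p u) (p u)"
      using p(2)[OF p(1)[of u], of u] by (simp add: cinner_diff_left)
    then have "(norm (p u))\<^sup>2 = cmod (cinner_L2 u (p u))"
      by (simp only: cinner_self norm_of_real) simp
    also have "\<dots> \<le> norm u * norm (p u)"
      by (rule cinner_Cauchy_Schwarz)
    finally show "norm (p u) \<le> norm u * 1"
      by (cases "p u = 0") (simp_all add: power2_eq_square)
  qed
  have ex: "\<forall>u. blinfun_apply (Blinfun p) u \<in> K \<and> (\<forall>v\<in>K. cinner_L2 (u - blinfun_apply (Blinfun p) u) v = 0)"
    using p by (simp add: bounded_linear_Blinfun_apply[OF bl])
  let ?P = "\<lambda>P. \<forall>u. blinfun_apply P u \<in> K \<and> (\<forall>v\<in>K. cinner_L2 (u - blinfun_apply P u) v = 0)"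
  have "?P (proj K)"
    unfolding proj_def
  proof (rule theI[of ?P, OF ex])
    fix P assume P: "\<forall>u. blinfun_apply P u \<in> K \<and> (\<forall>v\<in>K. cinner_L2 (u - blinfun_apply P u) v = 0)"
    show "P = Blinfun p"
    proof (rule blinfun_eqI)
      fix u show "blinfun_apply P u = blinfun_apply (Blinfun p) u"
        by (rule proj_unique[OF K, of _ u]) (use P ex in auto)
    qed
  qed
  then show "blinfun_apply (proj K) u \<in> K" "v \<in> K \<Longrightarrow> cinner_L2 (u - blinfun_apply (proj K) u) v = 0"
    by auto
qed

lemma proj_eqI:
  assumes "closed_csubspace K" "p \<in> K" "\<And>v. v \<in> K \<Longrightarrow> cinner_L2 (u - p) v = 0"
  shows "blinfun_apply (proj K) u = p"
  by (rule proj_unique[OF assms(1), of _ u]) (use proj_props[OF assms(1)] assms in auto)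

lemma proj_eq_self_iff:
  assumes "closed_csubspace K"
  shows "blinfun_apply (proj K) u = u \<longleftrightarrow> u \<in> K"
  using proj_props(1)[OF assms, of u] proj_eqI[OF assms, of u u] by auto

lemma norm_proj_le:
  assumes K: "closed_csubspace K"
  shows "norm (blinfun_apply (proj K) u) \<le> norm u"
proof -
  let ?p = "blinfun_apply (proj K) u"
  have "cinner_L2 u ?p = cinner_L2 ?p ?p"
    using proj_props(2)[OF K, of ?p u] proj_props(1)[OF K, of u] by (simp add: cinner_diff_left)
  then have "(norm ?p)\<^sup>2 = cmod (cinner_L2 u ?p)"
    by (simp only: cinner_self norm_of_real) simp
  also have "\<dots> \<le> norm u * norm ?p"
    by (rule cinner_Cauchy_Schwarz)
  finally show ?thesis
    by (cases "?p = 0") (simp_all add: power2_eq_square)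
qed

lemma proj_scaleC:
  assumes K: "closed_csubspace K"
  shows "blinfun_apply (proj K) (scaleC_L2 c u) = scaleC_L2 c (blinfun_apply (proj K) u)"
proof (rule proj_eqI[OF K])
  show "scaleC_L2 c (blinfun_apply (proj K) u) \<in> K"
    using K proj_props(1)[OF K] by (simp add: closed_csubspace_def)
  fix v assume "v \<in> K"
  then show "cinner_L2 (scaleC_L2 c u - scaleC_L2 c (blinfun_apply (proj K) u)) v = 0"
    using proj_props(2)[OF K, of v u]
    by (simp add: cinner_scaleC_left flip: linear_diff[OF bounded_linear.linear[OF bounded_linear_scaleC_L2]])
qed

lemma proj_inject:
  assumes "closed_csubspace K" "closed_csubspace L" "proj K = proj L"
  shows "K = L"
  using proj_eq_self_iff[OF assms(1)] proj_eq_self_iff[OF assms(2)] assms(3) by auto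

lemma closed_csubspace_eq_UNIV:
  assumes K: "closed_csubspace K" and "\<And>v. (\<And>u. u \<in> K \<Longrightarrow> cinner_L2 v u = 0) \<Longrightarrow> v = 0"
  shows "K = UNIV"
proof -
  have "u - blinfun_apply (proj K) u = 0" for u
    by (rule assms(2)) (rule proj_props[OF K])
  then show ?thesis
    using proj_props(1)[OF K] by (metis UNIV_eq_I eq_iff_diff_eq_0)
qed

subsection \<open>Contractions and multiplication operators\<close>

definition ccontraction :: "(L2 \<Rightarrow> L2) \<Rightarrow> bool" where
  "ccontraction T \<longleftrightarrow> (\<forall>u v. T (u + v) = T u + T v) \<and> (\<forall>c u. T (scaleC_L2 c u) = scaleC_L2 c (T u)) \<and>
     (\<forall>u. norm (T u) \<le> norm u)"

lemma ccontraction_diff: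
  assumes "ccontraction T"
  shows "T (u - v) = T u - T v"
  using assms unfolding ccontraction_def by (metis diff_add_cancel eq_diff_eq)

lemma ccontraction_zero: "ccontraction T \<Longrightarrow> T 0 = 0"
  using ccontraction_diff[of T 0 0] by simp

lemma ccontraction_proj: "closed_csubspace K \<Longrightarrow> ccontraction (blinfun_apply (proj K))"
  by (simp add: ccontraction_def blinfun.add_right proj_scaleC norm_proj_le)

text \<open>An epsilon/3 argument: the common bound on the operators controls the error of replacing
  a vector by a nearby one. Strong convergence therefore needs to be checked only on a total
  set.\<close>

lemma closed_csubspace_convergence:
  assumes T: "\<forall>\<^sub>F n in F. ccontraction (T n)" and S: "ccontraction S"
  shows "closed_csubspace {u. ((\<lambda>n. T n u) \<longlongrightarrow> S u) F}" (is "closed_csubspace ?K")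
proof -
  have add: "u + v \<in> ?K" if "u \<in> ?K" "v \<in> ?K" for u v
  proof -
    have "((\<lambda>n. T n u + T n v) \<longlongrightarrow> S u + S v) F"
      using that by (auto intro: tendsto_add)
    moreover have "\<forall>\<^sub>F n in F. T n u + T n v = T n (u + v)"
      using T by eventually_elim (simp add: ccontraction_def)
    ultimately have "((\<lambda>n. T n (u + v)) \<longlongrightarrow> S u + S v) F"
      by (rule Lim_transform_eventually)
    then show ?thesis
      using S by (simp add: ccontraction_def)
  qed
  have scale: "scaleC_L2 c u \<in> ?K" if "u \<in> ?K" for c u
  proof -
    have "((\<lambda>n. scaleC_L2 c (T n u)) \<longlongrightarrow> scaleC_L2 c (S u)) F"
      using that bounded_linear.tendsto[OF bounded_linear_scaleC_L2] by auto
    moreover have "\<forall>\<^sub>F n in F. scaleC_L2 c (T n u) = T n (scaleC_L2 c u)"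
      using T by eventually_elim (simp add: ccontraction_def)
    ultimately have "((\<lambda>n. T n (scaleC_L2 c u)) \<longlongrightarrow> scaleC_L2 c (S u)) F"
      by (rule Lim_transform_eventually)
    then show ?thesis
      using S by (simp add: ccontraction_def)
  qed
  have "u \<in> ?K" if u: "\<And>n. U n \<in> ?K" "U \<longlonglongrightarrow> u" for U u
  proof -
    have "\<forall>\<^sub>F n in F. dist (T n u) (S u) < e" if e: "e > 0" for e
    proof -
      obtain k where k: "dist (U k) u < e / 3"
        using u(2) e by (metis LIMSEQ_def divide_pos_pos dual_order.refl zero_less_numeral)
      have "\<forall>\<^sub>F n in F. dist (T n (U k)) (S (U k)) < e / 3"
        using u(1)[of k] e by (auto dest: tendstoD[of _ _ _ "e / 3"])
      with T show ?thesis
      proof eventually_elim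
        case (elim n)
        have "dist (T n u) (T n (U k)) \<le> dist (U k) u" "dist (S (U k)) (S u) \<le> dist (U k) u"
          using elim(1) S ccontraction_diff[OF elim(1), of u "U k"] ccontraction_diff[OF S, of "U k" u]
          by (metis ccontraction_def dist_commute dist_norm)+
        then have "dist (T n u) (T n (U k)) < e / 3" "dist (S (U k)) (S u) < e / 3"
          using k by simp_all
        then show ?case
          using dist_triangle_third[OF _ elim(2)] by blast
      qed
    qed
    then show ?thesis
      by (simp add: tendsto_iff)
  qed
  then have "closed ?K"
    unfolding closed_sequential_limits by blast
  moreover have "0 \<in> ?K"
  proof -
    have "\<forall>\<^sub>F n in F. T n 0 = 0"
      using T by eventually_elim (simp add: ccontraction_zero)
    then have "((\<lambda>n. T n 0) \<longlongrightarrow> 0) F"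
      by (rule tendsto_eventually)
    then show ?thesis
      by (simp add: ccontraction_zero[OF S])
  qed
  ultimately show ?thesis
    unfolding closed_csubspace_def subspace_def scaleR_eq_scaleC_L2 using add scale by blast
qed

definition multiplier :: "(real \<Rightarrow> complex) \<Rightarrow> bool" where
  "multiplier m \<longleftrightarrow> m \<in> borel_measurable borel \<and> (\<forall>x. cmod (m x) \<le> 1)"

definition mult_L2 :: "(real \<Rightarrow> complex) \<Rightarrow> L2 \<Rightarrow> L2" where
  "mult_L2 m u = abs_L2 (\<lambda>x. m x * rep_L2 u x)"

lemma multiplier_measurable [measurable_dest]: "multiplier m \<Longrightarrow> m \<in> borel_measurable borel"
  by (simp add: multiplier_def)

lemma multiplier_cnj: "multiplier m \<Longrightarrow> multiplier (\<lambda>x. cnj (m x))"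
  by (auto simp: multiplier_def)

lemma square_integrable_multiplier:
  assumes "multiplier m" "square_integrable f"
  shows "square_integrable (\<lambda>x. m x * f x)"
  using assms by (intro square_integrable_bound[OF assms(2), where B = 1])
    (auto simp: multiplier_def norm_mult square_integrable_def intro: mult_left_le_one_le)

lemma rep_mult_L2:
  "multiplier m \<Longrightarrow> AE x in lborel. rep_L2 (mult_L2 m u) x = m x * rep_L2 u x"
  unfolding mult_L2_def by (rule rep_abs_L2) (simp add: square_integrable_multiplier)

lemma mult_L2_abs_L2:
  assumes "multiplier m" "square_integrable f"
  shows "mult_L2 m (abs_L2 f) = abs_L2 (\<lambda>x. m x * f x)"
  unfolding mult_L2_def
  by (subst abs_L2_eq_iff) (use rep_abs_L2[OF assms(2)] assms in \<open>auto simp: square_integrable_multiplier\<close>)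

lemma mult_L2_mult_L2:
  assumes "multiplier m" "multiplier n"
  shows "mult_L2 m (mult_L2 n u) = mult_L2 (\<lambda>x. m x * n x) u"
  unfolding mult_L2_def[of n] mult_L2_def[of "\<lambda>x. m x * n x"]
  using assms by (simp add: mult_L2_abs_L2 square_integrable_multiplier mult.assoc)

lemma mult_L2_cong_AE:
  assumes "multiplier m" "multiplier n" "AE x in lborel. m x = n x"
  shows "mult_L2 m u = mult_L2 n u"
  unfolding mult_L2_def
  by (subst abs_L2_eq_iff) (use assms in \<open>auto simp: square_integrable_multiplier\<close>)

lemma mult_L2_one [simp]: "mult_L2 (\<lambda>x. 1) u = u"
  by (simp add: mult_L2_def)

lemma cinner_mult_L2:
  assumes "multiplier m"
  shows "cinner_L2 (mult_L2 m u) v = cinner_L2 u (mult_L2 (\<lambda>x. cnj (m x)) v)"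
proof -
  have "cinner_L2 (mult_L2 m u) (abs_L2 (rep_L2 v)) =
    cinner_L2 (abs_L2 (rep_L2 u)) (mult_L2 (\<lambda>x. cnj (m x)) v)"
    unfolding mult_L2_def using assms
    by (subst (1 2) cinner_abs_L2) (auto simp: square_integrable_multiplier multiplier_cnj mult_ac)
  then show ?thesis by simp
qed

lemma ccontraction_mult_L2:
  assumes m: "multiplier m"
  shows "ccontraction (mult_L2 m)"
  unfolding ccontraction_def
proof (intro conjI allI)
  fix u v :: L2 and c :: complex
  note sq = square_integrable_multiplier[OF m]
  have "mult_L2 m (abs_L2 (\<lambda>x. rep_L2 u x + rep_L2 v x)) = mult_L2 m u + mult_L2 m v"
    unfolding mult_L2_abs_L2[OF m square_integrable_add[OF square_integrable_rep_L2 square_integrable_rep_L2]]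
    by (simp add: mult_L2_def distrib_left sq flip: abs_L2_add)
  then show "mult_L2 m (u + v) = mult_L2 m u + mult_L2 m v"
    by (simp add: abs_L2_add)
  have "mult_L2 m (abs_L2 (\<lambda>x. c * rep_L2 u x)) = scaleC_L2 c (mult_L2 m u)"
    unfolding mult_L2_abs_L2[OF m square_integrable_mult_left[OF square_integrable_rep_L2]]
    by (simp add: mult_L2_def mult.left_commute sq flip: abs_L2_scaleC)
  then show "mult_L2 m (scaleC_L2 c u) = scaleC_L2 c (mult_L2 m u)"
    by (simp add: abs_L2_scaleC)
  have "(norm (mult_L2 m u))\<^sup>2 \<le> (norm u)\<^sup>2"
    unfolding mult_L2_def norm_L2_square[of u] norm_abs_L2_square[OF sq[OF square_integrable_rep_L2]]
  proof (rule integral_mono)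
    show "integrable lborel (\<lambda>x. (cmod (m x * rep_L2 u x))\<^sup>2)" "integrable lborel (\<lambda>x. (cmod (rep_L2 u x))\<^sup>2)"
      using sq[OF square_integrable_rep_L2[of u]] square_integrable_rep_L2[of u]
      by (auto simp: square_integrable_def)
    show "(cmod (m x * rep_L2 u x))\<^sup>2 \<le> (cmod (rep_L2 u x))\<^sup>2" for x
      using m by (intro power_mono) (auto simp: norm_mult multiplier_def intro: mult_left_le_one_le)
  qed
  then show "norm (mult_L2 m u) \<le> norm u"
    by (rule power2_le_imp_le) simp
qed

lemma tendsto_abs_L2_dominated:
  assumes g: "\<And>n. g n \<in> borel_measurable borel" and h: "h \<in> borel_measurable borel"
    and w: "square_integrable w" and le: "\<And>n x. cmod (g n x) \<le> cmod (w x)"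
    and lim: "AE x in lborel. (\<lambda>n. g n x) \<longlonglongrightarrow> h x"
  shows "square_integrable h" "(\<lambda>n. abs_L2 (g n)) \<longlonglongrightarrow> abs_L2 h"
proof -
  have [measurable]: "g n \<in> borel_measurable borel" "h \<in> borel_measurable borel" for n
    by fact+
  have sg: "square_integrable (g n)" for n
    by (rule square_integrable_bound[OF w, where B = 1]) (use g le in auto)
  have hle: "AE x in lborel. cmod (h x) \<le> cmod (w x)"
    using lim by eventually_elim (rule Lim_bounded[OF tendsto_norm], auto simp: le)
  \<comment> \<open>\<open>h\<close> is dominated only almost everywhere, whereas
    \<open>square_integrable_bound\<close> wants domination at every point; the truncated function
    has it and agrees with \<open>h\<close> almost everywhere.\<close>
  have "square_integrable (\<lambda>x. if cmod (h x) \<le> cmod (w x) then h x else 0)"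
    by (rule square_integrable_bound[OF w, where B = 1]) (use w in auto)
  then show sh: "square_integrable h"
    by (rule square_integrable_AE_cong) (use hle in auto)
  have "(\<lambda>n. LINT x|lborel. (cmod (g n x - h x))\<^sup>2) \<longlonglongrightarrow> (LINT x|(lborel :: real measure). 0)"
  proof (rule integral_dominated_convergence[where w = "\<lambda>x. 4 * (cmod (w x))\<^sup>2"])
    show "integrable lborel (\<lambda>x. 4 * (cmod (w x))\<^sup>2)"
      using w by (auto simp: square_integrable_def)
    show "AE x in lborel. (\<lambda>n. (cmod (g n x - h x))\<^sup>2) \<longlonglongrightarrow> 0"
      using lim
    proof eventually_elim
      case (elim x)
      have "(\<lambda>n. (cmod (g n x - h x))\<^sup>2) \<longlonglongrightarrow> (cmod (h x - h x))\<^sup>2"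
        by (intro tendsto_intros elim)
      then show ?case by simp
    qed
    show "AE x in lborel. norm ((cmod (g n x - h x))\<^sup>2) \<le> 4 * (cmod (w x))\<^sup>2" for n
      using hle
    proof eventually_elim
      case (elim x)
      have "cmod (g n x - h x) \<le> 2 * cmod (w x)"
        using norm_triangle_ineq4[of "g n x" "h x"] le[of n x] elim by linarith
      from power_mono[OF this, of 2] show ?case
        by (simp add: power_mult_distrib)
    qed
  qed auto
  then show "(\<lambda>n. abs_L2 (g n)) \<longlonglongrightarrow> abs_L2 h"
    by (subst tendsto_L2_iff_integral) (use sg sh in auto)
qed

lemma tendsto_mult_L2:
  assumes m: "\<And>n. multiplier (m n)" "multiplier m'"
    and lim: "AE x in lborel. (\<lambda>n. m n x) \<longlonglongrightarrow> m' x"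
  shows "(\<lambda>n. mult_L2 (m n) u) \<longlonglongrightarrow> mult_L2 m' u"
  unfolding mult_L2_def
proof (rule tendsto_abs_L2_dominated(2))
  show "cmod (m n x * rep_L2 u x) \<le> cmod (rep_L2 u x)" for n x
    using m(1)[of n] by (auto simp: multiplier_def norm_mult intro: mult_left_le_one_le)
  show "AE x in lborel. (\<lambda>n. m n x * rep_L2 u x) \<longlonglongrightarrow> m' x * rep_L2 u x"
    using lim by eventually_elim (intro tendsto_intros)
  have [measurable]: "m n \<in> borel_measurable borel" "m' \<in> borel_measurable borel" for n
    using m by (auto simp: multiplier_def)
  show "(\<lambda>x. m n x * rep_L2 u x) \<in> borel_measurable borel" "(\<lambda>x. m' x * rep_L2 u x) \<in> borel_measurable borel" for n
    by measurable
qed auto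

section \<open>Complex conjugation on square-integrable functions\<close>

definition cnj_L2 :: "L2 \<Rightarrow> L2" where
  "cnj_L2 u = abs_L2 (\<lambda>x. cnj (rep_L2 u x))"

lemma cnj_L2_abs_L2:
  assumes "square_integrable f"
  shows "cnj_L2 (abs_L2 f) = abs_L2 (\<lambda>x. cnj (f x))"
  unfolding cnj_L2_def
  by (subst abs_L2_eq_iff) (use rep_abs_L2[OF assms] assms in \<open>auto simp: square_integrable_cnj\<close>)

lemma cinner_cnj_L2: "cinner_L2 (cnj_L2 u) v = cnj (cinner_L2 u (cnj_L2 v))"
proof -
  have "cinner_L2 (cnj_L2 u) (abs_L2 (rep_L2 v)) = cnj (cinner_L2 (abs_L2 (rep_L2 u)) (cnj_L2 v))"
    unfolding cnj_L2_def
    by (subst (1 2) cinner_abs_L2)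
      (auto simp: square_integrable_cnj mult_ac simp flip: Bochner_Integration.integral_cnj)
  then show ?thesis by simp
qed

lemma cnj_cnj_L2 [simp]: "cnj_L2 (cnj_L2 u) = u"
  by (subst (2) cnj_L2_def) (simp add: cnj_L2_abs_L2 square_integrable_cnj)

lemma norm_cnj_L2 [simp]: "norm (cnj_L2 u) = norm u"
proof -
  have "(norm (cnj_L2 u))\<^sup>2 = (norm u)\<^sup>2"
    unfolding cnj_L2_def norm_L2_square[of u] by (simp add: norm_abs_L2_square square_integrable_cnj)
  then show ?thesis
    by (simp add: power2_eq_iff_nonneg)
qed

subsection \<open>Totality of indicators of intervals\<close>

definition ind_L2 :: "real \<Rightarrow> real \<Rightarrow> L2" where
  "ind_L2 p q = abs_L2 (\<lambda>x. indicator {p..q} x)"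

lemma square_integrable_indicator: "square_integrable (\<lambda>x. indicator {p..q} x :: complex)"
proof -
  have "(\<lambda>x. (cmod (indicator {p..q} x))\<^sup>2) = (indicator {p..q} :: real \<Rightarrow> real)"
    by (auto simp: indicator_def)
  moreover have "integrable lborel (indicator {p..q} :: real \<Rightarrow> real)"
    by (cases "p \<le> q") (auto intro: integrable_real_indicator)
  ultimately show ?thesis
    by (simp add: square_integrable_def)
qed

lemma cnj_indicator: "cnj (indicator A x) = complex_of_real (indicator A x)"
  by (simp add: indicator_def)

lemma set_integrable_rep_L2: "set_integrable lborel {p..q} (rep_L2 v)"
  using integrable_mult_cnj[OF square_integrable_rep_L2[of v] square_integrable_indicator[of p q]]
  by (simp add: set_integrable_def scaleR_conv_of_real mult.commute cnj_indicator)

lemma cinner_ind_L2: "cinner_L2 v (ind_L2 p q) = (LINT x:{p..q}|lborel. rep_L2 v x)"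
proof -
  have "cinner_L2 (abs_L2 (rep_L2 v)) (ind_L2 p q) = (LINT x|lborel. rep_L2 v x * cnj (indicator {p..q} x))"
    unfolding ind_L2_def by (rule cinner_abs_L2) (simp_all add: square_integrable_indicator)
  also have "\<dots> = (LINT x:{p..q}|lborel. rep_L2 v x)"
    by (simp add: set_lebesgue_integral_def scaleR_conv_of_real mult.commute cnj_indicator)
  finally show ?thesis by simp
qed

text \<open>On a bounded interval the positive and the negative part of \<open>r\<close> are
  densities of two measures that agree on all half-lines. The measures are then equal, hence so are
  the densities almost everywhere.\<close>

lemma AE_zero_of_interval_integrals:
  fixes r :: "real \<Rightarrow> real"
  assumes int: "\<And>p q. set_integrable lborel {p..q} r" and zero: "\<And>p q. (LINT x:{p..q}|lborel. r x) = 0"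
    and [measurable]: "r \<in> borel_measurable borel"
  shows "AE x in lborel. r x = 0"
proof -
  have "AE x in lborel. x \<in> {- real N..real N} \<longrightarrow> r x = 0" for N
  proof -
    let ?I = "{- real N..real N}"
    \<comment> \<open>\<open>ennreal\<close> truncates negative numbers to 0, so the signs 1 and -1
      select the positive and the negative part.\<close>
    let ?f = "\<lambda>(s :: real) x. ennreal (s * (indicator ?I x * r x))"
    have eq: "emeasure (density lborel (?f s)) {a<..} = (\<integral>\<^sup>+x. ennreal (s * (indicator {max a (- N)..real N} x * r x)) \<partial>lborel)" for s a :: real
    proof -
      have "emeasure (density lborel (?f s)) {a<..} = (\<integral>\<^sup>+x. ?f s x * indicator {a<..} x \<partial>lborel)"
        by (rule emeasure_density) auto
      also have "\<dots> = (\<integral>\<^sup>+x. ennreal (s * (indicator {max a (- N)..real N} x * r x)) \<partial>lborel)"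
        by (rule nn_integral_cong_AE, rule AE_mp[OF AE_lborel_singleton[of a]]) (auto simp: indicator_def)
      finally show ?thesis .
    qed
    have ig: "integrable lborel (\<lambda>x. indicator {p..q} x * r x)" for p q
      using int[of p q] by (simp add: set_integrable_def)
    have fin: "(\<integral>\<^sup>+x. ennreal (s * (indicator {p..q} x * r x)) \<partial>lborel) < \<infinity>" for s p q :: real
    proof -
      have "integrable lborel (\<lambda>x. s * (indicator {p..q} x * r x))"
        using ig by simp
      then show ?thesis
        using real_integrable_def by (metis ennreal_less_top infinity_ennreal_def less_top)
    qed
    have "density lborel (?f 1) = density lborel (?f (- 1))"
    proof (rule measure_eqI_lessThan)
      fix a
      show "emeasure (density lborel (?f 1)) {a<..} < \<infinity>"
        unfolding eq[of 1 a] by (rule fin)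
      let ?g = "\<lambda>x. indicator {max a (- N)..real N} x * r x"
      have d: "enn2real (\<integral>\<^sup>+x. ennreal (?g x) \<partial>lborel) - enn2real (\<integral>\<^sup>+x. ennreal (- ?g x) \<partial>lborel) = 0"
        using real_lebesgue_integral_def[OF ig[of "max a (- N)" "real N"]] zero[of "max a (- N)" "real N"]
        by (simp add: set_lebesgue_integral_def)
      show "emeasure (density lborel (?f 1)) {a<..} = emeasure (density lborel (?f (- 1))) {a<..}"
      proof (subst (1 2) eq)
        have "(\<integral>\<^sup>+x. ennreal (?g x) \<partial>lborel) < top" "(\<integral>\<^sup>+x. ennreal (- ?g x) \<partial>lborel) < top"
          using fin[of 1 "max a (- N)" "real N"] fin[of "-1" "max a (- N)" "real N"] by simp_all
        then have "(\<integral>\<^sup>+x. ennreal (?g x) \<partial>lborel) = (\<integral>\<^sup>+x. ennreal (- ?g x) \<partial>lborel)"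
          using d by (metis ennreal_enn2real eq_iff_diff_eq_0)
        then show "(\<integral>\<^sup>+x. ennreal (1 * ?g x) \<partial>lborel) = (\<integral>\<^sup>+x. ennreal (- 1 * ?g x) \<partial>lborel)"
          by simp
      qed
    qed simp_all
    then have "AE x in lborel. ?f 1 x = ?f (- 1) x"
      by (subst (asm) sigma_finite_measure.density_unique_iff[OF sigma_finite_lborel]) auto
    then show ?thesis
    proof eventually_elim
      case (elim x)
      show ?case
      proof
        assume "x \<in> ?I"
        then have "ennreal (r x) = ennreal (- r x)"
          using elim by simp
        then show "r x = 0"
          by (cases "r x \<ge> 0") (auto simp: ennreal_neg ennreal_eq_0_iff dest: sym)
      qed
    qed
  qed
  then have "AE x in lborel. \<forall>N::nat. x \<in> {- real N..real N} \<longrightarrow> r x = 0"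
    unfolding AE_all_countable by blast
  then show ?thesis
  proof eventually_elim
    case (elim x)
    obtain N :: nat where "\<bar>x\<bar> \<le> N"
      using real_arch_simple by blast
    then show ?case
      using elim by (auto simp: abs_le_iff)
  qed
qed

lemma L2_zero_of_intervals:
  assumes "\<And>p q. p < q \<Longrightarrow> cinner_L2 v (ind_L2 p q) = 0"
  shows "v = 0"
proof -
  have zero: "(LINT x:{p..q}|lborel. rep_L2 v x) = 0" for p q
  proof (cases "p < q")
    case True
    then show ?thesis
      using assms[of p q] by (simp add: cinner_ind_L2)
  next
    case False
    then have "AE x in lborel. x \<notin> {p..q}"
      using AE_lborel_singleton[of p] by (auto elim!: eventually_mono)
    then have "(LINT x:{p..q}|lborel. rep_L2 v x) = (LINT x:{}|lborel. rep_L2 v x)"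
      by (intro set_integral_cong_set) (auto simp: set_borel_measurable_def)
    then show ?thesis by (simp add: set_lebesgue_integral_def)
  qed
  have int: "integrable lborel (\<lambda>x. indicator {p..q} x *\<^sub>R rep_L2 v x)" for p q
    using set_integrable_rep_L2[of p q v] by (simp add: set_integrable_def)
  have "AE x in lborel. Re (rep_L2 v x) = 0"
    by (rule AE_zero_of_interval_integrals)
      (use int zero integrable_Re[OF int] integral_Re[OF int] in \<open>auto simp: set_integrable_def set_lebesgue_integral_def\<close>)
  moreover have "AE x in lborel. Im (rep_L2 v x) = 0"
    by (rule AE_zero_of_interval_integrals)
      (use int zero integrable_Im[OF int] integral_Im[OF int] in \<open>auto simp: set_integrable_def set_lebesgue_integral_def\<close>)
  ultimately have "AE x in lborel. rep_L2 v x = 0"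
    by eventually_elim (simp add: complex_eq_iff)
  then have "abs_L2 (rep_L2 v) = abs_L2 (\<lambda>x. 0)"
    by (subst abs_L2_eq_iff) auto
  then show ?thesis
    by (simp add: zero_L2_def)
qed

lemma no_accumulation_finite:
  assumes "no_accumulation_points D" "compact C"
  shows "finite (D \<inter> C)"
  using finite_not_islimpt_in_compact[OF assms(2), of D] assms(1)
  by (auto simp: no_accumulation_points_def Int_commute)

lemma no_accumulation_closed: "no_accumulation_points D \<Longrightarrow> closed D"
  by (auto simp: no_accumulation_points_def closed_limpt)

text \<open>The indefinite integral of \<open>v\<close> is continuous and locally constant off
  \<open>D\<close>. A continuous function whose derivative vanishes off finitely many points of an
  interval is constant there.\<close>

lemma cinner_ind_L2_zero_of_good_intervals:
  assumes D: "no_accumulation_points D"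
    and zero: "\<And>p q. p < q \<Longrightarrow> {p..q} \<inter> D = {} \<Longrightarrow> cinner_L2 v (ind_L2 p q) = 0"
    and pq: "p < q"
  shows "cinner_L2 v (ind_L2 p q) = 0"
proof -
  have HK: "cinner_L2 v (ind_L2 a b) = integral {a..b} (rep_L2 v)" "rep_L2 v integrable_on {a..b}" for a b
    using set_borel_integral_eq_integral[OF set_integrable_rep_L2[of a b v]] by (simp_all add: cinner_ind_L2)
  let ?G = "\<lambda>x. integral {p..x} (rep_L2 v)"
  have "?G q = 0"
  proof (rule has_derivative_zero_unique_strong_interval)
    show "finite (D \<inter> {p..q} \<union> {p, q})"
      using no_accumulation_finite[OF D, of "{p..q}"] by simp
    show "continuous_on {p..q} ?G"
      by (rule indefinite_integral_continuous_1) (rule HK)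
    show "(?G has_derivative (\<lambda>h. 0)) (at x within {p..q})" if "x \<in> {p..q} - (D \<inter> {p..q} \<union> {p, q})" for x
    proof -
      have "open ({p<..<q} - D)" "x \<in> {p<..<q} - D"
        using no_accumulation_closed[OF D] that by auto
      then obtain e where e: "e > 0" "cball x e \<subseteq> {p<..<q} - D"
        by (meson open_contains_cball)
      have const: "?G y = ?G x" if "y \<in> ball x e" for y
      proof -
        have *: "?G b = ?G a" if "a < b" "a \<in> ball x e" "b \<in> ball x e" for a b
        proof -
          have "{a..b} \<subseteq> cball x e"
            using that by (auto simp: dist_real_def)
          then have ab: "{a..b} \<inter> D = {}" "p < a" "b < q"
            using e(2) that by force+
          have "?G a + integral {a..b} (rep_L2 v) = ?G b"
            by (rule Henstock_Kurzweil_Integration.integral_combine) (use ab that HK in auto)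
          then show ?thesis
            using zero[OF that(1) ab(1)] HK(1) by simp
        qed
        show ?thesis
        proof (cases x y rule: linorder_cases)
          case less
          show ?thesis by (rule *[OF less]) (use that e(1) in simp_all)
        next
          case greater
          show ?thesis by (rule *[OF greater, symmetric]) (use that e(1) in simp_all)
        qed simp
      qed
      have "(?G has_derivative (\<lambda>h. 0)) (at x)"
        by (rule has_derivative_transform_within_open[OF has_derivative_const[of "?G x"] open_ball[of x e]])
          (use e(1) in simp, rule const[symmetric])
      then show ?thesis
        by (rule has_derivative_at_withinI)
    qed
  qed (use pq in auto)
  then show ?thesis
    by (simp add: HK)
qed

text \<open>Used for spaces of vectors on which operators converge, with \<open>D\<close> the
  exceptional points of a phase: only on intervals avoiding \<open>D\<close> is the phase known to
  be smooth and strictly monotone.\<close>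

lemma closed_csubspace_eq_UNIV_intervals:
  assumes "closed_csubspace K" "no_accumulation_points D"
    and "\<And>p q. p < q \<Longrightarrow> {p..q} \<inter> D = {} \<Longrightarrow> ind_L2 p q \<in> K"
  shows "K = UNIV"
proof (rule closed_csubspace_eq_UNIV[OF assms(1)])
  fix v assume v: "\<And>u. u \<in> K \<Longrightarrow> cinner_L2 v u = 0"
  show "v = 0"
    by (rule L2_zero_of_intervals, rule cinner_ind_L2_zero_of_good_intervals[OF assms(2)])
      (auto intro: v assms(3))
qed

subsection \<open>The Poisson integral\<close>

definition ker_L2 :: "complex \<Rightarrow> L2" where
  "ker_L2 w = abs_L2 (cker w)"

lemmas square_integrable_cker = square_integrable_cker_norm(1)

lemma norm_ker_L2: "Im w \<noteq> 0 \<Longrightarrow> (norm (ker_L2 w))\<^sup>2 = pi / \<bar>Im w\<bar>"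
  by (simp add: ker_L2_def norm_abs_L2_square square_integrable_cker_norm)

lemma cnj_ker_L2: "Im w \<noteq> 0 \<Longrightarrow> cnj_L2 (ker_L2 w) = ker_L2 (cnj w)"
  unfolding ker_L2_def by (simp add: cnj_L2_abs_L2 square_integrable_cker cnj_cker)

lemma cinner_ker_L2:
  assumes "Im w \<noteq> 0"
  shows "integrable lborel (\<lambda>t. rep_L2 u t * cker (cnj w) t)"
    "cinner_L2 u (ker_L2 w) = (LINT t|lborel. rep_L2 u t * cker (cnj w) t)"
proof -
  show "integrable lborel (\<lambda>t. rep_L2 u t * cker (cnj w) t)"
    using integrable_mult_cnj[OF square_integrable_rep_L2[of u] square_integrable_cker[OF assms]]
    by (simp add: cnj_cker)
  have "cinner_L2 (abs_L2 (rep_L2 u)) (ker_L2 w) = (LINT t|lborel. rep_L2 u t * cnj (cker w t))"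
    unfolding ker_L2_def by (rule cinner_abs_L2) (simp_all add: square_integrable_cker assms)
  then show "cinner_L2 u (ker_L2 w) = (LINT t|lborel. rep_L2 u t * cker (cnj w) t)"
    by (simp add: cnj_cker)
qed

text \<open>The Poisson integral, written as a difference of two Cauchy integrals. For
  \<open>u\<close> orthogonal to the kernels with pole in the upper half plane the second one
  vanishes, and what remains is the holomorphic extension \<open>hardy_ext\<close>.\<close>

definition pois :: "L2 \<Rightarrow> real \<Rightarrow> real \<Rightarrow> complex" where
  "pois u x y = (cinner_L2 u (ker_L2 (Complex x (- y))) - cinner_L2 u (ker_L2 (Complex x y))) / (2 * pi * \<i>)"

definition pker :: "real \<Rightarrow> real \<Rightarrow> real \<Rightarrow> real" where
  "pker x y t = y / ((t - x)\<^sup>2 + y\<^sup>2) / pi"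

lemma pker_nonneg: "y > 0 \<Longrightarrow> pker x y t \<ge> 0"
  by (simp add: pker_def)

lemma measurable_pker [measurable]: "(\<lambda>(x, t). pker x y t) \<in> borel_measurable (lborel \<Otimes>\<^sub>M lborel)"
  unfolding pker_def by measurable

lemma measurable_pker1 [measurable]: "(\<lambda>t. pker x y t) \<in> borel_measurable borel"
    "(\<lambda>x. pker x y t) \<in> borel_measurable borel"
  unfolding pker_def by measurable

lemma nn_integral_pker:
  assumes "y > 0"
  shows "(\<integral>\<^sup>+t. ennreal (pker x y t) \<partial>lborel) = 1" "(\<integral>\<^sup>+x. ennreal (pker x y t) \<partial>lborel) = 1"
proof -
  have *: "(\<integral>\<^sup>+t. ennreal (pker x y t) \<partial>lborel) = 1" for x
  proof -
    have "has_bochner_integral lborel (\<lambda>t. pker x y t) (pi / pi)"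
      unfolding pker_def using has_bochner_integral_Poisson[OF assms] by (rule has_bochner_integral_divide)
    then show ?thesis
      using assms by (subst nn_integral_eq_integral) (auto simp: has_bochner_integral_iff pker_nonneg)
  qed
  show "(\<integral>\<^sup>+t. ennreal (pker x y t) \<partial>lborel) = 1"
    by (rule *)
  show "(\<integral>\<^sup>+x. ennreal (pker x y t) \<partial>lborel) = 1"
    using *[of t] by (simp add: pker_def power2_commute[of t])
qed

lemma cker_diff_cnj:
  assumes "y > 0"
  shows "cker (Complex x y) t - cker (Complex x (- y)) t = 2 * pi * \<i> * of_real (pker x y t)"
proof -
  have ne: "of_real t - Complex x y \<noteq> 0" "of_real t - Complex x (- y) \<noteq> 0"
    using assms by (auto simp: complex_eq_iff)
  have pr: "(of_real t - Complex x y) * (of_real t - Complex x (- y)) = of_real ((t - x)\<^sup>2 + y\<^sup>2)"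
    by (simp add: complex_eq_iff power2_eq_square algebra_simps)
  have "cker (Complex x y) t - cker (Complex x (- y)) t =
      (Complex x y - Complex x (- y)) / ((of_real t - Complex x y) * (of_real t - Complex x (- y)))"
    unfolding cker_def using ne by (subst diff_frac_eq) auto
  also have "\<dots> = (2 * \<i> * of_real y) / of_real ((t - x)\<^sup>2 + y\<^sup>2)"
    unfolding pr by (simp add: complex_eq_iff)
  also have "\<dots> = 2 * pi * \<i> * of_real (pker x y t)"
    by (simp add: pker_def)
  finally show ?thesis .
qed

lemma pois_integral:
  assumes "y > 0"
  shows "integrable lborel (\<lambda>t. rep_L2 u t * of_real (pker x y t))"
    "pois u x y = (LINT t|lborel. rep_L2 u t * of_real (pker x y t))"
proof -
  have c: "cnj (Complex x (- y)) = Complex x y" "cnj (Complex x y) = Complex x (- y)"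
    by (simp_all add: complex_eq_iff)
  have i: "integrable lborel (\<lambda>t. rep_L2 u t * cker (Complex x y) t)"
    "integrable lborel (\<lambda>t. rep_L2 u t * cker (Complex x (- y)) t)"
    using cinner_ker_L2(1)[of "Complex x (- y)" u] cinner_ker_L2(1)[of "Complex x y" u] assms by (simp_all add: c)
  have eq: "rep_L2 u t * cker (Complex x y) t - rep_L2 u t * cker (Complex x (- y)) t =
      2 * pi * \<i> * (rep_L2 u t * of_real (pker x y t))" for t
    using cker_diff_cnj[OF assms, of x t] by (simp add: mult_ac flip: right_diff_distrib)
  have int: "integrable lborel (\<lambda>t. 2 * pi * \<i> * (rep_L2 u t * of_real (pker x y t)))"
    using Bochner_Integration.integrable_diff[OF i] unfolding eq .
  then have "integrable lborel (\<lambda>t. (1 / (2 * pi * \<i>)) * (2 * pi * \<i> * (rep_L2 u t * of_real (pker x y t))))"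
    by (rule integrable_mult_right)
  then show "integrable lborel (\<lambda>t. rep_L2 u t * of_real (pker x y t))"
    by simp
  have "cinner_L2 u (ker_L2 (Complex x (- y))) - cinner_L2 u (ker_L2 (Complex x y)) =
      (LINT t|lborel. rep_L2 u t * cker (Complex x y) t - rep_L2 u t * cker (Complex x (- y)) t)"
    using assms by (simp add: cinner_ker_L2 c i)
  also have "\<dots> = 2 * pi * \<i> * (LINT t|lborel. rep_L2 u t * of_real (pker x y t))"
    unfolding eq by simp
  finally show "pois u x y = (LINT t|lborel. rep_L2 u t * of_real (pker x y t))"
    by (simp add: pois_def)
qed

lemma measurable_pois:
  assumes "y > 0"
  shows "(\<lambda>x. pois u x y) \<in> borel_measurable borel"
  unfolding pois_integral(2)[OF assms] by measurable

text \<open>Jensen's inequality for the probability density \<open>pker x y\<close>, obtained by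
  splitting the kernel into two square roots and applying Cauchy-Schwarz. Integration over
  \<open>x\<close> then shows that the Poisson integral is a contraction.\<close>

lemma pois_square_bound:
  assumes y: "y > 0"
  shows "ennreal ((cmod (pois u x y))\<^sup>2) \<le> (\<integral>\<^sup>+t. ennreal ((cmod (rep_L2 u t))\<^sup>2 * pker x y t) \<partial>lborel)"
proof -
  let ?f = "\<lambda>t. ennreal (cmod (rep_L2 u t) * sqrt (pker x y t))" and ?g = "\<lambda>t. ennreal (sqrt (pker x y t))"
  have "ennreal (cmod (pois u x y)) \<le> (\<integral>\<^sup>+t. ennreal (cmod (rep_L2 u t * of_real (pker x y t))) \<partial>lborel)"
    unfolding pois_integral(2)[OF y] using pois_integral(1)[OF y] by (rule integral_norm_bound_ennreal)
  also have "\<dots> = (\<integral>\<^sup>+t. ?f t * ?g t \<partial>lborel)"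
    using pker_nonneg[OF y] by (intro nn_integral_cong) (simp add: norm_mult mult.assoc flip: ennreal_mult)
  finally have "(ennreal (cmod (pois u x y)))\<^sup>2 \<le> (\<integral>\<^sup>+t. ?f t * ?g t \<partial>lborel)\<^sup>2"
    by (rule power_mono) simp
  also have "\<dots> \<le> (\<integral>\<^sup>+t. (?f t)\<^sup>2 \<partial>lborel) * (\<integral>\<^sup>+t. (?g t)\<^sup>2 \<partial>lborel)"
    by (rule Cauchy_Schwarz_nn_integral) measurable
  also have "(\<integral>\<^sup>+t. (?g t)\<^sup>2 \<partial>lborel) = 1"
    using pker_nonneg[OF y] nn_integral_pker(1)[OF y] by (simp add: ennreal_power)
  also have "(\<integral>\<^sup>+t. (?f t)\<^sup>2 \<partial>lborel) = (\<integral>\<^sup>+t. ennreal ((cmod (rep_L2 u t))\<^sup>2 * pker x y t) \<partial>lborel)"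
    using pker_nonneg[OF y] by (simp add: ennreal_power power_mult_distrib)
  finally show ?thesis
    by (simp add: ennreal_power)
qed

lemma square_integrable_pois:
  assumes y: "y > 0"
  shows "square_integrable (\<lambda>x. pois u x y)" "norm (abs_L2 (\<lambda>x. pois u x y)) \<le> norm u"
proof -
  have "(\<integral>\<^sup>+x. ennreal ((cmod (pois u x y))\<^sup>2) \<partial>lborel) \<le>
      (\<integral>\<^sup>+x. \<integral>\<^sup>+t. ennreal ((cmod (rep_L2 u t))\<^sup>2 * pker x y t) \<partial>lborel \<partial>lborel)"
    by (intro nn_integral_mono pois_square_bound y)
  also have "\<dots> = (\<integral>\<^sup>+t. \<integral>\<^sup>+x. ennreal ((cmod (rep_L2 u t))\<^sup>2 * pker x y t) \<partial>lborel \<partial>lborel)"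
    by (rule lborel_pair.Fubini') measurable
  also have "\<dots> = (\<integral>\<^sup>+t. ennreal ((cmod (rep_L2 u t))\<^sup>2) \<partial>lborel)"
    using pker_nonneg[OF y] by (simp add: ennreal_mult nn_integral_cmult nn_integral_pker(2)[OF y])
  also have "\<dots> = ennreal ((norm u)\<^sup>2)"
    using nn_integral_cmod_square[OF square_integrable_rep_L2[of u]] by simp
  finally have *: "(\<integral>\<^sup>+x. ennreal ((cmod (pois u x y))\<^sup>2) \<partial>lborel) \<le> ennreal ((norm u)\<^sup>2)" .
  show "square_integrable (\<lambda>x. pois u x y)" "norm (abs_L2 (\<lambda>x. pois u x y)) \<le> norm u"
    by (rule square_integrable_of_nn_integral[OF measurable_pois[OF y] * norm_ge_zero])+
qed

definition pois_L2 :: "real \<Rightarrow> L2 \<Rightarrow> L2" where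
  "pois_L2 y u = abs_L2 (\<lambda>x. pois u x y)"

lemma ccontraction_pois_L2:
  assumes y: "y > 0"
  shows "ccontraction (pois_L2 y)"
  unfolding ccontraction_def
proof (intro conjI allI)
  fix u v c
  have "pois (u + v) x y = pois u x y + pois v x y" for x
    by (simp add: pois_def cinner_add_left add_divide_distrib[symmetric] algebra_simps)
  then show "pois_L2 y (u + v) = pois_L2 y u + pois_L2 y v"
    by (simp add: pois_L2_def abs_L2_add square_integrable_pois[OF y])
  have "pois (scaleC_L2 c u) x y = c * pois u x y" for x
    by (simp add: pois_def cinner_scaleC_left right_diff_distrib)
  then show "pois_L2 y (scaleC_L2 c u) = scaleC_L2 c (pois_L2 y u)"
    by (simp add: pois_L2_def abs_L2_scaleC square_integrable_pois[OF y])
  show "norm (pois_L2 y u) \<le> norm u"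
    unfolding pois_L2_def by (rule square_integrable_pois[OF y])
qed

lemma pois_ind_L2:
  assumes y: "y > 0" and pq: "p < q"
  shows "pois (ind_L2 p q) x y = of_real ((arctan ((q - x) / y) - arctan ((p - x) / y)) / pi)"
proof -
  have "pois (ind_L2 p q) x y = (LINT t|lborel. of_real (indicator {p..q} t * (y / ((t - x)\<^sup>2 + y\<^sup>2)) / pi))"
    unfolding pois_integral(2)[OF y]
  proof (rule integral_cong_AE)
    show "AE t in lborel. rep_L2 (ind_L2 p q) t * of_real (pker x y t) =
        of_real (indicator {p..q} t * (y / ((t - x)\<^sup>2 + y\<^sup>2)) / pi)"
      using rep_abs_L2[OF square_integrable_indicator, of p q]
      by eventually_elim (simp add: ind_L2_def pker_def indicator_def)
  qed measurable
  also have "\<dots> = of_real ((LINT t|lborel. indicator {p..q} t * (y / ((t - x)\<^sup>2 + y\<^sup>2))) / pi)"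
    by (simp only: integral_complex_of_real integral_divide_zero)
  also have "(LINT t|lborel. indicator {p..q} t * (y / ((t - x)\<^sup>2 + y\<^sup>2))) =
      arctan ((q - x) / y) - arctan ((p - x) / y)"
    using integral_Poisson_interval[OF y, of p q x] pq by simp
  finally show ?thesis .
qed

lemma norm_ind_L2:
  assumes "p \<le> q"
  shows "(norm (ind_L2 p q))\<^sup>2 = q - p"
proof -
  have "(\<lambda>x. (cmod (indicator {p..q} x))\<^sup>2) = (indicator {p..q} :: real \<Rightarrow> real)"
    by (auto simp: indicator_def)
  then show ?thesis
    using assms by (simp add: ind_L2_def norm_abs_L2_square square_integrable_indicator)
qed

text \<open>For a contraction T, the square of |T u - u| is at most 2 |u|^2 - 2 Re (T u, u). Hence
  it is enough to find the limit of the pairing with the indicator itself, where the Poisson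
  integral is an explicit difference of arctangents.\<close>

lemma tendsto_pois_L2_ind:
  assumes pq: "p < q"
  shows "((\<lambda>y. pois_L2 y (ind_L2 p q)) \<longlongrightarrow> ind_L2 p q) (at_right 0)"
proof (rule tendsto_at_right_sequentially[of 0 1])
  fix S :: "nat \<Rightarrow> real"
  assume S: "\<And>n. 0 < S n" "S \<longlonglongrightarrow> 0"
  let ?u = "ind_L2 p q"
  let ?a = "\<lambda>y x. (arctan ((q - x) / y) - arctan ((p - x) / y)) / pi"
  have ci: "cinner_L2 (pois_L2 (S n) ?u) ?u = of_real (LINT x:{p..q}|lborel. ?a (S n) x)" for n
  proof -
    have "cinner_L2 (pois_L2 (S n) ?u) ?u = (LINT x:{p..q}|lborel. rep_L2 (pois_L2 (S n) ?u) x)"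
      by (rule cinner_ind_L2)
    also have "\<dots> = (LINT x:{p..q}|lborel. of_real (?a (S n) x))"
      unfolding set_lebesgue_integral_def
    proof (rule integral_cong_AE)
      show "AE x in lborel. indicator {p..q} x *\<^sub>R rep_L2 (pois_L2 (S n) ?u) x =
          indicator {p..q} x *\<^sub>R complex_of_real (?a (S n) x)"
        using rep_abs_L2[OF square_integrable_pois(1)[OF S(1)[of n]], of ?u]
        by eventually_elim (simp add: pois_L2_def pois_ind_L2[OF S(1) pq])
    qed measurable
    also have "\<dots> = of_real (LINT x:{p..q}|lborel. ?a (S n) x)"
      unfolding set_lebesgue_integral_def
      by (subst integral_complex_of_real[symmetric]) (simp add: scaleR_conv_of_real)
    finally show ?thesis .
  qed
  have "(\<lambda>n. LINT x:{p..q}|lborel. ?a (S n) x) \<longlonglongrightarrow> (LINT x:{p..q}|lborel. 1)"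
    unfolding set_lebesgue_integral_def
  proof (rule integral_dominated_convergence[where w = "indicator {p..q}"])
    show "integrable lborel (indicator {p..q} :: real \<Rightarrow> real)"
      using pq by (auto intro: integrable_real_indicator)
    show "AE x in lborel. (\<lambda>n. indicator {p..q} x *\<^sub>R ?a (S n) x) \<longlonglongrightarrow> indicator {p..q} x *\<^sub>R 1"
      using AE_lborel_singleton[of p] AE_lborel_singleton[of q]
    proof eventually_elim
      case (elim x)
      have inv: "filterlim (\<lambda>n. inverse (S n)) at_top sequentially"
        using S by (intro filterlim_inverse_at_top) auto
      show ?case
      proof (cases "x \<in> {p..q}")
        case True
        with elim have x: "p < x" "x < q" by auto
        have eq: "a / S n = a * inverse (S n)" for a n
          by (rule divide_inverse)
        have "(\<lambda>n. arctan ((q - x) / S n)) \<longlonglongrightarrow> pi / 2"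
          unfolding eq using x by (intro filterlim_compose[OF tendsto_arctan_at_top]
              filterlim_tendsto_pos_mult_at_top[OF tendsto_const _ inv]) auto
        moreover have "(\<lambda>n. arctan ((p - x) / S n)) \<longlonglongrightarrow> - (pi / 2)"
          unfolding eq using x by (intro filterlim_compose[OF tendsto_arctan_at_bot]
              filterlim_tendsto_neg_mult_at_bot[OF tendsto_const _ inv]) auto
        ultimately have "(\<lambda>n. (arctan ((q - x) / S n) - arctan ((p - x) / S n)) / pi)
            \<longlonglongrightarrow> (pi / 2 - - (pi / 2)) / pi"
          by (intro tendsto_intros) auto
        with True show ?thesis
          by simp
      qed simp
    qed
    show "AE x in lborel. norm (indicator {p..q} x *\<^sub>R ?a (S n) x) \<le> indicator {p..q} x" for n
    proof (rule AE_I2)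
      fix x
      have "\<bar>arctan ((q - x) / S n) - arctan ((p - x) / S n)\<bar> \<le> pi"
        using arctan_bounded[of "(q - x) / S n"] arctan_bounded[of "(p - x) / S n"] by linarith
      then show "norm (indicator {p..q} x *\<^sub>R ?a (S n) x) \<le> indicator {p..q} x"
        by (simp add: indicator_def)
    qed
  qed measurable
  also have "(LINT x:{p..q}|lborel. 1) = q - p"
    using pq by (simp add: set_lebesgue_integral_def)
  finally have lim: "(\<lambda>n. LINT x:{p..q}|lborel. ?a (S n) x) \<longlonglongrightarrow> q - p" .
  have le: "(norm (pois_L2 (S n) ?u - ?u))\<^sup>2 \<le> 2 * (q - p) - 2 * (LINT x:{p..q}|lborel. ?a (S n) x)" for n
  proof -
    have "(norm (pois_L2 (S n) ?u - ?u))\<^sup>2 =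
        (norm (pois_L2 (S n) ?u))\<^sup>2 + (norm ?u)\<^sup>2 - 2 * inner (pois_L2 (S n) ?u) ?u"
      by (simp add: power2_norm_eq_inner inner_diff_left inner_diff_right inner_commute)
    moreover have "(norm (pois_L2 (S n) ?u))\<^sup>2 \<le> (norm ?u)\<^sup>2"
      using ccontraction_pois_L2[OF S(1)[of n]] by (intro power_mono) (auto simp: ccontraction_def)
    moreover have "inner (pois_L2 (S n) ?u) ?u = (LINT x:{p..q}|lborel. ?a (S n) x)"
      by (simp add: inner_L2_def ci)
    ultimately show ?thesis
      using norm_ind_L2[of p q] pq by simp
  qed
  have "(\<lambda>n. 2 * (q - p) - 2 * (LINT x:{p..q}|lborel. ?a (S n) x)) \<longlonglongrightarrow> 2 * (q - p) - 2 * (q - p)"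
    by (intro tendsto_intros lim)
  then have L0: "(\<lambda>n. 2 * (q - p) - 2 * (LINT x:{p..q}|lborel. ?a (S n) x)) \<longlonglongrightarrow> 0"
    by (simp only: diff_self)
  have "(\<lambda>n. (norm (pois_L2 (S n) ?u - ?u))\<^sup>2) \<longlonglongrightarrow> 0"
    by (rule Lim_null_comparison[OF always_eventually L0], rule allI, subst real_norm_def, subst abs_of_nonneg)
      (simp, rule le)
  from tendsto_real_sqrt[OF this] have "(\<lambda>n. norm (pois_L2 (S n) ?u - ?u)) \<longlonglongrightarrow> 0"
    by simp
  then show "(\<lambda>n. pois_L2 (S n) ?u) \<longlonglongrightarrow> ?u"
    using Lim_null tendsto_norm_zero_iff by blast
qed simp

lemma tendsto_pois_L2: "((\<lambda>y. pois_L2 y u) \<longlongrightarrow> u) (at_right 0)"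
proof -
  have "{u. ((\<lambda>y. pois_L2 y u) \<longlongrightarrow> u) (at_right 0)} = UNIV"
  proof (rule closed_csubspace_eq_UNIV_intervals[where D = "{}"])
    show "closed_csubspace {u. ((\<lambda>y. pois_L2 y u) \<longlongrightarrow> u) (at_right 0)}"
      using eventually_at_right_less[of 0]
      by (intro closed_csubspace_convergence[where S = "\<lambda>u. u"])
        (auto elim!: eventually_mono intro: ccontraction_pois_L2 simp: ccontraction_def[of "\<lambda>u. u"])
  qed (auto simp: no_accumulation_points_def tendsto_pois_L2_ind)
  then show ?thesis by auto
qed

subsection \<open>Green's formula in the upper half plane\<close>

text \<open>Green's formula is proved for Henstock-Kurzweil integrals of continuous functions. This
  translates its boundary and slice terms into inner products, where Cauchy-Schwarz and norm limits
  apply.\<close>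

lemma integral_interval_cinner:
  fixes g f :: "real \<Rightarrow> complex"
  assumes f: "square_integrable f" and g: "continuous_on {p..q} g" and pq: "p \<le> q"
    and B: "\<And>x. x \<in> {p..q} \<Longrightarrow> cmod (g x) \<le> B"
  shows "integral {p..q} (\<lambda>x. g x * f x) = cinner_L2 (abs_L2 f) (abs_L2 (\<lambda>x. indicator {p..q} x * cnj (g x)))"
    "cmod (integral {p..q} (\<lambda>x. g x * f x)) \<le> B * sqrt (q - p) * norm (abs_L2 f)"
    "square_integrable (\<lambda>x. indicator {p..q} x * cnj (g x))"
proof -
  let ?g = "\<lambda>x. indicator {p..q} x * cnj (g x)"
  have B0: "B \<ge> 0"
    using B[of p] pq by (meson atLeastAtMost_iff norm_ge_zero order.trans order_refl)
  have "(\<lambda>x. indicator {p..q} x *\<^sub>R cnj (g x)) \<in> borel_measurable borel"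
    by (rule borel_measurable_continuous_on_indicator) (auto intro: continuous_on_cnj g)
  moreover have "(\<lambda>x. indicator {p..q} x *\<^sub>R cnj (g x)) = ?g"
    by (auto simp: fun_eq_iff indicator_def)
  ultimately have [measurable]: "?g \<in> borel_measurable borel"
    by simp
  have le: "cmod (?g x) \<le> B * cmod (indicator {p..q} x)" for x
    using B[of x] by (simp add: indicator_def)
  show sg: "square_integrable ?g"
    by (rule square_integrable_bound[OF square_integrable_indicator _ le]) measurable
  have "(norm (abs_L2 ?g))\<^sup>2 \<le> (LINT x|lborel. B\<^sup>2 * (cmod (indicator {p..q} x))\<^sup>2)"
    unfolding norm_abs_L2_square[OF sg]
  proof (rule integral_mono)
    show "integrable lborel (\<lambda>x. (cmod (?g x))\<^sup>2)" "integrable lborel (\<lambda>x. B\<^sup>2 * (cmod (indicator {p..q} x))\<^sup>2)"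
      using sg square_integrable_indicator[of p q] by (auto simp: square_integrable_def)
    show "(cmod (?g x))\<^sup>2 \<le> B\<^sup>2 * (cmod (indicator {p..q} x))\<^sup>2" for x
      using power_mono[OF le[of x], of 2] by (simp add: power_mult_distrib)
  qed
  also have "\<dots> = B\<^sup>2 * (norm (ind_L2 p q))\<^sup>2"
    by (simp add: ind_L2_def norm_abs_L2_square square_integrable_indicator)
  also have "\<dots> = (B * sqrt (q - p))\<^sup>2"
    using pq by (simp add: norm_ind_L2 power_mult_distrib)
  finally have ng: "norm (abs_L2 ?g) \<le> B * sqrt (q - p)"
    by (rule power2_le_imp_le) (use B0 pq in simp)
  have "(\<lambda>x. f x * cnj (?g x)) = (\<lambda>x. indicator {p..q} x *\<^sub>R (g x * f x))"
    by (auto simp: fun_eq_iff indicator_def)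
  then have si: "set_integrable lborel {p..q} (\<lambda>x. g x * f x)"
    using integrable_mult_cnj[OF f sg] by (simp add: set_integrable_def)
  have "integral {p..q} (\<lambda>x. g x * f x) = (LINT x:{p..q}|lborel. g x * f x)"
    using set_borel_integral_eq_integral(2)[OF si] by simp
  also have "\<dots> = (LINT x|lborel. f x * cnj (?g x))"
    unfolding set_lebesgue_integral_def by (rule Bochner_Integration.integral_cong) (auto simp: indicator_def)
  also have "\<dots> = cinner_L2 (abs_L2 f) (abs_L2 ?g)"
    by (rule cinner_abs_L2[symmetric]) (use f sg in auto)
  finally show eq: "integral {p..q} (\<lambda>x. g x * f x) = cinner_L2 (abs_L2 f) (abs_L2 ?g)" .
  show "cmod (integral {p..q} (\<lambda>x. g x * f x)) \<le> B * sqrt (q - p) * norm (abs_L2 f)"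
    unfolding eq using cinner_Cauchy_Schwarz[of "abs_L2 f" "abs_L2 ?g"] mult_left_mono[OF ng norm_ge_zero[of "abs_L2 f"]]
    by (simp add: mult_ac)
qed

lemma continuous_on_section1:
  assumes "continuous_on (A \<times> B) (\<lambda>(x, y). f x y)" "y \<in> B"
  shows "continuous_on A (\<lambda>x. f x y)"
proof -
  have "continuous_on A (\<lambda>x. (x, y))"
    by (intro continuous_intros)
  from continuous_on_compose2[OF assms(1) this] assms(2) show ?thesis
    by auto
qed

text \<open>Since the y-derivative of a holomorphic \<open>F\<close> is i times its x-derivative,
  the y-derivative \<open>G\<close> of \<open>W F\<close> splits as \<open>H + \<i> * E\<close> with
  \<open>E\<close> the x-derivative of \<open>W F\<close>. The integral of \<open>E\<close> over a
  horizontal segment vanishes because \<open>W\<close> does at both ends; what remains is the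
  failure \<open>H\<close> of \<open>W\<close> to be holomorphic, times \<open>F\<close>.\<close>

lemma Green_strip:
  fixes F :: "complex \<Rightarrow> complex" and W Wx Wy :: "real \<Rightarrow> real \<Rightarrow> complex"
  assumes F: "F holomorphic_on {z. Im z > 0}" and ab: "0 < a" "a \<le> b" and pq: "p \<le> q"
    and Wx: "\<And>x y. x \<in> {p..q} \<Longrightarrow> y \<in> {a..b} \<Longrightarrow> ((\<lambda>x. W x y) has_vector_derivative Wx x y) (at x within {p..q})"
    and Wy: "\<And>x y. x \<in> {p..q} \<Longrightarrow> y \<in> {a..b} \<Longrightarrow> ((\<lambda>y. W x y) has_vector_derivative Wy x y) (at y within {a..b})"
    and cW: "continuous_on ({p..q} \<times> {a..b}) (\<lambda>(x, y). W x y)"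
    and cWx: "continuous_on ({p..q} \<times> {a..b}) (\<lambda>(x, y). Wx x y)"
    and cWy: "continuous_on ({p..q} \<times> {a..b}) (\<lambda>(x, y). Wy x y)"
    and bd: "\<And>y. y \<in> {a..b} \<Longrightarrow> W p y = 0" "\<And>y. y \<in> {a..b} \<Longrightarrow> W q y = 0"
  shows "integral {p..q} (\<lambda>x. W x b * F (Complex x b)) - integral {p..q} (\<lambda>x. W x a * F (Complex x a)) =
    integral {a..b} (\<lambda>y. integral {p..q} (\<lambda>x. (Wy x y - \<i> * Wx x y) * F (Complex x y)))"
proof -
  let ?U = "{z. Im z > 0}" and ?R = "{p..q} \<times> {a..b}"
  define F' where "F' = deriv F"
  have oU: "open ?U"
    by (rule open_halfspace_Im_gt)
  have F': "F' holomorphic_on ?U"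
    unfolding F'_def using F oU by (rule holomorphic_deriv)
  have DF: "(F has_field_derivative F' z) (at z within S)" if "Im z > 0" for z S
  proof -
    have "(F has_field_derivative deriv F z) (at z)"
      by (rule holomorphic_derivI[OF F oU]) (use that in simp)
    then show ?thesis
      unfolding F'_def by (rule has_field_derivative_at_within)
  qed
  have cC: "continuous_on ?R (\<lambda>(x, y). G (Complex x y))" if "G holomorphic_on ?U" for G
  proof -
    have "continuous_on ?R (\<lambda>z. G (of_real (fst z) + \<i> * of_real (snd z)))"
      using ab by (intro continuous_on_compose2[OF holomorphic_on_imp_continuous_on[OF that]] continuous_intros) auto
    then show ?thesis
      by (simp add: case_prod_unfold Complex_eq)
  qed
  note cF = cC[OF F] and cF' = cC[OF F']
  have dx: "((\<lambda>x. F (Complex x y)) has_vector_derivative F' (Complex x y)) (at x within S)"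
    if "y \<in> {a..b}" for x y S
  proof -
    have "((\<lambda>x. Complex x y) has_vector_derivative 1) (at x within S)"
      unfolding Complex_eq has_vector_derivative_def
      by (auto intro!: derivative_eq_intros simp: scaleR_conv_of_real)
    from field_vector_diff_chain_within[OF this DF] that ab show ?thesis
      by (simp add: comp_def)
  qed
  have dy: "((\<lambda>y. F (Complex x y)) has_vector_derivative \<i> * F' (Complex x y)) (at y within S)"
    if "y \<in> {a..b}" for x y S
  proof -
    have "((\<lambda>y. Complex x y) has_vector_derivative \<i>) (at y within S)"
      unfolding Complex_eq has_vector_derivative_def
      by (auto intro!: derivative_eq_intros simp: scaleR_conv_of_real mult.commute)
    from field_vector_diff_chain_within[OF this DF] that ab show ?thesis
      by (simp add: comp_def)
  qed
  define G where "G x y = Wy x y * F (Complex x y) + W x y * (\<i> * F' (Complex x y))" for x y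
  define E where "E x y = Wx x y * F (Complex x y) + W x y * F' (Complex x y)" for x y
  define H where "H x y = (Wy x y - \<i> * Wx x y) * F (Complex x y)" for x y
  have cG: "continuous_on ?R (\<lambda>(x, y). G x y)"
    using cW cWy cF cF' unfolding G_def case_prod_unfold by (intro continuous_intros) auto
  have cH: "continuous_on ?R (\<lambda>(x, y). H x y)"
    using cW cWy cWx cF unfolding H_def case_prod_unfold by (intro continuous_intros) auto
  have cE: "continuous_on ?R (\<lambda>(x, y). E x y)"
    using cW cWx cF cF' unfolding E_def case_prod_unfold by (intro continuous_intros) auto
  have cWF: "continuous_on ?R (\<lambda>(x, y). W x y * F (Complex x y))"
    using cW cF unfolding case_prod_unfold by (intro continuous_intros) auto
  have E0: "integral {p..q} (\<lambda>x. E x y) = 0" if y: "y \<in> {a..b}" for y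
  proof -
    have "((\<lambda>x. E x y) has_integral W q y * F (Complex q y) - W p y * F (Complex p y)) {p..q}"
    proof (rule fundamental_theorem_of_calculus[OF pq])
      fix x assume "x \<in> {p..q}"
      from has_vector_derivative_mult[OF Wx[OF this y] dx[OF y, of x "{p..q}"]]
      show "((\<lambda>x. W x y * F (Complex x y)) has_vector_derivative E x y) (at x within {p..q})"
        by (simp add: E_def add.commute)
    qed
    then show ?thesis
      using bd[OF y] by (simp add: integral_unique)
  qed
  have FTC: "integral {a..b} (G x) = W x b * F (Complex x b) - W x a * F (Complex x a)" if x: "x \<in> {p..q}" for x
  proof (rule integral_unique, rule fundamental_theorem_of_calculus[OF ab(2)])
    fix y assume y: "y \<in> {a..b}"
    from has_vector_derivative_mult[OF Wy[OF x y] dy[OF y, of x "{a..b}"]]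
    show "((\<lambda>y. W x y * F (Complex x y)) has_vector_derivative G x y) (at y within {a..b})"
      by (simp add: G_def add.commute)
  qed
  have "integral {p..q} (\<lambda>x. W x b * F (Complex x b)) - integral {p..q} (\<lambda>x. W x a * F (Complex x a)) =
      integral {p..q} (\<lambda>x. W x b * F (Complex x b) - W x a * F (Complex x a))"
    using ab continuous_on_section1[OF cWF] by (intro integral_diff[symmetric] integrable_continuous_real) auto
  also have "\<dots> = integral {p..q} (\<lambda>x. integral {a..b} (G x))"
    by (rule integral_cong) (simp add: FTC)
  also have "\<dots> = integral {a..b} (\<lambda>y. integral {p..q} (\<lambda>x. G x y))"
    using integral_swap_continuous[of p a q b G] cG by (simp add: cbox_Pair_eq)
  also have "\<dots> = integral {a..b} (\<lambda>y. integral {p..q} (\<lambda>x. H x y))"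
  proof (rule integral_cong)
    fix y assume y: "y \<in> {a..b}"
    have "integral {p..q} (\<lambda>x. G x y) = integral {p..q} (\<lambda>x. H x y + \<i> * E x y)"
      by (rule integral_cong) (simp add: G_def H_def E_def algebra_simps)
    also have "\<dots> = integral {p..q} (\<lambda>x. H x y) + integral {p..q} (\<lambda>x. \<i> * E x y)"
      using y continuous_on_section1[OF cH] continuous_on_section1[OF cE]
      by (intro Henstock_Kurzweil_Integration.integral_add integrable_continuous_real continuous_intros) auto
    finally show "integral {p..q} (\<lambda>x. G x y) = integral {p..q} (\<lambda>x. H x y)"
      using E0[OF y] by simp
  qed
  finally show ?thesis
    by (simp add: H_def)
qed

text \<open>Cauchy-Schwarz on each horizontal slice. The bound \<beta> depends on the height alone
  because \<open>F\<close> is controlled only through the norms of its slices, not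
  pointwise.\<close>

lemma Green_strip_bound:
  fixes F :: "complex \<Rightarrow> complex" and W Wx Wy :: "real \<Rightarrow> real \<Rightarrow> complex"
  assumes F: "F holomorphic_on {z. Im z > 0}" and ab: "0 < a" "a \<le> b" and pq: "p \<le> q"
    and Wx: "\<And>x y. x \<in> {p..q} \<Longrightarrow> y \<in> {a..b} \<Longrightarrow> ((\<lambda>x. W x y) has_vector_derivative Wx x y) (at x within {p..q})"
    and Wy: "\<And>x y. x \<in> {p..q} \<Longrightarrow> y \<in> {a..b} \<Longrightarrow> ((\<lambda>y. W x y) has_vector_derivative Wy x y) (at y within {a..b})"
    and cW: "continuous_on ({p..q} \<times> {a..b}) (\<lambda>(x, y). W x y)"
    and cWx: "continuous_on ({p..q} \<times> {a..b}) (\<lambda>(x, y). Wx x y)"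
    and cWy: "continuous_on ({p..q} \<times> {a..b}) (\<lambda>(x, y). Wy x y)"
    and bd: "\<And>y. y \<in> {a..b} \<Longrightarrow> W p y = 0" "\<And>y. y \<in> {a..b} \<Longrightarrow> W q y = 0"
    and sq: "\<And>y. y > 0 \<Longrightarrow> square_integrable (\<lambda>x. F (Complex x y))"
    and N: "\<And>y. y > 0 \<Longrightarrow> norm (abs_L2 (\<lambda>x. F (Complex x y))) \<le> N"
    and \<beta>: "\<And>x y. x \<in> {p..q} \<Longrightarrow> y \<in> {a..b} \<Longrightarrow> cmod (Wy x y - \<i> * Wx x y) \<le> \<beta> y"
    and \<beta>I: "(\<beta> has_integral I) {a..b}"
  shows "cmod (integral {p..q} (\<lambda>x. W x b * F (Complex x b)) - integral {p..q} (\<lambda>x. W x a * F (Complex x a)))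
    \<le> I * sqrt (q - p) * N"
proof -
  let ?R = "{p..q} \<times> {a..b}"
  let ?H = "\<lambda>y. integral {p..q} (\<lambda>x. (Wy x y - \<i> * Wx x y) * F (Complex x y))"
  have cF: "continuous_on ?R (\<lambda>(x, y). F (Complex x y))"
  proof -
    have "continuous_on ?R (\<lambda>z. F (of_real (fst z) + \<i> * of_real (snd z)))"
      using ab by (intro continuous_on_compose2[OF holomorphic_on_imp_continuous_on[OF F]] continuous_intros) auto
    then show ?thesis
      by (simp add: case_prod_unfold Complex_eq)
  qed
  have cH: "continuous_on ({a..b} \<times> {p..q}) (\<lambda>(y, x). (Wy x y - \<i> * Wx x y) * F (Complex x y))"
  proof -
    have "continuous_on ?R (\<lambda>(x, y). (Wy x y - \<i> * Wx x y) * F (Complex x y))"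
      using cWy cWx cF unfolding case_prod_unfold by (intro continuous_intros) auto
    from continuous_on_compose2[OF this continuous_on_swap, of "{a..b} \<times> {p..q}"] show ?thesis
      by (force simp: case_prod_unfold prod.swap_def)
  qed
  have "continuous_on {a..b} ?H"
    using integral_continuous_on_param[of "{a..b}" p q "\<lambda>y x. (Wy x y - \<i> * Wx x y) * F (Complex x y)"] cH
    by simp
  then have iH: "?H integrable_on {a..b}"
    by (rule integrable_continuous_real)
  have "cmod (integral {a..b} ?H) \<le> integral {a..b} (\<lambda>y. \<beta> y * (sqrt (q - p) * N))"
  proof (rule integral_norm_bound_integral[OF iH])
    show "(\<lambda>y. \<beta> y * (sqrt (q - p) * N)) integrable_on {a..b}"
      using \<beta>I by (intro integrable_on_mult_left) (auto simp: integrable_on_def)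
    fix y assume y: "y \<in> {a..b}"
    then have y0: "y > 0"
      using ab by simp
    have c1: "continuous_on {p..q} (\<lambda>x. Wy x y - \<i> * Wx x y)"
      using continuous_on_section1[OF cWy y] continuous_on_section1[OF cWx y] by (intro continuous_intros)
    have "\<beta> y \<ge> 0"
      using \<beta>[of p y] y pq by (meson atLeastAtMost_iff norm_ge_zero order.trans order_refl)
    then have "\<beta> y * sqrt (q - p) * norm (abs_L2 (\<lambda>x. F (Complex x y))) \<le> \<beta> y * sqrt (q - p) * N"
      using pq by (intro mult_left_mono N y0) auto
    then show "cmod (?H y) \<le> \<beta> y * (sqrt (q - p) * N)"
      using integral_interval_cinner(2)[OF sq[OF y0] c1 pq \<beta>[OF _ y]] by (simp add: mult.assoc)
  qed
  also have "\<dots> = I * (sqrt (q - p) * N)"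
    using \<beta>I by (simp add: integral_unique)
  finally show ?thesis
    using Green_strip[OF F ab pq Wx Wy cW cWx cWy bd] by (simp add: mult.assoc)
qed

subsection \<open>The Hardy space as an orthogonal complement\<close>

lemma bounded_bilinear_cinner: "bounded_bilinear cinner_L2"
proof
  show "\<exists>K. \<forall>u v. norm (cinner_L2 u v) \<le> norm u * norm v * K"
    using cinner_Cauchy_Schwarz by (intro exI[of _ 1]) simp
  show "cinner_L2 u (r *\<^sub>R v) = r *\<^sub>R cinner_L2 u v" for u v r
    by (simp add: scaleR_eq_scaleC_L2 cinner_scaleC_right scaleR_conv_of_real)
qed (simp_all add: cinner_add_left cinner_add_right cinner_scaleR_left scaleR_conv_of_real)

lemmas tendsto_cinner = bounded_bilinear.tendsto[OF bounded_bilinear_cinner]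

lemma cnj_L2_diff: "cnj_L2 (u - v) = cnj_L2 u - cnj_L2 v"
proof -
  have "cnj_L2 (abs_L2 (\<lambda>x. rep_L2 u x - rep_L2 v x)) = cnj_L2 u - cnj_L2 v"
    by (subst cnj_L2_abs_L2) (simp_all add: square_integrable_diff square_integrable_cnj cnj_L2_def flip: abs_L2_diff)
  then show ?thesis
    by (simp add: abs_L2_diff)
qed

lemma cmod_cker_le: "cmod (cker w t) \<le> 1 / \<bar>Im w\<bar>" if "Im w \<noteq> 0"
proof -
  have "\<bar>Im w\<bar> \<le> cmod (of_real t - w)"
    using abs_Im_le_cmod[of "of_real t - w"] by simp
  then show ?thesis
    using that by (simp add: cker_def norm_divide frac_le)
qed

lemma tendsto_ker_L2_vertical:
  assumes w: "Im w > 0" and a: "\<And>n. a n > 0" "a \<longlonglongrightarrow> 0"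
  shows "(\<lambda>n. ker_L2 (w + \<i> * of_real (a n))) \<longlonglongrightarrow> ker_L2 w"
  unfolding ker_L2_def
proof (rule tendsto_abs_L2_dominated(2))
  show "square_integrable (cker w)"
    using w by (simp add: square_integrable_cker)
  show "cmod (cker (w + \<i> * of_real (a n)) x) \<le> cmod (cker w x)" for n x
  proof (rule power2_le_imp_le)
    have "(Im w)\<^sup>2 \<le> (Im w + a n)\<^sup>2"
      using w a(1)[of n] by (intro power_mono) auto
    then show "(cmod (cker (w + \<i> * of_real (a n)) x))\<^sup>2 \<le> (cmod (cker w x))\<^sup>2"
      using w by (simp add: cmod_cker_square) (intro divide_left_mono, auto intro!: mult_pos_pos add_nonneg_pos)
  qed simp
  have ne: "of_real x - w \<noteq> 0" for x
    using w by (auto simp: complex_eq_iff)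
  have "(\<lambda>n. 1 / (of_real x - (w + \<i> * of_real (a n)))) \<longlonglongrightarrow> 1 / (of_real x - (w + \<i> * of_real 0))" for x
    by (intro tendsto_intros a) (use ne in simp)
  then show "AE x in lborel. (\<lambda>n. cker (w + \<i> * of_real (a n)) x) \<longlonglongrightarrow> cker w x"
    by (simp add: cker_def)
qed measurable

text \<open>The pairing is the integral of F(z) / (z - cnj w) along the line at height
  \<open>a\<close>; the pole lies below the real axis, so Cauchy's theorem should make it
  independent of the height. As no pointwise decay of \<open>F\<close> is available, the sides of
  the rectangle are removed by a cutoff instead.\<close>

lemma cinner_ker_L2_constant:
  assumes F: "F holomorphic_on {z. Im z > 0}"
    and sq: "\<And>y. y > 0 \<Longrightarrow> square_integrable (\<lambda>x. F (Complex x y))"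
    and N: "\<And>y. y > 0 \<Longrightarrow> norm (abs_L2 (\<lambda>x. F (Complex x y))) \<le> N"
    and w: "Im w > 0" and ab: "0 < a" "a \<le> b"
  shows "cinner_L2 (abs_L2 (\<lambda>x. F (Complex x a))) (ker_L2 (w + \<i> * of_real a)) =
    cinner_L2 (abs_L2 (\<lambda>x. F (Complex x b))) (ker_L2 (w + \<i> * of_real b))"
proof -
  define g where "g x y = 1 / (Complex x y - cnj w)" for x y
  \<comment> \<open>Vanishes at both ends of [-R, R] and tends to 1 pointwise as \<open>R\<close>
    grows, with derivative of size |x| / R^2.\<close>
  define ct where "ct R x = 1 - x\<^sup>2 / R\<^sup>2" for R x :: real
  \<comment> \<open>A bound for |x| |g x y| uniform in \<open>x\<close> and in \<open>y > 0\<close>: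
    |x| is at most |x - Re w| + |Re w|, and the distance to the pole is at least both |x - Re w| and
    Im w.\<close>
  define \<kappa> where "\<kappa> = 1 + \<bar>Re w\<bar> / Im w"
  have den: "Complex x y - cnj w \<noteq> 0" if "y > 0" for x y
    using w that by (auto simp: complex_eq_iff)
  have g_cker: "cnj (g x y) = cker (w + \<i> * of_real y) x" for x y
    by (simp add: g_def cker_def Complex_eq algebra_simps)
  have cg: "continuous_on ({p..q} \<times> {a..b}) (\<lambda>(x, y). g x y)" for p q
    unfolding g_def case_prod_unfold Complex_eq
    using den ab by (intro continuous_intros) (auto simp: Complex_eq)
  have g_bound: "\<bar>x\<bar> * cmod (g x y) \<le> \<kappa>" if y: "y > 0" for x y
  proof -
    let ?D = "cmod (Complex x y - cnj w)"
    have D: "?D > 0"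
      using den[OF y] by simp
    have 1: "\<bar>x - Re w\<bar> \<le> ?D"
      using abs_Re_le_cmod[of "Complex x y - cnj w"] by simp
    have 2: "Im w \<le> ?D"
      using abs_Im_le_cmod[of "Complex x y - cnj w"] y w by simp
    have "\<bar>Re w\<bar> * Im w \<le> \<bar>Re w\<bar> * ?D"
      using 2 by (rule mult_left_mono) simp
    then have "\<bar>Re w\<bar> \<le> \<bar>Re w\<bar> / Im w * ?D"
      using w by (simp add: field_simps)
    then have "\<bar>x\<bar> \<le> \<kappa> * ?D"
      using 1 by (simp add: \<kappa>_def distrib_right)
    then show ?thesis
      using D by (simp add: g_def norm_divide divide_le_eq)
  qed
  let ?f = "\<lambda>y x. F (Complex x y)"
  let ?J = "\<lambda>R y. integral {-R..R} (\<lambda>x. of_real (ct R x) * g x y * F (Complex x y))"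
  have lim: "(\<lambda>n. ?J (real (Suc n)) y) \<longlonglongrightarrow> cinner_L2 (abs_L2 (?f y)) (ker_L2 (w + \<i> * of_real y))"
    if y: "y \<in> {a..b}" for y
  proof -
    have y0: "y > 0"
      using y ab by simp
    let ?g = "\<lambda>n x. indicator {- real (Suc n)..real (Suc n)} x * cnj (of_real (ct (real (Suc n)) x) * g x y)"
    have cont: "continuous_on {-R..R} (\<lambda>x. of_real (ct R x) * g x y)" for R
      unfolding ct_def divide_inverse by (intro continuous_intros continuous_on_section1[OF cg y])
    have chi: "\<bar>ct R x\<bar> \<le> 1" if "x \<in> {-R..R}" "R > 0" for R x
    proof -
      have "x\<^sup>2 \<le> R\<^sup>2"
        using that by (intro abs_le_square_iff[THEN iffD1]) auto
      then have "x\<^sup>2 / R\<^sup>2 \<le> 1" "x\<^sup>2 / R\<^sup>2 \<ge> 0"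
        using that by auto
      then show ?thesis by (simp add: ct_def)
    qed
    have bnd: "cmod (of_real (ct (real (Suc n)) x) * g x y) \<le> 1 / (Im w + y)" if "x \<in> {- real (Suc n)..real (Suc n)}" for n x
    proof -
      have "cmod (g x y) \<le> 1 / (Im w + y)"
        using cmod_cker_le[of "w + \<i> * of_real y" x] w y0 by (simp flip: g_cker)
      moreover have "\<bar>ct (real (Suc n)) x\<bar> * cmod (g x y) \<le> 1 * cmod (g x y)"
        using chi[OF that] by (intro mult_right_mono) auto
      ultimately show ?thesis
        by (simp add: norm_mult)
    qed
    have J: "?J (real (Suc n)) y = cinner_L2 (abs_L2 (?f y)) (abs_L2 (?g n))" "square_integrable (?g n)" for n
      by (rule integral_interval_cinner[OF sq[OF y0] cont _ bnd]; simp)+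
    have "(\<lambda>n. abs_L2 (?g n)) \<longlonglongrightarrow> ker_L2 (w + \<i> * of_real y)"
      unfolding ker_L2_def
    proof (rule tendsto_abs_L2_dominated(2))
      show "?g n \<in> borel_measurable borel" for n
        using J(2) by (rule square_integrable_measurable)
      show "square_integrable (cker (w + \<i> * of_real y))"
        using w y0 by (simp add: square_integrable_cker)
      show "cmod (?g n x) \<le> cmod (cker (w + \<i> * of_real y) x)" for n x
        using chi[of x "real (Suc n)"]
        by (auto simp: indicator_def norm_mult g_cker[symmetric] simp del: of_nat_Suc intro!: mult_left_le_one_le)
      show "AE x in lborel. (\<lambda>n. ?g n x) \<longlonglongrightarrow> cker (w + \<i> * of_real y) x"
      proof (rule AE_I2)
        fix x
        have "(\<lambda>n. of_real (1 - x\<^sup>2 / (real (Suc n))\<^sup>2) * cnj (g x y)) \<longlonglongrightarrow> of_real (1 - 0) * cnj (g x y)"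
          by (intro tendsto_intros) real_asymp
        moreover have "\<forall>\<^sub>F n in sequentially. of_real (1 - x\<^sup>2 / (real (Suc n))\<^sup>2) * cnj (g x y) = ?g n x"
        proof -
          obtain m :: nat where m: "\<bar>x\<bar> \<le> m"
            using real_arch_simple by blast
          show ?thesis
            using eventually_ge_at_top[of m]
          proof eventually_elim
            case (elim n)
            then have "x \<in> {- real (Suc n)..real (Suc n)}"
              using m by auto
            then show ?case
              by (simp add: ct_def)
          qed
        qed
        ultimately show "(\<lambda>n. ?g n x) \<longlonglongrightarrow> cker (w + \<i> * of_real y) x"
          unfolding g_cker[symmetric] using Lim_transform_eventually by force
      qed
    qed measurable
    then show ?thesis
      unfolding J(1) by (intro tendsto_cinner tendsto_const)
  qed
  \<comment> \<open>Only the derivative of the cutoff contributes, as \<open>g\<close> is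
    holomorphic. The defect is at most 2 \<kappa> / R^2, and Cauchy-Schwarz over [-R, R] costs only
    the square root of 2 R, so the difference tends to 0.\<close>
  have bound: "cmod (?J R b - ?J R a) \<le> ((2 * \<kappa> / R\<^sup>2) * (b - a)) * sqrt (R - (- R)) * N" if R: "R > 0" for R
  proof (rule Green_strip_bound[OF F ab, where \<beta> = "\<lambda>_. 2 * \<kappa> / R\<^sup>2"
        and Wx = "\<lambda>x y. - of_real (2 * x / R\<^sup>2) * g x y - of_real (ct R x) * (g x y)\<^sup>2"
        and Wy = "\<lambda>x y. - \<i> * of_real (ct R x) * (g x y)\<^sup>2"])
    fix x y assume y: "y \<in> {a..b}"
    then have y0: "y > 0"
      using ab by simp
    have dne: "of_real x + \<i> * of_real y - cnj w \<noteq> 0"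
      using den[OF y0, of x] by (simp add: Complex_eq)
    have 1: "((\<lambda>z. 1 / (z - cnj w)) has_field_derivative - ((g x y)\<^sup>2)) (at (Complex x y) within S)" for S
      using den[OF y0, of x] by (auto intro!: derivative_eq_intros simp: g_def power2_eq_square divide_simps)
    have 2: "((\<lambda>x. Complex x y) has_vector_derivative 1) (at x within S)" for S
      unfolding Complex_eq has_vector_derivative_def
      by (auto intro!: derivative_eq_intros simp: scaleR_conv_of_real)
    have 3: "((\<lambda>y. Complex x y) has_vector_derivative \<i>) (at y within S)" for S
      unfolding Complex_eq has_vector_derivative_def
      by (auto intro!: derivative_eq_intros simp: scaleR_conv_of_real mult.commute)
    have gx: "((\<lambda>x. g x y) has_vector_derivative - ((g x y)\<^sup>2)) (at x within S)" for S
      using field_vector_diff_chain_within[OF 2 1] by (simp add: g_def comp_def)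
    have gy: "((\<lambda>y. g x y) has_vector_derivative - (\<i> * (g x y)\<^sup>2)) (at y within S)" for S
      using field_vector_diff_chain_within[OF 3 1] by (simp add: g_def comp_def)
    have "(ct R has_real_derivative (- (2 * x / R\<^sup>2))) (at x within S)" for S
      unfolding ct_def divide_inverse by (auto intro!: derivative_eq_intros)
    then have cx: "((\<lambda>x. complex_of_real (ct R x)) has_vector_derivative of_real (- (2 * x / R\<^sup>2))) (at x within S)" for S
      by (intro has_vector_derivative_of_real) (simp add: has_real_derivative_iff_has_vector_derivative)
    show "((\<lambda>x. of_real (ct R x) * g x y) has_vector_derivative
        - of_real (2 * x / R\<^sup>2) * g x y - of_real (ct R x) * (g x y)\<^sup>2) (at x within {-R..R})"
      by (rule has_vector_derivative_eq_rhs[OF has_vector_derivative_mult[OF cx gx]]) (simp add: algebra_simps)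
    show "((\<lambda>y. of_real (ct R x) * g x y) has_vector_derivative - \<i> * of_real (ct R x) * (g x y)\<^sup>2) (at y within {a..b})"
      by (rule has_vector_derivative_eq_rhs[OF has_vector_derivative_mult_right[OF gy]]) (simp add: algebra_simps)
    have "- \<i> * of_real (ct R x) * (g x y)\<^sup>2 - \<i> * (- of_real (2 * x / R\<^sup>2) * g x y - of_real (ct R x) * (g x y)\<^sup>2)
        = \<i> * of_real (2 / R\<^sup>2) * (of_real x * g x y)"
      by (simp add: algebra_simps)
    then show "cmod (- \<i> * of_real (ct R x) * (g x y)\<^sup>2 - \<i> * (- of_real (2 * x / R\<^sup>2) * g x y - of_real (ct R x) * (g x y)\<^sup>2))
        \<le> 2 * \<kappa> / R\<^sup>2"
      using g_bound[OF y0, of x] R by (simp only: norm_mult) (simp add: norm_divide norm_power divide_right_mono)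
  next
    have cc: "continuous_on T (\<lambda>z. complex_of_real (ct R (fst z)))" for T :: "(real \<times> real) set"
      unfolding ct_def divide_inverse by (intro continuous_intros)
    note cg' = cg[unfolded case_prod_unfold]
    show "continuous_on ({-R..R} \<times> {a..b}) (\<lambda>(x, y). of_real (ct R x) * g x y)"
      "continuous_on ({-R..R} \<times> {a..b}) (\<lambda>(x, y). - of_real (2 * x / R\<^sup>2) * g x y - of_real (ct R x) * (g x y)\<^sup>2)"
      "continuous_on ({-R..R} \<times> {a..b}) (\<lambda>(x, y). - \<i> * of_real (ct R x) * (g x y)\<^sup>2)"
      unfolding case_prod_unfold divide_inverse by (intro continuous_intros cc cg')+
    show "((\<lambda>_. 2 * \<kappa> / R\<^sup>2) has_integral (2 * \<kappa> / R\<^sup>2) * (b - a)) {a..b}"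
      using has_integral_const_real[of "2 * \<kappa> / R\<^sup>2" a b] ab by (simp add: mult.commute)
  qed (use R sq N in \<open>auto simp: ct_def\<close>)
  have "(\<lambda>n. ?J (real (Suc n)) b - ?J (real (Suc n)) a) \<longlonglongrightarrow> 0"
  proof (rule Lim_null_comparison[OF always_eventually], rule allI)
    show "cmod (?J (real (Suc n)) b - ?J (real (Suc n)) a) \<le>
        ((2 * \<kappa> / (real (Suc n))\<^sup>2) * (b - a)) * sqrt (real (Suc n) - (- real (Suc n))) * N" for n
      by (rule bound) simp
    show "(\<lambda>n. ((2 * \<kappa> / (real (Suc n))\<^sup>2) * (b - a)) * sqrt (real (Suc n) - (- real (Suc n))) * N) \<longlonglongrightarrow> 0"
      by real_asymp
  qed
  moreover have "(\<lambda>n. ?J (real (Suc n)) b - ?J (real (Suc n)) a) \<longlonglongrightarrow>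
      cinner_L2 (abs_L2 (?f b)) (ker_L2 (w + \<i> * of_real b)) - cinner_L2 (abs_L2 (?f a)) (ker_L2 (w + \<i> * of_real a))"
    using ab by (intro tendsto_diff lim) auto
  ultimately show ?thesis
    using LIMSEQ_unique by fastforce
qed

text \<open>At great height the kernel has norm of order y^(-1/2) while the slices of
  \<open>F\<close> stay bounded, so the constant in \<open>cinner_ker_L2_constant\<close> is 0.
  Letting the height decrease to 0 gives the claim for the boundary function.\<close>

lemma H2_orthogonal_ker:
  assumes u: "u \<in> H2" and w: "Im w > 0"
  shows "cinner_L2 u (ker_L2 w) = 0"
proof -
  from u obtain F C where F: "F holomorphic_on {z. Im z > 0}"
    and sq: "\<And>y. y > 0 \<Longrightarrow> square_integrable (\<lambda>x. F (Complex x y))"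
    and C: "\<And>y. y > 0 \<Longrightarrow> (LINT x|lborel. (cmod (F (Complex x y)))\<^sup>2) \<le> C"
    and lim: "((\<lambda>y. abs_L2 (\<lambda>x. F (Complex x y))) \<longlongrightarrow> u) (at_right 0)"
    unfolding H2_def by blast
  let ?f = "\<lambda>y. abs_L2 (\<lambda>x. F (Complex x y))"
  have N: "norm (?f y) \<le> sqrt C" if "y > 0" for y
    using C[OF that] norm_abs_L2_square[OF sq[OF that]] by (simp add: real_le_rsqrt)
  let ?I = "\<lambda>y. cinner_L2 (?f y) (ker_L2 (w + \<i> * of_real y))"
  have zero: "?I a = 0" if a: "a > 0" for a
  proof -
    have le: "cmod (?I a) \<le> sqrt C * sqrt (pi / (Im w + y))" if y: "y \<ge> a" for y
    proof -
      have y0: "y > 0"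
        using y a by simp
      have nk: "norm (ker_L2 (w + \<i> * of_real y)) = sqrt (pi / (Im w + y))"
        using norm_ker_L2[of "w + \<i> * of_real y"] w y0 by (simp add: real_sqrt_unique)
      have "?I a = ?I y"
        by (rule cinner_ker_L2_constant[OF F sq N w a y]) 
      also have "cmod \<dots> \<le> norm (?f y) * norm (ker_L2 (w + \<i> * of_real y))"
        by (rule cinner_Cauchy_Schwarz)
      also have "\<dots> \<le> sqrt C * sqrt (pi / (Im w + y))"
        unfolding nk using N[OF y0] w y0 by (intro mult_right_mono) auto
      finally show ?thesis .
    qed
    have "((\<lambda>y. sqrt C * sqrt (pi / (Im w + y))) \<longlongrightarrow> 0) at_top"
      by real_asymp
    moreover have "\<forall>\<^sub>F y in at_top. cmod (?I a) \<le> sqrt C * sqrt (pi / (Im w + y))"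
      using eventually_ge_at_top[of a] by eventually_elim (rule le)
    ultimately have "cmod (?I a) \<le> 0"
      by (rule tendsto_lowerbound) simp
    then show ?thesis by simp
  qed
  define a where "a n = inverse (real (Suc n))" for n
  have a: "a n > 0" "a \<longlonglongrightarrow> 0" for n
    unfolding a_def by (simp, rule LIMSEQ_inverse_real_of_nat)
  have "filterlim a (at_right 0) sequentially"
    using a by (intro tendsto_imp_filterlim_at_right) auto
  then have "(\<lambda>n. ?f (a n)) \<longlonglongrightarrow> u"
    by (rule filterlim_compose[OF lim])
  then have "(\<lambda>n. ?I (a n)) \<longlonglongrightarrow> cinner_L2 u (ker_L2 w)"
    by (intro tendsto_cinner tendsto_ker_L2_vertical w a)
  then show ?thesis
    using zero[OF a(1)] by (simp add: LIMSEQ_const_iff)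
qed

lemma ker_L2_in_H2:
  assumes w: "Im w < 0"
  shows "ker_L2 w \<in> H2"
  unfolding H2_def
proof (intro CollectI exI conjI allI impI)
  let ?F = "\<lambda>z. 1 / (z - w)" and ?C = "pi / \<bar>Im w\<bar>"
  have eq: "(\<lambda>x. ?F (Complex x y)) = cker (w - \<i> * of_real y)" for y
    by (simp add: fun_eq_iff cker_def Complex_eq algebra_simps)
  show "?F holomorphic_on {z. Im z > 0}"
    using w by (intro holomorphic_intros) auto
  fix y :: real assume y: "y > 0"
  show "square_integrable (\<lambda>x. ?F (Complex x y))"
    unfolding eq using w y by (intro square_integrable_cker) auto
  show "(LINT x|lborel. (cmod (?F (Complex x y)))\<^sup>2) \<le> ?C"
    unfolding eq[THEN fun_cong]
  proof (subst square_integrable_cker_norm(2))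
    have "pi / (y - Im w) \<le> pi / (- Im w)"
      using w y by (intro divide_left_mono mult_pos_pos) auto
    then show "pi / \<bar>Im (w - \<i> * of_real y)\<bar> \<le> ?C"
      using w y by simp
  qed (use w y in auto)
next
  let ?F = "\<lambda>z. 1 / (z - w)"
  have eq: "abs_L2 (\<lambda>x. ?F (Complex x y)) = cnj_L2 (ker_L2 (cnj w + \<i> * of_real y))" if "y > 0" for y
    using cnj_ker_L2[of "cnj w + \<i> * of_real y"] w that
    by (simp add: ker_L2_def cker_def[abs_def] Complex_eq algebra_simps)
  show "((\<lambda>y. abs_L2 (\<lambda>x. ?F (Complex x y))) \<longlongrightarrow> ker_L2 w) (at_right 0)"
  proof (rule tendsto_at_right_sequentially[of 0 1])
    fix S :: "nat \<Rightarrow> real" assume S: "\<And>n. 0 < S n" "S \<longlonglongrightarrow> 0"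
    have "(\<lambda>n. norm (ker_L2 (cnj w + \<i> * of_real (S n)) - ker_L2 (cnj w))) \<longlonglongrightarrow> 0"
      using tendsto_ker_L2_vertical[of "cnj w" S] w S by (simp add: tendsto_norm_zero_iff flip: Lim_null)
    moreover have "norm (ker_L2 (cnj w + \<i> * of_real y) - ker_L2 (cnj w)) =
        norm (abs_L2 (\<lambda>x. ?F (Complex x y)) - ker_L2 w)" if "y > 0" for y
    proof -
      have "ker_L2 w = cnj_L2 (ker_L2 (cnj w))"
        using cnj_ker_L2[of "cnj w"] w by simp
      then show ?thesis
        unfolding eq[OF that] by (simp only: cnj_L2_diff[symmetric] norm_cnj_L2)
    qed
    ultimately have "(\<lambda>n. norm (abs_L2 (\<lambda>x. ?F (Complex x (S n))) - ker_L2 w)) \<longlonglongrightarrow> 0"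
      using S by simp
    then show "(\<lambda>n. abs_L2 (\<lambda>x. ?F (Complex x (S n)))) \<longlonglongrightarrow> ker_L2 w"
      using Lim_null tendsto_norm_zero_iff by blast
  qed simp
qed

text \<open>The Cauchy integral of \<open>u\<close>. The conjugate of \<open>z\<close> appears
  because \<open>cinner_L2\<close> conjugates its second argument.\<close>

definition hardy_ext :: "L2 \<Rightarrow> complex \<Rightarrow> complex" where
  "hardy_ext u z = cinner_L2 u (ker_L2 (cnj z)) / (2 * pi * \<i>)"

lemma integrable_mult_bounded:
  fixes f m :: "real \<Rightarrow> complex"
  assumes "integrable lborel f" "m \<in> borel_measurable borel" "\<And>x. cmod (m x) \<le> B"
  shows "integrable lborel (\<lambda>x. f x * m x)"
proof (rule Bochner_Integration.integrable_bound)
  show "integrable lborel (\<lambda>x. B * cmod (f x))"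
    using assms(1) by simp
  show "AE x in lborel. cmod (f x * m x) \<le> norm (B * cmod (f x))"
  proof (rule AE_I2)
    fix x
    have "B \<ge> 0"
      using assms(3)[of x] norm_ge_zero order.trans by blast
    then show "cmod (f x * m x) \<le> norm (B * cmod (f x))"
      using mult_left_mono[OF assms(3)[of x] norm_ge_zero[of "f x"]] by (simp add: norm_mult abs_mult mult_ac)
  qed
qed (use assms in measurable)

text \<open>Differentiation under the integral sign by the exact remainder formula 1/(t-w) - 1/(t-z)
  - (w-z)/(t-z)^2 = (w-z)^2 / ((t-z)^2 (t-w)). The last factor stays bounded once \<open>w\<close>
  is closer to \<open>z\<close> than half of \<open>Im z\<close>.\<close>

lemma holomorphic_hardy_ext: "hardy_ext u holomorphic_on {z. Im z > 0}"
proof -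
  let ?f = "\<lambda>z t. rep_L2 u t * cker z t"
  let ?h = "\<lambda>z. LINT t|lborel. ?f z t"
  have int: "integrable lborel (?f z)" if "Im z > 0" for z
    using cinner_ker_L2(1)[of "cnj z" u] that by simp
  have "\<exists>D. (?h has_field_derivative D) (at z)" if z: "Im z > 0" for z
  proof -
    define D where "D = (LINT t|lborel. ?f z t * cker z t)"
    define K where "K = (LINT t|lborel. cmod (?f z t))"
    have iD: "integrable lborel (\<lambda>t. ?f z t * cker z t)"
      by (rule integrable_mult_bounded[OF int[OF z] measurable_cker cmod_cker_le]) (use z in simp)
    have K0: "K \<ge> 0"
      unfolding K_def by simp
    have est: "cmod ((?h w - ?h z) / (w - z) - D) \<le> cmod (w - z) * (2 / (Im z)\<^sup>2 * K)"
      if w: "w \<noteq> z" "dist w z < Im z / 2" for w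
    proof -
      have "\<bar>Im w - Im z\<bar> < Im z / 2"
        using w(2) abs_Im_le_cmod[of "w - z"] by (simp add: dist_norm)
      then have Iw: "Im w > Im z / 2"
        by linarith
      then have Iw0: "Im w > 0"
        using z by linarith
      have ne: "of_real t - z \<noteq> 0" "of_real t - w \<noteq> 0" for t
        using z Iw0 by (auto simp: complex_eq_iff)
      have id: "?f w t - ?f z t - (w - z) * (?f z t * cker z t) = (w - z)\<^sup>2 * (?f z t * (cker z t * cker w t))" for t
        using ne[of t] by (simp add: cker_def divide_simps) (simp add: power2_eq_square algebra_simps)
      have "?h w - ?h z - (w - z) * D = (LINT t|lborel. ?f w t - ?f z t - (w - z) * (?f z t * cker z t))"
        unfolding D_def using int[OF z] int[OF Iw0] iD by simp
      also have "\<dots> = (w - z)\<^sup>2 * (LINT t|lborel. ?f z t * (cker z t * cker w t))"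
        unfolding id by simp
      finally have eq: "?h w - ?h z - (w - z) * D = (w - z)\<^sup>2 * (LINT t|lborel. ?f z t * (cker z t * cker w t))" .
      have "cmod (LINT t|lborel. ?f z t * (cker z t * cker w t)) \<le>
          (LINT t|lborel. cmod (?f z t * (cker z t * cker w t)))"
        by (rule integral_norm_bound)
      also have "\<dots> \<le> (LINT t|lborel. cmod (?f z t) * (2 / (Im z)\<^sup>2))"
      proof (rule Bochner_Integration.integral_mono)
        have kk: "cmod (cker z t * cker w t) \<le> 2 / (Im z)\<^sup>2" for t
        proof -
          have "cmod (cker z t) * cmod (cker w t) \<le> (1 / Im z) * (2 / Im z)"
          proof (rule mult_mono)
            show "cmod (cker z t) \<le> 1 / Im z"
              using cmod_cker_le[of z t] z by simp
            have "cmod (cker w t) \<le> 1 / Im w"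
              using cmod_cker_le[of w t] Iw0 by simp
            also have "\<dots> \<le> 1 / (Im z / 2)"
              using Iw z by (intro divide_left_mono) auto
            finally show "cmod (cker w t) \<le> 2 / Im z" by simp
          qed (use z in auto)
          then show ?thesis
            by (simp add: norm_mult power2_eq_square)
        qed
        show "integrable lborel (\<lambda>t. cmod (?f z t * (cker z t * cker w t)))"
          by (rule integrable_norm, rule integrable_mult_bounded[OF int[OF z] _ kk]) measurable
        show "integrable lborel (\<lambda>t. cmod (?f z t) * (2 / (Im z)\<^sup>2))"
          using int[OF z] by (intro integrable_mult_left) auto
        show "cmod (?f z t * (cker z t * cker w t)) \<le> cmod (?f z t) * (2 / (Im z)\<^sup>2)" for t
          unfolding norm_mult[of "?f z t"] by (intro mult_left_mono kk) simp
      qed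
      also have "\<dots> = 2 / (Im z)\<^sup>2 * K"
        unfolding K_def by (simp add: mult.commute)
      finally have b: "cmod (LINT t|lborel. ?f z t * (cker z t * cker w t)) \<le> 2 / (Im z)\<^sup>2 * K" .
      have "(?h w - ?h z) / (w - z) - D = (?h w - ?h z - (w - z) * D) / (w - z)"
        using w(1) by (simp add: diff_divide_distrib)
      also have "\<dots> = (w - z) * (LINT t|lborel. ?f z t * (cker z t * cker w t))"
        unfolding eq using w(1) by (simp add: power2_eq_square)
      finally have q: "(?h w - ?h z) / (w - z) - D = (w - z) * (LINT t|lborel. ?f z t * (cker z t * cker w t))" .
      show ?thesis
        unfolding q norm_mult[of "w - z"] by (rule mult_left_mono[OF b norm_ge_zero])
    qed
    have "((\<lambda>w. (?h w - ?h z) / (w - z) - D) \<longlongrightarrow> 0) (at z)"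
    proof (rule Lim_null_comparison)
      show "\<forall>\<^sub>F w in at z. cmod ((?h w - ?h z) / (w - z) - D) \<le> cmod (w - z) * (2 / (Im z)\<^sup>2 * K)"
        unfolding eventually_at using est z by (intro exI[of _ "Im z / 2"]) auto
      have "((\<lambda>w. cmod (w - z) * (2 / (Im z)\<^sup>2 * K)) \<longlongrightarrow> cmod (z - z) * (2 / (Im z)\<^sup>2 * K)) (at z)"
        by (intro tendsto_intros)
      then show "((\<lambda>w. cmod (w - z) * (2 / (Im z)\<^sup>2 * K)) \<longlongrightarrow> 0) (at z)"
        by simp
    qed
    then have "((\<lambda>w. (?h w - ?h z) / (w - z)) \<longlongrightarrow> D) (at z)"
      by (subst Lim_null)
    then show ?thesis
      by (auto simp: has_field_derivative_iff)
  qed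
  then have "?h holomorphic_on {z. Im z > 0}"
    by (auto simp: holomorphic_on_def field_differentiable_def intro: has_field_derivative_at_within)
  then have "(\<lambda>z. ?h z / (2 * pi * \<i>)) holomorphic_on {z. Im z > 0}"
    by (intro holomorphic_intros) auto
  then show ?thesis
    by (rule holomorphic_transform) (simp add: hardy_ext_def cinner_ker_L2)
qed

lemma hardy_ext_eq_pois:
  assumes "\<And>w. Im w > 0 \<Longrightarrow> cinner_L2 u (ker_L2 w) = 0" "y > 0"
  shows "hardy_ext u (Complex x y) = pois u x y"
  using assms by (simp add: hardy_ext_def pois_def complex_cnj)

text \<open>For the converse, orthogonality to the kernels makes the Cauchy integral of
  \<open>u\<close> coincide with its Poisson integral: the first is holomorphic, while the second
  has bounded slices and converges to \<open>u\<close>.\<close>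

lemma H2_iff: "u \<in> H2 \<longleftrightarrow> (\<forall>w. Im w > 0 \<longrightarrow> cinner_L2 u (ker_L2 w) = 0)"
proof
  assume u: "\<forall>w. Im w > 0 \<longrightarrow> cinner_L2 u (ker_L2 w) = 0"
  have eq: "(\<lambda>x. hardy_ext u (Complex x y)) = (\<lambda>x. pois u x y)" if "y > 0" for y
    using u that by (simp add: hardy_ext_eq_pois)
  show "u \<in> H2"
    unfolding H2_def
  proof (intro CollectI exI conjI allI impI)
    show "hardy_ext u holomorphic_on {z. Im z > 0}"
      by (rule holomorphic_hardy_ext)
    fix y :: real assume y: "y > 0"
    show "square_integrable (\<lambda>x. hardy_ext u (Complex x y))"
      unfolding eq[OF y] by (rule square_integrable_pois[OF y])
    show "(LINT x|lborel. (cmod (hardy_ext u (Complex x y)))\<^sup>2) \<le> (norm u)\<^sup>2"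
      unfolding eq[OF y, THEN fun_cong] norm_abs_L2_square[OF square_integrable_pois(1)[OF y], symmetric]
      by (intro power_mono square_integrable_pois y) simp
  next
    show "((\<lambda>y. abs_L2 (\<lambda>x. hardy_ext u (Complex x y))) \<longlongrightarrow> u) (at_right 0)"
    proof (rule Lim_transform_eventually[OF tendsto_pois_L2])
      show "\<forall>\<^sub>F y in at_right 0. pois_L2 y u = abs_L2 (\<lambda>x. hardy_ext u (Complex x y))"
        using eventually_at_right_less[of 0] by eventually_elim (simp add: eq pois_L2_def)
    qed
  qed
qed (auto simp: H2_orthogonal_ker)

lemma hardy_ext_slice:
  assumes "u \<in> H2" "y > 0"
  shows "square_integrable (\<lambda>x. hardy_ext u (Complex x y))" "norm (abs_L2 (\<lambda>x. hardy_ext u (Complex x y))) \<le> norm u"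
proof -
  have "(\<lambda>x. hardy_ext u (Complex x y)) = (\<lambda>x. pois u x y)"
    using assms by (simp add: hardy_ext_eq_pois H2_iff)
  then show "square_integrable (\<lambda>x. hardy_ext u (Complex x y))" "norm (abs_L2 (\<lambda>x. hardy_ext u (Complex x y))) \<le> norm u"
    using square_integrable_pois[OF assms(2)] by simp_all
qed

lemma tendsto_hardy_ext:
  assumes "u \<in> H2"
  shows "((\<lambda>y. abs_L2 (\<lambda>x. hardy_ext u (Complex x y))) \<longlongrightarrow> u) (at_right 0)"
proof (rule Lim_transform_eventually[OF tendsto_pois_L2])
  show "\<forall>\<^sub>F y in at_right 0. pois_L2 y u = abs_L2 (\<lambda>x. hardy_ext u (Complex x y))"
    using eventually_at_right_less[of 0]
    by eventually_elim (use assms in \<open>simp add: hardy_ext_eq_pois H2_iff pois_L2_def\<close>)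
qed

lemma closed_csubspace_H2: "closed_csubspace H2"
proof -
  have "closed {u. cinner_L2 u v = 0}" for v
    by (intro closed_Collect_eq continuous_on_const
        linear_continuous_on[OF bounded_linear_cinner_left])
  then have "closed (\<Inter>w\<in>{w. Im w > 0}. {u. cinner_L2 u (ker_L2 w) = 0})"
    by (intro closed_INT) auto
  moreover have "(\<Inter>w\<in>{w. Im w > 0}. {u. cinner_L2 u (ker_L2 w) = 0}) = H2"
    by (auto simp: H2_iff)
  ultimately show ?thesis
    by (auto simp: closed_csubspace_def subspace_def H2_iff cinner_add_left cinner_scaleR_left cinner_scaleC_left)
qed

text \<open>Conjugation moves the pole of a Cauchy kernel to the other half plane. This reduces
  decreasing phases to increasing ones: the part of a vector orthogonal to \<open>H2\<close> is
  conjugated into \<open>H2\<close>, where \<open>H2_oscillation_decay\<close> applies.\<close>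

lemma cnj_L2_in_H2:
  assumes "\<And>v. v \<in> H2 \<Longrightarrow> cinner_L2 u v = 0"
  shows "cnj_L2 u \<in> H2"
  using assms ker_L2_in_H2 by (auto simp: H2_iff cinner_cnj_L2 cnj_ker_L2)

subsection \<open>Decay of oscillating functions against the Hardy space\<close>

text \<open>The bound is the integral over the whole half-line, so it survives when the strip is
  enlarged to the half plane.\<close>

lemma has_integral_linear_exp_bound:
  fixes M X c a b :: real
  assumes "a > 0" "a \<le> b" "c > 0" "M \<ge> 0" "X \<ge> 0"
  obtains I where "((\<lambda>y. (M * y + X) * exp (- (c * y))) has_integral I) {a..b}" "I \<le> M / c\<^sup>2 + X / c"
proof -
  define B where "B y = - ((M * y / c + M / c\<^sup>2 + X / c) * exp (- (c * y)))" for y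
  have "((\<lambda>y. (M * y + X) * exp (- (c * y))) has_integral (B b - B a)) {a..b}"
  proof (rule fundamental_theorem_of_calculus[OF assms(2)])
    fix y
    have "(B has_real_derivative - ((M / c) * exp (- (c * y)) + (M * y / c + M / c\<^sup>2 + X / c) * (exp (- (c * y)) * (- c))))
        (at y within {a..b})"
      unfolding B_def using assms by (auto intro!: derivative_eq_intros simp: field_simps)
    moreover have "- ((M / c) * exp (- (c * y)) + (M * y / c + M / c\<^sup>2 + X / c) * (exp (- (c * y)) * (- c))) =
        (M * y + X) * exp (- (c * y))"
      using assms by (simp add: field_simps power2_eq_square)
    ultimately show "(B has_vector_derivative (M * y + X) * exp (- (c * y))) (at y within {a..b})"
      by (simp add: has_real_derivative_iff_has_vector_derivative)
  qed
  moreover have "B b - B a \<le> M / c\<^sup>2 + X / c"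
  proof -
    have "B b \<le> 0"
      unfolding B_def using assms by (auto intro!: mult_nonneg_nonneg add_nonneg_nonneg)
    moreover have "- B a \<le> M / c\<^sup>2 + X / c"
    proof -
      have 1: "(1 + c * a) * exp (- (c * a)) \<le> 1"
        using exp_ge_add_one_self[of "c * a"] by (simp add: exp_minus field_simps)
      have 2: "exp (- (c * a)) \<le> 1"
        using assms by simp
      have "- B a = (M / c\<^sup>2) * ((1 + c * a) * exp (- (c * a))) + (X / c) * exp (- (c * a))"
        using assms by (simp add: B_def field_simps power2_eq_square)
      also have "\<dots> \<le> (M / c\<^sup>2) * 1 + (X / c) * 1"
        using assms by (intro add_mono mult_left_mono 1 2) auto
      finally show ?thesis by simp
    qed
    ultimately show ?thesis by linarith
  qed
  ultimately show ?thesis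
    using that by blast
qed

text \<open>\<open>Green_strip_bound\<close> is applied to the pairing with the conjugated test
  function. The upper edge of the strip disappears as its height grows because of the factor exp(-c
  y), and the lower edge tends to the inner product in question. If \<open>c\<close> and
  \<open>M\<close> both have order t, the bound has order 1/t.\<close>

lemma H2_oscillation_decay:
  fixes h h1 h2 ct ct1 :: "real \<Rightarrow> real"
  assumes u: "u \<in> H2" and pq: "p < q"
    and h: "\<And>x. x \<in> {p..q} \<Longrightarrow> (h has_real_derivative h1 x) (at x within {p..q})"
    and h1: "\<And>x. x \<in> {p..q} \<Longrightarrow> (h1 has_real_derivative h2 x) (at x within {p..q})"
    and h2: "continuous_on {p..q} h2"
    and c: "c > 0" "\<And>x. x \<in> {p..q} \<Longrightarrow> h1 x \<ge> c" and M: "\<And>x. x \<in> {p..q} \<Longrightarrow> \<bar>h2 x\<bar> \<le> M"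
    and ct: "\<And>x. x \<in> {p..q} \<Longrightarrow> (ct has_real_derivative ct1 x) (at x within {p..q})"
    and ct1: "continuous_on {p..q} ct1" "\<And>x. x \<in> {p..q} \<Longrightarrow> \<bar>ct1 x\<bar> \<le> X"
    and ct0: "\<And>x. x \<in> {p..q} \<Longrightarrow> \<bar>ct x\<bar> \<le> 1" "ct p = 0" "ct q = 0"
  shows "cmod (cinner_L2 u (abs_L2 (\<lambda>x. indicator {p..q} x * (exp (- \<i> * of_real (h x)) * of_real (ct x)))))
    \<le> (M / c\<^sup>2 + X / c) * sqrt (q - p) * norm u"
proof -
  define F where "F = hardy_ext u"
  have F: "F holomorphic_on {z. Im z > 0}"
    unfolding F_def by (rule holomorphic_hardy_ext)
  have sq: "square_integrable (\<lambda>x. F (Complex x y))" and N: "norm (abs_L2 (\<lambda>x. F (Complex x y))) \<le> norm u"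
    if "y > 0" for y
    unfolding F_def by (intro hardy_ext_slice u that)+
  \<comment> \<open>exp(i h) at x + i y, with \<open>h\<close> replaced by its first-order Taylor
    polynomial h(x) + i y h1(x). The defect of \<open>W\<close> then involves no \<open>h1\<close>
    outside the exponential, only \<open>h2 x * y\<close> and the derivative of the cutoff.\<close>
  define e where "e x y = exp (\<i> * of_real (h x) - of_real (h1 x * y))" for x y
  define W where "W x y = e x y * of_real (ct x)" for x y
  have ne: "cmod (e x y) = exp (- (h1 x * y))" for x y
    by (simp add: e_def)
  have M0: "M \<ge> 0" and X0: "X \<ge> 0"
    using M[of p] ct1(2)[of p] pq by auto
  have cont: "continuous_on {p..q} h" "continuous_on {p..q} h1" "continuous_on {p..q} ct"
    using h h1 ct by (meson DERIV_continuous continuous_on_eq_continuous_within)+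
  have fst: "continuous_on ({p..q} \<times> T) (\<lambda>z. k (fst z))" if "continuous_on {p..q} k"
    for k :: "real \<Rightarrow> real" and T :: "real set"
    by (rule continuous_on_compose2[OF that continuous_on_fst[OF continuous_on_id]]) auto
  have cW: "continuous_on {p..q} (\<lambda>x. W x y)" for y
    unfolding W_def e_def by (intro continuous_intros cont)
  have nW: "cmod (W x y) \<le> exp (- (c * y))" if "x \<in> {p..q}" "y \<ge> 0" for x y
  proof -
    have "c * y \<le> h1 x * y"
      using c(2)[OF that(1)] that(2) by (rule mult_right_mono)
    then have "cmod (e x y) \<le> exp (- (c * y))"
      by (simp add: ne)
    then have "cmod (e x y) * \<bar>ct x\<bar> \<le> exp (- (c * y)) * 1"
      using ct0(1)[OF that(1)] by (intro mult_mono) auto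
    then show ?thesis
      by (simp add: W_def norm_mult)
  qed
  let ?J = "\<lambda>y. integral {p..q} (\<lambda>x. W x y * F (Complex x y))"
  let ?K = "(M / c\<^sup>2 + X / c) * sqrt (q - p) * norm u"
  have strip: "cmod (?J b - ?J a) \<le> ?K" if ab: "0 < a" "a \<le> b" for a b
  proof -
    obtain I where I: "((\<lambda>y. (M * y + X) * exp (- (c * y))) has_integral I) {a..b}" "I \<le> M / c\<^sup>2 + X / c"
      using has_integral_linear_exp_bound[OF ab c(1) M0 X0] .
    have "cmod (?J b - ?J a) \<le> I * sqrt (q - p) * norm u"
    proof (rule Green_strip_bound[OF F ab, where \<beta> = "\<lambda>y. (M * y + X) * exp (- (c * y))"
          and Wx = "\<lambda>x y. (\<i> * of_real (h1 x) - of_real (h2 x * y)) * e x y * of_real (ct x) + e x y * of_real (ct1 x)"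
          and Wy = "\<lambda>x y. - of_real (h1 x) * e x y * of_real (ct x)"])
      show "p \<le> q" using pq by simp
      fix x y assume x: "x \<in> {p..q}" and y: "y \<in> {a..b}"
      have of: "((\<lambda>x. complex_of_real (k x)) has_vector_derivative of_real k') (at x within {p..q})"
        if "(k has_real_derivative k') (at x within {p..q})" for k k'
        using that by (intro has_vector_derivative_of_real) (simp add: has_real_derivative_iff_has_vector_derivative)
      have "((\<lambda>x. h1 x * y) has_real_derivative h2 x * y) (at x within {p..q})"
        using h1[OF x] by (auto intro!: derivative_eq_intros)
      from has_vector_derivative_diff[OF has_vector_derivative_mult_right[OF of[OF h[OF x]], of \<i>] of[OF this]]
      have ex: "((\<lambda>x. e x y) has_vector_derivative (\<i> * of_real (h1 x) - of_real (h2 x * y)) * e x y) (at x within {p..q})"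
        using field_vector_diff_chain_within[OF _ DERIV_exp[THEN has_field_derivative_at_within],
            of "\<lambda>x. \<i> * of_real (h x) - of_real (h1 x * y)" _ x "{p..q}"]
        by (simp add: e_def comp_def)
      show "((\<lambda>x. W x y) has_vector_derivative
          (\<i> * of_real (h1 x) - of_real (h2 x * y)) * e x y * of_real (ct x) + e x y * of_real (ct1 x)) (at x within {p..q})"
        using has_vector_derivative_mult[OF ex of[OF ct[OF x]]] by (simp add: W_def add.commute)
      have "((\<lambda>y. h1 x * y) has_real_derivative h1 x) (at y within {a..b})"
        by (auto intro!: derivative_eq_intros)
      then have "((\<lambda>y. complex_of_real (h1 x * y)) has_vector_derivative of_real (h1 x)) (at y within {a..b})"
        by (intro has_vector_derivative_of_real) (simp add: has_real_derivative_iff_has_vector_derivative)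
      from has_vector_derivative_diff[OF has_vector_derivative_const this, of "\<i> * of_real (h x)"]
      have dy: "((\<lambda>y. \<i> * of_real (h x) - complex_of_real (h1 x * y)) has_vector_derivative - of_real (h1 x)) (at y within {a..b})"
        by simp
      have ey: "((\<lambda>y. e x y) has_vector_derivative - of_real (h1 x) * e x y) (at y within {a..b})"
        using field_vector_diff_chain_within[OF dy DERIV_exp[THEN has_field_derivative_at_within]]
        by (simp add: e_def comp_def)
      show "((\<lambda>y. W x y) has_vector_derivative - of_real (h1 x) * e x y * of_real (ct x)) (at y within {a..b})"
        using has_vector_derivative_mult_left[OF ey, of "of_real (ct x)"] by (simp add: W_def)
      have eq: "- of_real (h1 x) * e x y * of_real (ct x) -
          \<i> * ((\<i> * of_real (h1 x) - of_real (h2 x * y)) * e x y * of_real (ct x) + e x y * of_real (ct1 x)) =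
          \<i> * e x y * of_real (h2 x * y * ct x - ct1 x)"
        by (simp add: algebra_simps)
      have y0: "y > 0"
        using y ab by simp
      have "\<bar>h2 x * y * ct x - ct1 x\<bar> \<le> M * y + X"
      proof -
        have "\<bar>h2 x\<bar> * y * \<bar>ct x\<bar> \<le> M * y * 1"
          using M[OF x] ct0(1)[OF x] y0 M0 by (intro mult_mono) auto
        moreover have "\<bar>h2 x * y * ct x\<bar> = \<bar>h2 x\<bar> * y * \<bar>ct x\<bar>"
          using y0 by (simp add: abs_mult)
        ultimately show ?thesis
          using abs_triangle_ineq4[of "h2 x * y * ct x" "ct1 x"] ct1(2)[OF x] by linarith
      qed
      moreover have "exp (- (h1 x * y)) \<le> exp (- (c * y))"
        using c(2)[OF x] y0 by simp
      ultimately have "exp (- (h1 x * y)) * \<bar>h2 x * y * ct x - ct1 x\<bar> \<le> exp (- (c * y)) * (M * y + X)"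
        by (intro mult_mono) auto
      then show "cmod (- of_real (h1 x) * e x y * of_real (ct x) -
          \<i> * ((\<i> * of_real (h1 x) - of_real (h2 x * y)) * e x y * of_real (ct x) + e x y * of_real (ct1 x)))
          \<le> (M * y + X) * exp (- (c * y))"
        unfolding eq norm_mult ne norm_of_real by (simp add: mult.commute)
    next
      show "continuous_on ({p..q} \<times> {a..b}) (\<lambda>(x, y). W x y)"
        "continuous_on ({p..q} \<times> {a..b}) (\<lambda>(x, y). (\<i> * of_real (h1 x) - of_real (h2 x * y)) * e x y * of_real (ct x) + e x y * of_real (ct1 x))"
        "continuous_on ({p..q} \<times> {a..b}) (\<lambda>(x, y). - of_real (h1 x) * e x y * of_real (ct x))"
        unfolding W_def e_def case_prod_unfold
        by (intro continuous_intros fst cont h2 ct1)+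
      show "W p y = 0" "W q y = 0" for y
        by (simp_all add: W_def ct0)
    qed (use sq N I in auto)
    also have "\<dots> \<le> ?K"
      using I(2) pq by (intro mult_right_mono) auto
    finally show ?thesis .
  qed
  have top: "cmod (?J b) \<le> exp (- (c * b)) * sqrt (q - p) * norm u" if b: "b > 0" for b
  proof -
    have "cmod (?J b) \<le> exp (- (c * b)) * sqrt (q - p) * norm (abs_L2 (\<lambda>x. F (Complex x b)))"
      by (rule integral_interval_cinner(2)[OF sq[OF b] cW _ nW]) (use pq b in auto)
    also have "\<dots> \<le> exp (- (c * b)) * sqrt (q - p) * norm u"
      using pq by (intro mult_left_mono N b) auto
    finally show ?thesis .
  qed
  have J: "cmod (?J a) \<le> ?K" if a: "a > 0" for a
  proof -
    have le: "cmod (?J a) \<le> ?K + exp (- (c * b)) * sqrt (q - p) * norm u" if "b \<ge> a" for b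
    proof -
      have "cmod (?J a) \<le> cmod (?J b - ?J a) + cmod (?J b)"
        using norm_triangle_sub[of "?J a" "?J b"] by (simp add: norm_minus_commute)
      then show ?thesis
        using strip[OF a that] top[of b] a that by simp
    qed
    have "((\<lambda>b. ?K + exp (- (c * b)) * sqrt (q - p) * norm u) \<longlongrightarrow> ?K + 0 * sqrt (q - p) * norm u) at_top"
    proof (intro tendsto_intros)
      show "((\<lambda>b. exp (- (c * b))) \<longlongrightarrow> 0) at_top"
        using c(1) by real_asymp
    qed
    moreover have "\<forall>\<^sub>F b in at_top. cmod (?J a) \<le> ?K + exp (- (c * b)) * sqrt (q - p) * norm u"
      using eventually_ge_at_top[of a] by eventually_elim (rule le)
    ultimately show ?thesis
      using tendsto_lowerbound[of "\<lambda>b. ?K + exp (- (c * b)) * sqrt (q - p) * norm u"] by simp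
  qed
  define a where "a n = inverse (real (Suc n))" for n
  have a: "a n > 0" "a \<longlonglongrightarrow> 0" for n
    unfolding a_def by (simp, rule LIMSEQ_inverse_real_of_nat)
  have "filterlim a (at_right 0) sequentially"
    using a by (intro tendsto_imp_filterlim_at_right) auto
  then have limF: "(\<lambda>n. abs_L2 (\<lambda>x. F (Complex x (a n)))) \<longlonglongrightarrow> u"
    unfolding F_def by (rule filterlim_compose[OF tendsto_hardy_ext[OF u]])
  let ?g = "\<lambda>y x. indicator {p..q} x * cnj (W x y)"
  have nW1: "cmod (W x y) \<le> 1" if "x \<in> {p..q}" "y \<ge> 0" for x y
    using nW[OF that] that(2) c(1) by (intro order.trans[OF nW[OF that]]) simp
  have JC: "?J (a n) = cinner_L2 (abs_L2 (\<lambda>x. F (Complex x (a n)))) (abs_L2 (?g (a n)))" for n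
    by (rule integral_interval_cinner(1)[OF sq[OF a(1)] cW _ nW1]) (use pq a(1)[of n] in auto)
  have sg: "square_integrable (?g y)" if "y \<ge> 0" for y
    by (rule integral_interval_cinner(3)[OF square_integrable_zero cW _ nW1]) (use pq that in auto)
  have "(\<lambda>n. abs_L2 (?g (a n))) \<longlonglongrightarrow> abs_L2 (?g 0)"
  proof (rule tendsto_abs_L2_dominated(2)[OF _ _ square_integrable_indicator[of p q]])
    show "?g (a n) \<in> borel_measurable borel" "?g 0 \<in> borel_measurable borel" for n
      using sg[of "a n"] sg[of 0] a(1)[of n] by (auto intro: square_integrable_measurable)
    show "cmod (?g (a n) x) \<le> cmod (indicator {p..q} x)" for n x
      using nW1[of x "a n"] a(1)[of n] by (simp add: indicator_def)
    show "AE x in lborel. (\<lambda>n. ?g (a n) x) \<longlonglongrightarrow> ?g 0 x"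
      unfolding W_def e_def by (intro AE_I2 tendsto_intros a)
  qed
  then have "(\<lambda>n. ?J (a n)) \<longlonglongrightarrow> cinner_L2 u (abs_L2 (?g 0))"
    unfolding JC by (intro tendsto_cinner limF)
  then have "cmod (cinner_L2 u (abs_L2 (?g 0))) \<le> ?K"
    using J[OF a(1)] by (intro Lim_bounded[OF tendsto_norm]) auto
  moreover have "?g 0 = (\<lambda>x. indicator {p..q} x * (exp (- \<i> * of_real (h x)) * of_real (ct x)))"
    by (simp add: fun_eq_iff W_def e_def exp_cnj)
  ultimately show ?thesis
    by simp
qed

subsection \<open>Projections onto modulated Hardy spaces and onto spaces of supported functions\<close>

definition phase :: "(real \<Rightarrow> real) \<Rightarrow> real \<Rightarrow> complex" where
  "phase \<psi> x = exp (\<i> * complex_of_real (\<psi> x))"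

lemma norm_phase [simp]: "cmod (phase \<psi> x) = 1"
  by (simp add: phase_def)

lemma phase_uminus: "phase (\<lambda>x. - \<psi> x) x = cnj (phase \<psi> x)"
  by (simp add: phase_def exp_cnj)

lemma phase_mult: "phase \<psi> x * phase \<phi> x = phase (\<lambda>x. \<psi> x + \<phi> x) x"
  by (simp add: phase_def exp_add[symmetric] distrib_left)

lemma multiplier_phase:
  assumes [measurable]: "\<psi> \<in> borel_measurable borel"
  shows "multiplier (phase \<psi>)"
  unfolding multiplier_def phase_def[abs_def] by auto

lemma mult_phase_phase:
  assumes "\<psi> \<in> borel_measurable borel" "\<phi> \<in> borel_measurable borel"
  shows "mult_L2 (phase \<psi>) (mult_L2 (phase \<phi>) u) = mult_L2 (phase (\<lambda>x. \<psi> x + \<phi> x)) u"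
  using assms by (subst mult_L2_mult_L2) (simp_all add: multiplier_phase phase_mult)

lemma mult_phase_inverse:
  assumes "\<psi> \<in> borel_measurable borel"
  shows "mult_L2 (phase \<psi>) (mult_L2 (phase (\<lambda>x. - \<psi> x)) u) = u"
    "mult_L2 (phase (\<lambda>x. - \<psi> x)) (mult_L2 (phase \<psi>) u) = u"
proof -
  have "phase (\<lambda>x. 0) = (\<lambda>x. 1)"
    by (simp add: phase_def fun_eq_iff)
  then show "mult_L2 (phase \<psi>) (mult_L2 (phase (\<lambda>x. - \<psi> x)) u) = u"
    "mult_L2 (phase (\<lambda>x. - \<psi> x)) (mult_L2 (phase \<psi>) u) = u"
    using assms by (simp_all add: mult_phase_phase)
qed

lemma norm_mult_phase:
  assumes "\<psi> \<in> borel_measurable borel"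
  shows "norm (mult_L2 (phase \<psi>) u) = norm u"
proof (rule antisym)
  have c: "ccontraction (mult_L2 (phase \<psi>))" "ccontraction (mult_L2 (phase (\<lambda>x. - \<psi> x)))"
    using assms by (auto intro!: ccontraction_mult_L2 multiplier_phase)
  show "norm (mult_L2 (phase \<psi>) u) \<le> norm u"
    using c(1) by (simp add: ccontraction_def)
  have "norm (mult_L2 (phase (\<lambda>x. - \<psi> x)) (mult_L2 (phase \<psi>) u)) \<le> norm (mult_L2 (phase \<psi>) u)"
    using c(2) by (simp add: ccontraction_def)
  then show "norm u \<le> norm (mult_L2 (phase \<psi>) u)"
    by (simp add: mult_phase_inverse assms)
qed

lemma phase_H2_eq: "phase_H2 \<psi> = mult_L2 (phase \<psi>) ` H2"
  by (auto simp: phase_H2_def mult_L2_def phase_def)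

lemma mem_phase_H2_iff:
  assumes "\<psi> \<in> borel_measurable borel"
  shows "u \<in> phase_H2 \<psi> \<longleftrightarrow> mult_L2 (phase (\<lambda>x. - \<psi> x)) u \<in> H2"
  unfolding phase_H2_eq using mult_phase_inverse[OF assms] by (metis imageE imageI)

lemma ccontraction_linear: "ccontraction T \<Longrightarrow> bounded_linear T"
  by (rule bounded_linear_intro[where K = 1]) (auto simp: ccontraction_def scaleR_eq_scaleC_L2)

lemma closed_csubspace_vimage:
  assumes K: "closed_csubspace K" and T: "ccontraction T"
  shows "closed_csubspace (T -` K)"
proof -
  have "closed (T -` K)"
    using K bounded_linear.continuous_on[OF ccontraction_linear[OF T] continuous_on_id]
    by (intro closed_vimage) (auto simp: closed_csubspace_def)
  moreover have "subspace (T -` K)"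
    using K T by (auto simp: subspace_def ccontraction_def ccontraction_zero[OF T] scaleR_eq_scaleC_L2 closed_csubspace_def)
  ultimately show ?thesis
    using K T by (auto simp: closed_csubspace_def ccontraction_def)
qed

lemma closed_csubspace_phase_H2:
  assumes "\<psi> \<in> borel_measurable borel"
  shows "closed_csubspace (phase_H2 \<psi>)"
proof -
  have "phase_H2 \<psi> = mult_L2 (phase (\<lambda>x. - \<psi> x)) -` H2"
    using mem_phase_H2_iff[OF assms] by auto
  then show ?thesis
    using assms by (auto intro!: closed_csubspace_vimage closed_csubspace_H2 ccontraction_mult_L2 multiplier_phase)
qed

lemma proj_phase_H2:
  assumes \<psi>: "\<psi> \<in> borel_measurable borel"
  shows "blinfun_apply (proj (phase_H2 \<psi>)) u =
    mult_L2 (phase \<psi>) (blinfun_apply (proj H2) (mult_L2 (phase (\<lambda>x. - \<psi> x)) u))"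
proof (rule proj_eqI[OF closed_csubspace_phase_H2[OF \<psi>]])
  let ?w = "mult_L2 (phase (\<lambda>x. - \<psi> x)) u"
  show "mult_L2 (phase \<psi>) (blinfun_apply (proj H2) ?w) \<in> phase_H2 \<psi>"
    unfolding phase_H2_eq using proj_props(1)[OF closed_csubspace_H2] by blast
  fix v assume "v \<in> phase_H2 \<psi>"
  then obtain v' where v: "v = mult_L2 (phase \<psi>) v'" "v' \<in> H2"
    by (auto simp: phase_H2_eq)
  have m: "multiplier (phase \<psi>)"
    by (rule multiplier_phase[OF \<psi>])
  have "u - mult_L2 (phase \<psi>) (blinfun_apply (proj H2) ?w) = mult_L2 (phase \<psi>) (?w - blinfun_apply (proj H2) ?w)"
    by (simp add: ccontraction_diff[OF ccontraction_mult_L2[OF m]] mult_phase_inverse[OF \<psi>])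
  then have "cinner_L2 (u - mult_L2 (phase \<psi>) (blinfun_apply (proj H2) ?w)) v =
      cinner_L2 (?w - blinfun_apply (proj H2) ?w) (mult_L2 (phase (\<lambda>x. - \<psi> x)) (mult_L2 (phase \<psi>) v'))"
    by (simp add: v(1) cinner_mult_L2[OF m] phase_uminus[abs_def])
  also have "\<dots> = 0"
    using proj_props(2)[OF closed_csubspace_H2 v(2)] by (simp add: mult_phase_inverse[OF \<psi>])
  finally show "cinner_L2 (u - mult_L2 (phase \<psi>) (blinfun_apply (proj H2) ?w)) v = 0" .
qed

section \<open>Spaces of functions supported on a Borel set\<close>

lemma cnj_indicator_self: "cnj (indicator A x) = indicator A x"
  by (simp add: indicator_def)

definition supp_L2 :: "real set \<Rightarrow> L2 set" where
  "supp_L2 E = {u. mult_L2 (indicator E) u = u}"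

lemma multiplier_indicator: "E \<in> sets borel \<Longrightarrow> multiplier (indicator E)"
  by (auto simp: multiplier_def indicator_def)

lemma mult_indicator_idem:
  assumes "E \<in> sets borel"
  shows "mult_L2 (indicator E) (mult_L2 (indicator E) u) = mult_L2 (indicator E) u"
proof -
  have "(\<lambda>x. indicator E x * indicator E x) = (indicator E :: real \<Rightarrow> complex)"
    by (auto simp: indicator_def)
  then show ?thesis
    using assms by (simp add: mult_L2_mult_L2 multiplier_indicator)
qed

lemma closed_csubspace_supp_L2:
  assumes "E \<in> sets borel"
  shows "closed_csubspace (supp_L2 E)"
proof -
  have T: "ccontraction (mult_L2 (indicator E))"
    using assms by (intro ccontraction_mult_L2 multiplier_indicator)
  then have "closed (supp_L2 E)"
    unfolding supp_L2_def
    by (intro closed_Collect_eq continuous_on_id bounded_linear.continuous_on[OF ccontraction_linear[OF T]])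
  then show ?thesis
    using T linear_0[OF bounded_linear.linear[OF ccontraction_linear[OF T]]]
    by (auto simp: closed_csubspace_def subspace_def supp_L2_def ccontraction_def scaleR_eq_scaleC_L2)
qed

lemma proj_supp_L2:
  assumes E: "E \<in> sets borel"
  shows "blinfun_apply (proj (supp_L2 E)) u = mult_L2 (indicator E) u"
proof (rule proj_eqI[OF closed_csubspace_supp_L2[OF E]])
  show "mult_L2 (indicator E) u \<in> supp_L2 E"
    by (simp add: supp_L2_def mult_indicator_idem E)
  fix v assume v: "v \<in> supp_L2 E"
  have "cinner_L2 (u - mult_L2 (indicator E) u) v = cinner_L2 (u - mult_L2 (indicator E) u) (mult_L2 (indicator E) v)"
    using v by (simp add: supp_L2_def)
  also have "\<dots> = cinner_L2 (mult_L2 (indicator E) (u - mult_L2 (indicator E) u)) v"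
    by (simp add: cinner_mult_L2 multiplier_indicator E cnj_indicator_self)
  also have "\<dots> = 0"
    by (simp add: ccontraction_diff ccontraction_mult_L2 multiplier_indicator E mult_indicator_idem)
  finally show "cinner_L2 (u - mult_L2 (indicator E) u) v = 0" .
qed

section \<open>Projections of cut-off functions under steep phases\<close>

lemma cutoff_L2:
  fixes ct :: "real \<Rightarrow> real"
  assumes "continuous_on {p..q} ct" "\<And>x. x \<in> {p..q} \<Longrightarrow> \<bar>ct x\<bar> \<le> 1" "p \<le> q"
  shows "square_integrable (\<lambda>x. indicator {p..q} x * of_real (ct x))"
  using integral_interval_cinner(3)[OF square_integrable_zero, of p q "\<lambda>x. of_real (ct x)" 1] assms
  by (simp add: continuous_on_of_real)

text \<open>If v is the projection of w onto \<open>H2\<close>, then |v|^2 = |(v, w)|, so the decay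
  estimate applied to v itself bounds |v|. For a decreasing phase the same is done with the residual
  r = w - v, for which |r|^2 = |(r, w)|; conjugation puts r into \<open>H2\<close> and reverses the
  phase.\<close>

lemma proj_phase_cutoff:
  fixes \<psi> h1 h2 ct ct1 :: "real \<Rightarrow> real"
  assumes \<psi>: "\<psi> \<in> borel_measurable borel" and pq: "p < q"
    and h: "\<And>x. x \<in> {p..q} \<Longrightarrow> (\<psi> has_real_derivative h1 x) (at x within {p..q})"
    and h1: "\<And>x. x \<in> {p..q} \<Longrightarrow> (h1 has_real_derivative h2 x) (at x within {p..q})"
    and h2: "continuous_on {p..q} h2"
    and c: "c > 0" and M: "\<And>x. x \<in> {p..q} \<Longrightarrow> \<bar>h2 x\<bar> \<le> M"
    and ct: "\<And>x. x \<in> {p..q} \<Longrightarrow> (ct has_real_derivative ct1 x) (at x within {p..q})"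
    and ct1: "continuous_on {p..q} ct1" "\<And>x. x \<in> {p..q} \<Longrightarrow> \<bar>ct1 x\<bar> \<le> X"
    and ct0: "\<And>x. x \<in> {p..q} \<Longrightarrow> \<bar>ct x\<bar> \<le> 1" "ct p = 0" "ct q = 0"
  defines "\<xi> \<equiv> abs_L2 (\<lambda>x. indicator {p..q} x * of_real (ct x))"
  shows "(\<And>x. x \<in> {p..q} \<Longrightarrow> h1 x \<ge> c) \<Longrightarrow>
      norm (blinfun_apply (proj (phase_H2 \<psi>)) \<xi>) \<le> (M / c\<^sup>2 + X / c) * sqrt (q - p)"
    and "(\<And>x. x \<in> {p..q} \<Longrightarrow> h1 x \<le> - c) \<Longrightarrow>
      norm (\<xi> - blinfun_apply (proj (phase_H2 \<psi>)) \<xi>) \<le> (M / c\<^sup>2 + X / c) * sqrt (q - p)"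
proof -
  let ?K = "(M / c\<^sup>2 + X / c) * sqrt (q - p)"
  have M0: "M \<ge> 0" and X0: "X \<ge> 0"
    using M[of p] ct1(2)[of p] pq by auto
  then have K0: "?K \<ge> 0"
    using c pq by auto
  have cct: "continuous_on {p..q} ct"
    using ct by (meson DERIV_continuous continuous_on_eq_continuous_within)
  have sq: "square_integrable (\<lambda>x. indicator {p..q} x * of_real (ct x))"
    using cutoff_L2[OF cct ct0(1)] pq by simp
  have m\<psi>: "(\<lambda>x. - \<psi> x) \<in> borel_measurable borel"
    using \<psi> by simp
  let ?w = "mult_L2 (phase (\<lambda>x. - \<psi> x)) \<xi>"
  let ?v = "blinfun_apply (proj H2) ?w"
  have w: "?w = abs_L2 (\<lambda>x. indicator {p..q} x * (exp (- \<i> * of_real (\<psi> x)) * of_real (ct x)))"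
    unfolding \<xi>_def mult_L2_abs_L2[OF multiplier_phase[OF m\<psi>] sq] by (simp add: phase_def mult_ac)
  have wc: "cnj_L2 ?w = abs_L2 (\<lambda>x. indicator {p..q} x * (exp (- \<i> * of_real (- \<psi> x)) * of_real (ct x)))"
  proof -
    have "square_integrable (\<lambda>x. phase (\<lambda>x. - \<psi> x) x * (indicator {p..q} x * of_real (ct x)))"
      by (rule square_integrable_multiplier[OF multiplier_phase[OF m\<psi>] sq])
    then show ?thesis
      unfolding \<xi>_def mult_L2_abs_L2[OF multiplier_phase[OF m\<psi>] sq]
      by (simp only: cnj_L2_abs_L2 complex_cnj_mult flip: phase_uminus) (simp add: phase_def cnj_indicator_self mult_ac)
  qed
  note H = closed_csubspace_H2
  have bound: "norm r \<le> ?K" if "(norm r)\<^sup>2 \<le> ?K * norm r" for r :: L2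
    using that K0 by (cases "r = 0") (simp_all add: power2_eq_square)
  have vH: "?v \<in> H2"
    by (rule proj_props(1)[OF H])
  have ww: "cinner_L2 (?w - ?v) ?v = 0"
    by (rule proj_props(2)[OF H vH])
  show "norm (blinfun_apply (proj (phase_H2 \<psi>)) \<xi>) \<le> ?K" if "\<And>x. x \<in> {p..q} \<Longrightarrow> h1 x \<ge> c"
  proof -
    have "cmod (cinner_L2 ?v ?w) \<le> ?K * norm ?v"
      unfolding w[symmetric] using H2_oscillation_decay[OF vH pq h h1 h2 c that M ct ct1 ct0] by (simp add: w)
    moreover have "cinner_L2 ?v ?v = cnj (cinner_L2 ?v ?w)"
      using ww cinner_commute[of ?w ?v] by (simp add: cinner_diff_left)
    then have "(norm ?v)\<^sup>2 = cmod (cinner_L2 ?v ?w)"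
      by (metis cinner_self complex_mod_cnj norm_of_real abs_of_nonneg zero_le_power2)
    ultimately have "norm ?v \<le> ?K"
      by (intro bound) simp
    then show ?thesis
      by (simp add: proj_phase_H2[OF \<psi>] norm_mult_phase[OF \<psi>])
  qed
  show "norm (\<xi> - blinfun_apply (proj (phase_H2 \<psi>)) \<xi>) \<le> ?K" if neg: "\<And>x. x \<in> {p..q} \<Longrightarrow> h1 x \<le> - c"
  proof -
    let ?r = "?w - ?v"
    have rH: "cnj_L2 ?r \<in> H2"
      by (rule cnj_L2_in_H2) (rule proj_props(2)[OF H])
    have "cmod (cinner_L2 (cnj_L2 ?r) (cnj_L2 ?w)) \<le> ?K * norm (cnj_L2 ?r)"
      unfolding wc
    proof (rule H2_oscillation_decay[OF rH pq, where ?h1.0 = "\<lambda>x. - h1 x" and ?h2.0 = "\<lambda>x. - h2 x"])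
      show "((\<lambda>x. - \<psi> x) has_real_derivative - h1 x) (at x within {p..q})" if "x \<in> {p..q}" for x
        using h[OF that] by (rule DERIV_minus)
      show "((\<lambda>x. - h1 x) has_real_derivative - h2 x) (at x within {p..q})" if "x \<in> {p..q}" for x
        using h1[OF that] by (rule DERIV_minus)
      show "continuous_on {p..q} (\<lambda>x. - h2 x)"
        using h2 by (intro continuous_intros)
      show "c \<le> - h1 x" if "x \<in> {p..q}" for x
        using neg[OF that] by simp
    qed (use c M ct ct1 ct0 in auto)
    moreover have "cinner_L2 (cnj_L2 ?r) (cnj_L2 ?w) = cnj (cinner_L2 ?r ?w)"
      by (simp add: cinner_cnj_L2)
    moreover have "cinner_L2 ?r ?r = cinner_L2 ?r ?w"
      using ww by (simp only: cinner_diff_right diff_zero)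
    then have "(norm ?r)\<^sup>2 = cmod (cinner_L2 ?r ?w)"
      by (metis cinner_self norm_of_real abs_of_nonneg zero_le_power2)
    ultimately have "norm ?r \<le> ?K"
      by (intro bound) simp
    moreover have "\<xi> - blinfun_apply (proj (phase_H2 \<psi>)) \<xi> = mult_L2 (phase \<psi>) ?r"
      by (simp add: ccontraction_diff[OF ccontraction_mult_L2[OF multiplier_phase[OF \<psi>]]]
          mult_phase_inverse[OF \<psi>] proj_phase_H2[OF \<psi>])
    ultimately show ?thesis
      by (simp add: norm_mult_phase[OF \<psi>])
  qed
qed

text \<open>The cutoffs $1 - s^{2k}$, where $s$ maps $[p,q]$ affinely onto $[-1,1]$, vanish at the end points
  and tend to the indicator of $[p,q]$.\<close>

lemma ind_L2_mem_of_cutoffs: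
  assumes K: "closed K" and pq: "p < q"
    and mem: "\<And>ct ct1 X. (\<And>x. (ct has_real_derivative ct1 x) (at x within {p..q})) \<Longrightarrow> continuous_on {p..q} ct1 \<Longrightarrow>
      (\<And>x. x \<in> {p..q} \<Longrightarrow> \<bar>ct1 x\<bar> \<le> X) \<Longrightarrow> (\<And>x. x \<in> {p..q} \<Longrightarrow> \<bar>ct x\<bar> \<le> 1) \<Longrightarrow> ct p = 0 \<Longrightarrow> ct q = 0 \<Longrightarrow>
      abs_L2 (\<lambda>x. indicator {p..q} x * of_real (ct x)) \<in> K"
  shows "ind_L2 p q \<in> K"
proof -
  define s where "s x = (2 * x - (p + q)) / (q - p)" for x
  define ct where "ct k x = 1 - s x ^ (2 * Suc k)" for k x
  have s: "\<bar>s x\<bar> \<le> 1" if "x \<in> {p..q}" for x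
    using that pq by (auto simp: s_def abs_le_iff divide_simps)
  have s1: "\<bar>s x\<bar> < 1" if "x \<in> {p<..<q}" for x
    using that pq by (auto simp: s_def abs_less_iff divide_simps)
  have bd: "\<bar>ct k x\<bar> \<le> 1" if "x \<in> {p..q}" for k x
  proof -
    have "s x ^ (2 * Suc k) = (s x)\<^sup>2 ^ Suc k"
      by (rule power_mult)
    moreover have "(s x)\<^sup>2 ^ Suc k \<le> 1"
      using s[OF that] by (intro power_le_one[OF zero_le_power2]) (simp add: abs_square_le_1)
    moreover have "(s x)\<^sup>2 ^ Suc k \<ge> 0"
      by simp
    ultimately show ?thesis
      unfolding ct_def by linarith
  qed
  have ends: "ct k p = 0" "ct k q = 0" for k
  proof -
    have "s p = - 1" "s q = 1"
      using pq by (auto simp: s_def divide_simps)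
    then show "ct k p = 0" "ct k q = 0"
      by (simp_all add: ct_def power_mult del: mult_Suc_right)
  qed
  have D: "(ct k has_real_derivative - (real (2 * Suc k) * s x ^ (2 * Suc k - 1) * (2 / (q - p)))) (at x within {p..q})" for k x
  proof -
    have "(s has_real_derivative 2 / (q - p)) (at x within {p..q})"
      unfolding s_def divide_inverse by (auto intro!: derivative_eq_intros)
    from DERIV_power[OF this, of "2 * Suc k"] show ?thesis
      unfolding ct_def[abs_def] using DERIV_diff[OF DERIV_const[of 1]] by (force simp: mult_ac)
  qed
  have cs: "continuous_on {p..q} s"
    unfolding s_def divide_inverse by (intro continuous_intros)
  have sq: "square_integrable (\<lambda>x. indicator {p..q} x * of_real (ct k x))" for k
    by (rule cutoff_L2) (use bd pq cs in \<open>auto simp: ct_def[abs_def] intro!: continuous_intros\<close>)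
  have mem_k: "abs_L2 (\<lambda>x. indicator {p..q} x * of_real (ct k x)) \<in> K" for k
  proof (rule mem[OF D])
    show "continuous_on {p..q} (\<lambda>x. - (real (2 * Suc k) * s x ^ (2 * Suc k - 1) * (2 / (q - p))))"
      by (intro continuous_intros cs)
    show "\<bar>- (real (2 * Suc k) * s x ^ (2 * Suc k - 1) * (2 / (q - p)))\<bar> \<le> real (2 * Suc k) * 1 * (2 / (q - p))"
      if "x \<in> {p..q}" for x
    proof -
      have a: "\<bar>s x ^ (2 * Suc k - 1)\<bar> \<le> 1"
        unfolding power_abs using s[OF that] by (intro power_le_one) auto
      have b: "\<bar>- (real (2 * Suc k) * s x ^ (2 * Suc k - 1) * (2 / (q - p)))\<bar> =
          real (2 * Suc k) * \<bar>s x ^ (2 * Suc k - 1)\<bar> * (2 / (q - p))"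
        using pq by (simp only: abs_minus_cancel abs_mult) simp
      show ?thesis
        unfolding b by (rule mult_right_mono[OF mult_left_mono[OF a]]) (use pq in auto)
    qed
  qed (use bd ends in auto)
  have "(\<lambda>k. abs_L2 (\<lambda>x. indicator {p..q} x * of_real (ct k x))) \<longlonglongrightarrow> ind_L2 p q"
    unfolding ind_L2_def
  proof (rule tendsto_abs_L2_dominated(2)[OF _ _ square_integrable_indicator[of p q]])
    show "(\<lambda>x. indicator {p..q} x * complex_of_real (ct k x)) \<in> borel_measurable borel" for k
      using sq by (rule square_integrable_measurable)
    show "cmod (indicator {p..q} x * of_real (ct k x)) \<le> cmod (indicator {p..q} x)" for k x
      using bd[of x k] by (simp add: indicator_def)
    show "AE x in lborel. (\<lambda>k. indicator {p..q} x * complex_of_real (ct k x)) \<longlonglongrightarrow> indicator {p..q} x"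
      using AE_lborel_singleton[of p] AE_lborel_singleton[of q]
    proof eventually_elim
      case (elim x)
      show ?case
      proof (cases "x \<in> {p..q}")
        case True
        then have "\<bar>s x\<bar> < 1"
          using elim by (intro s1) auto
        then have "(s x)\<^sup>2 < 1"
          by (simp add: abs_square_less_1)
        then have "(\<lambda>k. (s x)\<^sup>2 ^ Suc k) \<longlonglongrightarrow> 0"
          using LIMSEQ_Suc[OF LIMSEQ_realpow_zero[of "(s x)\<^sup>2"]] by simp
        then have "(\<lambda>k. 1 - (s x)\<^sup>2 ^ Suc k) \<longlonglongrightarrow> 1 - 0"
          by (intro tendsto_intros)
        then have "(\<lambda>k. ct k x) \<longlonglongrightarrow> 1"
          unfolding ct_def power_mult by simp
        then have "(\<lambda>k. complex_of_real (ct k x)) \<longlonglongrightarrow> of_real 1"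
          by (rule tendsto_of_real)
        then show ?thesis
          using True by simp
      qed simp
    qed
  qed measurable
  then show ?thesis
    by (rule closed_sequentially[OF K mem_k])
qed

text \<open>Both derivatives of the phase have order t, so the estimate for a cut-off function is of
  order 1/t. Its constant contains the slope \<open>X\<close> of the cutoff; hence the limit is
  taken first for each fixed cutoff, and the indicator is reached afterwards, through closedness of
  the space of vectors with the desired limit.\<close>

lemma
  fixes \<psi> :: "'n \<Rightarrow> real \<Rightarrow> real"
  assumes pq: "p < q" and t: "filterlim t at_top F" and m: "m > 0"
    and \<psi>: "\<forall>\<^sub>F n in F. \<psi> n \<in> borel_measurable borel"
    and h: "\<forall>\<^sub>F n in F. \<forall>x\<in>{p..q}. (\<psi> n has_real_derivative h1 n x) (at x within {p..q}) \<and>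
       (h1 n has_real_derivative h2 n x) (at x within {p..q}) \<and> \<bar>h2 n x\<bar> \<le> M * t n"
    and ch2: "\<forall>\<^sub>F n in F. continuous_on {p..q} (h2 n)"
  shows tendsto_proj_phase_increasing:
      "\<forall>\<^sub>F n in F. \<forall>x\<in>{p..q}. h1 n x \<ge> m * t n \<Longrightarrow> ((\<lambda>n. blinfun_apply (proj (phase_H2 (\<psi> n))) (ind_L2 p q)) \<longlongrightarrow> 0) F"
    and tendsto_proj_phase_decreasing:
      "\<forall>\<^sub>F n in F. \<forall>x\<in>{p..q}. h1 n x \<le> - (m * t n) \<Longrightarrow>
        ((\<lambda>n. blinfun_apply (proj (phase_H2 (\<psi> n))) (ind_L2 p q)) \<longlongrightarrow> ind_L2 p q) F"
proof -
  let ?P = "\<lambda>n. blinfun_apply (proj (phase_H2 (\<psi> n)))"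
  have cP: "\<forall>\<^sub>F n in F. ccontraction (?P n)"
    using \<psi> by eventually_elim (intro ccontraction_proj closed_csubspace_phase_H2)
  have tpos: "\<forall>\<^sub>F n in F. t n > 0"
    using t by (simp add: filterlim_at_top_dense)
  have K: "((\<lambda>n. (M * t n / (m * t n)\<^sup>2 + X / (m * t n)) * sqrt (q - p)) \<longlongrightarrow> 0) F" for X
  proof -
    have "((\<lambda>s. (M * s / (m * s)\<^sup>2 + X / (m * s)) * sqrt (q - p)) \<longlongrightarrow> 0) at_top"
      using m by real_asymp
    from filterlim_compose[OF this t] show ?thesis .
  qed
  show "((\<lambda>n. ?P n (ind_L2 p q)) \<longlongrightarrow> 0) F" if pos: "\<forall>\<^sub>F n in F. \<forall>x\<in>{p..q}. h1 n x \<ge> m * t n"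
  proof -
    have z: "ccontraction (\<lambda>u. 0)"
      using norm_scaleC_L2[of _ 0] by (auto simp: ccontraction_def simp flip: norm_eq_zero)
    have "ind_L2 p q \<in> {u. ((\<lambda>n. ?P n u) \<longlongrightarrow> 0) F}"
    proof (rule ind_L2_mem_of_cutoffs[OF _ pq])
      show "closed {u. ((\<lambda>n. ?P n u) \<longlongrightarrow> 0) F}"
        using closed_csubspace_convergence[OF cP z] by (simp add: closed_csubspace_def)
      fix ct ct1 :: "real \<Rightarrow> real" and X :: real
      assume ct: "\<And>x. (ct has_real_derivative ct1 x) (at x within {p..q})" "continuous_on {p..q} ct1"
        "\<And>x. x \<in> {p..q} \<Longrightarrow> \<bar>ct1 x\<bar> \<le> X" "\<And>x. x \<in> {p..q} \<Longrightarrow> \<bar>ct x\<bar> \<le> 1" "ct p = 0" "ct q = 0"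
      have "\<forall>\<^sub>F n in F. norm (?P n (abs_L2 (\<lambda>x. indicator {p..q} x * of_real (ct x))))
          \<le> (M * t n / (m * t n)\<^sup>2 + X / (m * t n)) * sqrt (q - p)"
        using \<psi> h ch2 tpos pos
      proof eventually_elim
        case (elim n)
        show ?case
          by (rule proj_phase_cutoff(1)[where ?h1.0 = "h1 n" and ?h2.0 = "h2 n" and ?ct1.0 = ct1])
            (use elim pq m ct in auto)
      qed
      then show "abs_L2 (\<lambda>x. indicator {p..q} x * of_real (ct x)) \<in> {u. ((\<lambda>n. ?P n u) \<longlongrightarrow> 0) F}"
        by (intro CollectI Lim_null_comparison[OF _ K])
    qed
    then show ?thesis by simp
  qed
  show "((\<lambda>n. ?P n (ind_L2 p q)) \<longlongrightarrow> ind_L2 p q) F" if neg: "\<forall>\<^sub>F n in F. \<forall>x\<in>{p..q}. h1 n x \<le> - (m * t n)"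
  proof -
    have i: "ccontraction (\<lambda>u. u)"
      by (simp add: ccontraction_def)
    have "ind_L2 p q \<in> {u. ((\<lambda>n. ?P n u) \<longlongrightarrow> u) F}"
    proof (rule ind_L2_mem_of_cutoffs[OF _ pq])
      show "closed {u. ((\<lambda>n. ?P n u) \<longlongrightarrow> u) F}"
        using closed_csubspace_convergence[OF cP i] by (simp add: closed_csubspace_def)
      fix ct ct1 :: "real \<Rightarrow> real" and X :: real
      assume ct: "\<And>x. (ct has_real_derivative ct1 x) (at x within {p..q})" "continuous_on {p..q} ct1"
        "\<And>x. x \<in> {p..q} \<Longrightarrow> \<bar>ct1 x\<bar> \<le> X" "\<And>x. x \<in> {p..q} \<Longrightarrow> \<bar>ct x\<bar> \<le> 1" "ct p = 0" "ct q = 0"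
      let ?u = "abs_L2 (\<lambda>x. indicator {p..q} x * of_real (ct x))"
      have "\<forall>\<^sub>F n in F. norm (?u - ?P n ?u) \<le> (M * t n / (m * t n)\<^sup>2 + X / (m * t n)) * sqrt (q - p)"
        using \<psi> h ch2 tpos neg
      proof eventually_elim
        case (elim n)
        show ?case
          by (rule proj_phase_cutoff(2)[where ?h1.0 = "h1 n" and ?h2.0 = "h2 n" and ?ct1.0 = ct1])
            (use elim pq m ct in auto)
      qed
      then have "((\<lambda>n. ?u - ?P n ?u) \<longlongrightarrow> 0) F"
        by (rule Lim_null_comparison[OF _ K])
      then have "((\<lambda>n. ?u - (?u - ?P n ?u)) \<longlongrightarrow> ?u - 0) F"
        by (intro tendsto_diff tendsto_const)
      then show "?u \<in> {u. ((\<lambda>n. ?P n u) \<longlongrightarrow> u) F}"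
        by simp
    qed
    then show ?thesis by simp
  qed
qed

subsection \<open>Distinguishing the projections\<close>

lemma H2_zero:
  assumes "u \<in> H2" "\<And>w. Im w > 0 \<Longrightarrow> cinner_L2 u (ker_L2 (cnj w)) = 0"
  shows "u = 0"
proof -
  have "((\<lambda>y. abs_L2 (\<lambda>x. hardy_ext u (Complex x y))) \<longlongrightarrow> 0) (at_right 0)"
  proof (rule tendsto_eventually)
    show "\<forall>\<^sub>F y in at_right 0. abs_L2 (\<lambda>x. hardy_ext u (Complex x y)) = 0"
      using eventually_at_right_less[of 0]
      by eventually_elim (use assms(2) in \<open>simp add: hardy_ext_def zero_L2_def\<close>)
  qed
  then show ?thesis
    using tendsto_unique[OF _ tendsto_hardy_ext[OF assms(1)]] by auto
qed

text \<open>Partial fractions turn orthogonality of $\theta/(t-i)$ to the Hardy space into a formula for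
  the holomorphic extension of $\theta/(t+i)$.\<close>

lemma multiplier_ker_identity:
  assumes \<theta>: "multiplier \<theta>" and inv: "\<And>v. v \<in> H2 \<Longrightarrow> mult_L2 (\<lambda>x. cnj (\<theta> x)) v \<in> H2"
    and w: "Im w > 0"
  shows "(w + \<i>) * cinner_L2 (mult_L2 \<theta> (ker_L2 (- \<i>))) (ker_L2 (cnj w)) =
    2 * \<i> * cinner_L2 (mult_L2 \<theta> (ker_L2 (- \<i>))) (ker_L2 (- \<i>))"
proof (cases "w = \<i>")
  case False
  have sq: "square_integrable (\<lambda>t. \<theta> t * cker z t)" if "Im z \<noteq> 0" for z
    using square_integrable_multiplier[OF \<theta> square_integrable_cker[OF that]] .
  have ci: "cinner_L2 (mult_L2 \<theta> (ker_L2 z)) (ker_L2 (cnj v)) = (LINT t|lborel. \<theta> t * cker z t * cker v t)"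
      "integrable lborel (\<lambda>t. \<theta> t * cker z t * cker v t)"
    if "Im z \<noteq> 0" "Im v \<noteq> 0" for z v
  proof -
    have "square_integrable (cker (cnj v))"
      using that by (simp add: square_integrable_cker)
    then show "cinner_L2 (mult_L2 \<theta> (ker_L2 z)) (ker_L2 (cnj v)) = (LINT t|lborel. \<theta> t * cker z t * cker v t)"
      "integrable lborel (\<lambda>t. \<theta> t * cker z t * cker v t)"
      using that cinner_abs_L2[OF sq[OF that(1)], of "cker (cnj v)"] integrable_mult_cnj[OF sq[OF that(1)], of "cker (cnj v)"]
      by (simp_all add: ker_L2_def mult_L2_abs_L2 \<theta> square_integrable_cker cnj_cker)
  qed
  have "ker_L2 (cnj w) \<in> H2"
    using w by (intro ker_L2_in_H2) simp
  then have "cinner_L2 (mult_L2 (\<lambda>x. cnj (\<theta> x)) (ker_L2 (cnj w))) (ker_L2 \<i>) = 0"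
    using inv by (intro H2_orthogonal_ker) auto
  then have "cinner_L2 (mult_L2 \<theta> (ker_L2 \<i>)) (ker_L2 (cnj w)) = 0"
    by (subst cinner_mult_L2[OF \<theta>], subst cinner_commute) simp
  then have 0: "(LINT t|lborel. \<theta> t * cker \<i> t * cker w t) = 0"
    using w by (simp add: ci)
  have pf: "(w - \<i>) * (\<theta> t * cker \<i> t * cker w t) =
      (w + \<i>) * (\<theta> t * cker (- \<i>) t * cker w t) - 2 * \<i> * (\<theta> t * cker (- \<i>) t * cker \<i> t)" for t
  proof -
    have ne: "of_real t - w \<noteq> 0" "of_real t - \<i> \<noteq> 0" "of_real t + \<i> \<noteq> 0"
      using w by (auto simp: complex_eq_iff)
    have "(w - \<i>) * (cker \<i> t * cker w t) =
        (w + \<i>) * (cker (- \<i>) t * cker w t) - 2 * \<i> * (cker (- \<i>) t * cker \<i> t)"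
      using ne by (simp add: cker_def divide_simps) (simp add: algebra_simps)
    from arg_cong[OF this, of "\<lambda>z. \<theta> t * z"] show ?thesis
      by (simp add: algebra_simps)
  qed
  have "(w - \<i>) * (LINT t|lborel. \<theta> t * cker \<i> t * cker w t) =
      (LINT t|lborel. (w + \<i>) * (\<theta> t * cker (- \<i>) t * cker w t) - 2 * \<i> * (\<theta> t * cker (- \<i>) t * cker \<i> t))"
    unfolding pf[symmetric] by simp
  also have "\<dots> = (w + \<i>) * (LINT t|lborel. \<theta> t * cker (- \<i>) t * cker w t)
      - 2 * \<i> * (LINT t|lborel. \<theta> t * cker (- \<i>) t * cker \<i> t)"
    using ci(2)[of "- \<i>" w] ci(2)[of "- \<i>" \<i>] w by (simp del: integral_mult_left_zero)
  finally show ?thesis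
    using 0 w ci(1)[of "- \<i>" \<i>] by (simp add: ci)
qed simp

text \<open>A function that is bounded analytic together with its conjugate is constant.
  \<open>multiplier_ker_identity\<close>, used for \<theta> and for the constant 1, shows that
  \<theta> k and c k have the same Cauchy integral, k being 1/(t + i); both lie in
  \<open>H2\<close>, so they agree, and k has no zeros.\<close>

lemma multiplier_constant:
  assumes \<theta>: "multiplier \<theta>"
    and inv: "\<And>v. v \<in> H2 \<Longrightarrow> mult_L2 \<theta> v \<in> H2" "\<And>v. v \<in> H2 \<Longrightarrow> mult_L2 (\<lambda>x. cnj (\<theta> x)) v \<in> H2"
  shows "\<exists>c. AE x in lborel. \<theta> x = c"
proof -
  let ?k = "ker_L2 (- \<i>)"
  have one: "multiplier (\<lambda>x. 1)"
    by (simp add: multiplier_def)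
  have kH: "?k \<in> H2"
    by (rule ker_L2_in_H2) simp
  have kk: "cinner_L2 ?k ?k = pi"
    using norm_ker_L2[of "- \<i>"] by (simp add: cinner_self del: of_real_power)
  define c where "c = cinner_L2 (mult_L2 \<theta> ?k) ?k / pi"
  have "mult_L2 \<theta> ?k - scaleC_L2 c ?k = 0"
  proof (rule H2_zero)
    show "mult_L2 \<theta> ?k - scaleC_L2 c ?k \<in> H2"
      using inv(1)[OF kH] kH closed_csubspace_H2 by (simp add: closed_csubspace_def subspace_diff)
    fix w assume w: "Im w > 0"
    then have wi: "w + \<i> \<noteq> 0"
      by (auto simp: complex_eq_iff)
    have "(w + \<i>) * cinner_L2 ?k (ker_L2 (cnj w)) = 2 * \<i> * pi"
      using multiplier_ker_identity[OF one _ w] by (simp add: kk)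
    then have "(w + \<i>) * cinner_L2 (mult_L2 \<theta> ?k - scaleC_L2 c ?k) (ker_L2 (cnj w)) = 0"
      using multiplier_ker_identity[OF \<theta> inv(2) w]
      unfolding cinner_diff_left cinner_scaleC_left right_diff_distrib mult.left_commute[of _ c]
      by (simp add: c_def)
    then show "cinner_L2 (mult_L2 \<theta> ?k - scaleC_L2 c ?k) (ker_L2 (cnj w)) = 0"
      using wi by simp
  qed
  then have eq: "mult_L2 \<theta> ?k = scaleC_L2 c ?k"
    by simp
  have "AE x in lborel. rep_L2 ?k x = cker (- \<i>) x"
    unfolding ker_L2_def by (rule rep_abs_L2) (simp add: square_integrable_cker)
  with rep_mult_L2[OF \<theta>, of ?k] rep_L2_scaleC[of c ?k] have "AE x in lborel. \<theta> x = c"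
  proof eventually_elim
    case (elim x)
    then have "\<theta> x * cker (- \<i>) x = c * cker (- \<i>) x"
      by (auto simp: eq)
    then show ?case
      using cker_nonzero[of "- \<i>" x] by auto
  qed
  then show ?thesis ..
qed

text \<open>Equality of the subspaces means that multiplication by the quotient of the two phases,
  and by its conjugate, maps \<open>H2\<close> into itself.\<close>

lemma phase_H2_eq_imp_constant:
  assumes \<psi>: "\<psi> \<in> borel_measurable borel" "\<phi> \<in> borel_measurable borel" and eq: "phase_H2 \<psi> = phase_H2 \<phi>"
  shows "\<exists>c. AE x in lborel. phase (\<lambda>x. \<psi> x - \<phi> x) x = c"
proof (rule multiplier_constant)
  have step: "mult_L2 (phase (\<lambda>x. \<psi> x - \<phi> x)) v \<in> H2"
    if "\<psi> \<in> borel_measurable borel" "\<phi> \<in> borel_measurable borel" "phase_H2 \<psi> = phase_H2 \<phi>" "v \<in> H2" for \<psi> \<phi> v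
  proof -
    have "mult_L2 (phase \<psi>) v \<in> phase_H2 \<phi>"
      using that by (auto simp: phase_H2_eq)
    then have "mult_L2 (phase (\<lambda>x. - \<phi> x)) (mult_L2 (phase \<psi>) v) \<in> H2"
      using that by (simp add: mem_phase_H2_iff)
    then show ?thesis
      using that by (subst (asm) mult_phase_phase) auto
  qed
  show "mult_L2 (phase (\<lambda>x. \<psi> x - \<phi> x)) v \<in> H2" if "v \<in> H2" for v
    using step assms that by blast
  show "mult_L2 (\<lambda>x. cnj (phase (\<lambda>x. \<psi> x - \<phi> x) x)) v \<in> H2" if "v \<in> H2" for v
    using step[OF \<psi>(2,1) eq[symmetric] that] by (simp flip: phase_uminus)
  show "multiplier (phase (\<lambda>x. \<psi> x - \<phi> x))"
    using \<psi> by (intro multiplier_phase) simp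
qed

lemma supp_L2_subset_imp_AE:
  assumes E: "E \<in> sets borel" "E' \<in> sets borel" and sub: "supp_L2 E \<subseteq> supp_L2 E'"
  shows "AE x in lborel. x \<in> E \<longrightarrow> x \<in> E'"
proof -
  \<comment> \<open>A vector without zeros: where its restriction to \<open>E\<close> is fixed by
    the indicator of \<open>E'\<close>, membership in \<open>E\<close> forces membership in
    \<open>E'\<close>.\<close>
  let ?k = "ker_L2 \<i>"
  have eq: "mult_L2 (indicator E') (mult_L2 (indicator E) ?k) = mult_L2 (indicator E) ?k"
    using sub mult_indicator_idem[OF E(1)] by (auto simp: supp_L2_def)
  have "AE x in lborel. rep_L2 ?k x = cker \<i> x"
    unfolding ker_L2_def by (rule rep_abs_L2) (simp add: square_integrable_cker)
  then show ?thesis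
    using rep_mult_L2[OF multiplier_indicator[OF E(1)], of ?k]
      rep_mult_L2[OF multiplier_indicator[OF E(2)], of "mult_L2 (indicator E) ?k"]
  proof eventually_elim
    case (elim x)
    then show ?case
      using cker_nonzero[of \<i> x] by (auto simp: eq indicator_def split: if_splits)
  qed
qed

lemma supp_L2_eq_iff:
  assumes E: "E \<in> sets borel" "E' \<in> sets borel"
  shows "supp_L2 E = supp_L2 E' \<longleftrightarrow> (AE x in lborel. x \<in> E \<longleftrightarrow> x \<in> E')"
proof
  assume "supp_L2 E = supp_L2 E'"
  then show "AE x in lborel. x \<in> E \<longleftrightarrow> x \<in> E'"
    using supp_L2_subset_imp_AE[OF E] supp_L2_subset_imp_AE[OF E(2,1)] by (auto elim: AE_mp)
next
  assume "AE x in lborel. x \<in> E \<longleftrightarrow> x \<in> E'"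
  then have "AE x in lborel. indicator E x = (indicator E' x :: complex)"
    by (auto simp: indicator_def elim!: AE_mp)
  then have "mult_L2 (indicator E) u = mult_L2 (indicator E') u" for u
    by (intro mult_L2_cong_AE multiplier_indicator E)
  then show "supp_L2 E = supp_L2 E'"
    by (simp add: supp_L2_def)
qed

text \<open>A modulated Hardy space contains a function without zeros, so \<open>E\<close> would
  have full measure and the space would be everything. But the Cauchy kernel with pole i is nonzero
  and orthogonal to \<open>H2\<close>.\<close>

lemma phase_H2_neq_supp_L2:
  assumes \<psi>: "\<psi> \<in> borel_measurable borel" and E: "E \<in> sets borel"
  shows "phase_H2 \<psi> \<noteq> supp_L2 E"
proof
  assume eq: "phase_H2 \<psi> = supp_L2 E"
  let ?k = "ker_L2 (- \<i>)"
  have "?k \<in> H2"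
    by (rule ker_L2_in_H2) simp
  then have "mult_L2 (phase \<psi>) ?k \<in> supp_L2 E"
    unfolding eq[symmetric] phase_H2_eq by blast
  then have inv: "mult_L2 (indicator E) (mult_L2 (phase \<psi>) ?k) = mult_L2 (phase \<psi>) ?k"
    by (simp add: supp_L2_def)
  have "AE x in lborel. rep_L2 ?k x = cker (- \<i>) x"
    unfolding ker_L2_def by (rule rep_abs_L2) (simp add: square_integrable_cker)
  with rep_mult_L2[OF multiplier_phase[OF \<psi>], of ?k]
    rep_mult_L2[OF multiplier_indicator[OF E], of "mult_L2 (phase \<psi>) ?k"]
  have "AE x in lborel. x \<in> E \<longleftrightarrow> x \<in> UNIV"
  proof eventually_elim
    case (elim x)
    have "phase \<psi> x \<noteq> 0"
      using norm_phase[of \<psi> x] by (metis norm_zero zero_neq_one)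
    then show ?case
      using elim inv cker_nonzero[of "- \<i>" x] by (auto simp: indicator_def split: if_splits)
  qed
  then have "supp_L2 E = supp_L2 UNIV"
    using E by (subst supp_L2_eq_iff) auto
  moreover have "supp_L2 UNIV = UNIV"
    using mult_L2_one by (auto simp: supp_L2_def indicator_def)
  ultimately have "mult_L2 (phase \<psi>) (ker_L2 \<i>) \<in> phase_H2 \<psi>"
    using eq by simp
  then have "ker_L2 \<i> \<in> H2"
    by (simp add: mem_phase_H2_iff \<psi> mult_phase_inverse)
  then have "cinner_L2 (ker_L2 \<i>) (ker_L2 \<i>) = 0"
    by (rule H2_orthogonal_ker) simp
  then show False
    using norm_ker_L2[of \<i>] by (simp add: cinner_self)
qed

subsection \<open>A compactified gradient map of the plane\<close>

text \<open>On the open disc, \<open>grad_map\<close> is, in the coordinate $\lambda = z/(1-|z|)$, the gradient of the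
  strictly convex function $\lambda \mapsto \int (|\lambda\cdot e| - \ln(1+|\lambda\cdot e|))\,dM$; on the unit
  circle it is $\int e\,\mathrm{sgn}(z\cdot e)\,dM$.\<close>

locale nondegenerate_directions = finite_measure M for M :: "'a measure" +
  fixes e :: "'a \<Rightarrow> complex"
  assumes nonzero: "emeasure M (space M) \<noteq> 0"
    and e_measurable [measurable]: "e \<in> borel_measurable M"
    and e_bound: "norm (e x) \<le> 1"
    and nondegenerate: "z \<noteq> 0 \<Longrightarrow> AE x in M. inner z (e x) \<noteq> 0"
begin

text \<open>For s = z.e / (1 - |z|) this is s / (1 + |s|), the derivative of |s| - ln(1 + |s|).
  Clearing the denominator 1 - |z| extends it to the unit circle, where s is infinite and the sign
  of z.e is left.\<close>

definition slope :: "complex \<Rightarrow> 'a \<Rightarrow> real" where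
  "slope z x = inner z (e x) / (1 - norm z + \<bar>inner z (e x)\<bar>)"

definition grad_map :: "complex \<Rightarrow> complex" where
  "grad_map z = (LINT x|M. slope z x *\<^sub>R e x)"

lemma not_AE_False: "\<not> (AE x in M. False)"
  using nonzero by (simp add: AE_iff_measurable[OF _ refl])

lemma slope_measurable [measurable]: "slope z \<in> borel_measurable M"
  unfolding slope_def[abs_def] by measurable

lemma slope_bound: "norm z \<le> 1 \<Longrightarrow> \<bar>slope z x\<bar> \<le> 1"
  by (auto simp: slope_def abs_divide divide_le_eq)

lemma slope_bound_strict:
  assumes "norm z < 1"
  shows "\<bar>slope z x\<bar> < 1"
proof -
  have "\<bar>inner z (e x)\<bar> < 1 - norm z + \<bar>inner z (e x)\<bar>"
    using assms by simp
  then show ?thesis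
    using assms by (simp add: slope_def abs_divide divide_less_eq)
qed

lemma slope_sphere: "norm z = 1 \<Longrightarrow> slope z x = sgn (inner z (e x))"
  by (simp add: slope_def sgn_if abs_if)

lemma inner_e_bound: "\<bar>inner z (e x)\<bar> \<le> norm z"
  using Cauchy_Schwarz_ineq2[of z "e x"] mult_left_mono[OF e_bound[of x] norm_ge_zero[of z]] by simp

lemma slope_e_bound: "norm z \<le> 1 \<Longrightarrow> norm (slope z x *\<^sub>R e x) \<le> 1"
  using slope_bound e_bound by (simp add: mult_le_one)

lemma integrable_slope: "norm z \<le> 1 \<Longrightarrow> integrable M (\<lambda>x. slope z x *\<^sub>R e x)"
  by (rule integrable_const_bound[where B = 1]) (simp_all only: slope_e_bound AE_I2, measurable)

lemma integrable_inner_e: "integrable M (\<lambda>x. \<bar>inner z (e x)\<bar>)"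
  by (rule integrable_const_bound[where B = "norm z"]) (auto intro: inner_e_bound)

lemma integrable_slope_inner: "norm z \<le> 1 \<Longrightarrow> integrable M (\<lambda>x. inner w (e x) * slope z x)"
  using integrable_inner_right[OF integrable_slope, of w z] by (simp add: mult.commute)

lemma inner_grad_map: "norm z \<le> 1 \<Longrightarrow> inner w (grad_map z) = (LINT x|M. inner w (e x) * slope z x)"
  unfolding grad_map_def by (subst integral_inner_right[symmetric]) (auto intro: integrable_slope simp: mult.commute)

text \<open>Dominated convergence. The denominator of \<open>slope\<close> can vanish only on the
  unit circle, and there only where z.e = 0, a null set by \<open>nondegenerate\<close>.\<close>

lemma continuous_grad_map: "continuous_on (cball 0 1) grad_map"
  unfolding continuous_on_sequentially
proof (intro allI impI ballI, elim conjE)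
  fix z :: "nat \<Rightarrow> complex" and a
  assume a: "a \<in> cball 0 1" and z: "\<forall>n. z n \<in> cball 0 1" "z \<longlonglongrightarrow> a"
  have "(\<lambda>n. LINT x|M. slope (z n) x *\<^sub>R e x) \<longlonglongrightarrow> (LINT x|M. slope a x *\<^sub>R e x)"
  proof (rule integral_dominated_convergence[where w = "\<lambda>_. 1"])
    have "AE x in M. 1 - norm a + \<bar>inner a (e x)\<bar> \<noteq> 0"
    proof (cases "norm a = 1")
      case True
      then have "a \<noteq> 0" by auto
      from nondegenerate[OF this] True show ?thesis by simp
    next
      case False
      then have "norm a < 1"
        using a by simp
      then have "1 - norm a + \<bar>inner a (e x)\<bar> > 0" for x
        by (simp add: add_pos_nonneg)
      then show ?thesis
        by (intro AE_I2) (metis less_irrefl)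
    qed
    then show "AE x in M. (\<lambda>n. slope (z n) x *\<^sub>R e x) \<longlonglongrightarrow> slope a x *\<^sub>R e x"
      unfolding slope_def by eventually_elim (intro tendsto_intros z(2))
    show "AE x in M. norm (slope (z n) x *\<^sub>R e x) \<le> 1" for n
      using z(1) slope_e_bound by auto
  qed auto
  then show "(grad_map \<circ> z) \<longlonglongrightarrow> grad_map a"
    by (simp add: grad_map_def comp_def)
qed

lemma AE_zero_of_integral_zero:
  fixes k :: "'a \<Rightarrow> real"
  assumes "integrable M k" "\<And>x. k x \<ge> 0" "(LINT x|M. k x) = 0"
  shows "AE x in M. k x = 0"
  using integral_nonneg_eq_0_iff_AE[OF assms(1)] assms(2,3) by simp

text \<open>The right-hand side is the support function of the zonoid of all integrals of s e with
  |s| at most 1. The gap is the integral of a nonnegative function, so equality forces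
  \<open>slope\<close> to be the extremal choice of s almost everywhere.\<close>

lemma support_gap:
  assumes w: "w \<noteq> 0" and z: "norm z \<le> 1"
  shows "inner w (grad_map z) \<le> (LINT x|M. \<bar>inner w (e x)\<bar>)"
    and "inner w (grad_map z) = (LINT x|M. \<bar>inner w (e x)\<bar>) \<Longrightarrow> AE x in M. slope z x = sgn (inner w (e x))"
proof -
  have nn: "\<bar>inner w (e x)\<bar> - inner w (e x) * slope z x \<ge> 0" for x
  proof -
    have "\<bar>inner w (e x)\<bar> * \<bar>slope z x\<bar> \<le> \<bar>inner w (e x)\<bar> * 1"
      using slope_bound[OF z] by (intro mult_left_mono) auto
    then have "\<bar>inner w (e x) * slope z x\<bar> \<le> \<bar>inner w (e x)\<bar>"
      by (simp add: abs_mult)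
    then show ?thesis
      using abs_ge_self[of "inner w (e x) * slope z x"] by linarith
  qed
  have int: "integrable M (\<lambda>x. \<bar>inner w (e x)\<bar> - inner w (e x) * slope z x)"
    by (intro Bochner_Integration.integrable_diff integrable_inner_e integrable_slope_inner z)
  have eq: "(LINT x|M. \<bar>inner w (e x)\<bar> - inner w (e x) * slope z x) =
      (LINT x|M. \<bar>inner w (e x)\<bar>) - inner w (grad_map z)"
    by (simp add: inner_grad_map[OF z] integrable_inner_e integrable_slope_inner z)
  have "(LINT x|M. \<bar>inner w (e x)\<bar> - inner w (e x) * slope z x) \<ge> 0"
    by (intro integral_nonneg_AE AE_I2 nn)
  then show "inner w (grad_map z) \<le> (LINT x|M. \<bar>inner w (e x)\<bar>)"
    unfolding eq by simp
  assume "inner w (grad_map z) = (LINT x|M. \<bar>inner w (e x)\<bar>)"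
  then have "AE x in M. \<bar>inner w (e x)\<bar> - inner w (e x) * slope z x = 0"
    by (intro AE_zero_of_integral_zero int nn) (simp add: eq)
  with nondegenerate[OF w] show "AE x in M. slope z x = sgn (inner w (e x))"
  proof eventually_elim
    case (elim x)
    then have "inner w (e x) * (sgn (inner w (e x)) - slope z x) = 0"
      by (simp only: right_diff_distrib abs_sgn)
    then show ?case
      using elim(1) by simp
  qed
qed

lemma grad_map_sphere:
  assumes "norm w = 1"
  shows "inner w (grad_map w) = (LINT x|M. \<bar>inner w (e x)\<bar>)"
  using assms by (simp add: inner_grad_map slope_sphere abs_sgn)

text \<open>A point of the circle attains the support function in its own direction. Another point
  with the same image attains it too, and the equality case of \<open>support_gap\<close> then
  excludes the open disc, where slopes are less than 1 in absolute value.\<close>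

lemma grad_map_eq_sphere:
  assumes w: "norm w = 1" and z: "norm z \<le> 1" and eq: "grad_map z = grad_map w"
  shows "norm z = 1" "AE x in M. sgn (inner z (e x)) = sgn (inner w (e x))"
proof -
  have w0: "w \<noteq> 0"
    using w by auto
  have *: "AE x in M. slope z x = sgn (inner w (e x))"
    using grad_map_sphere[OF w] by (intro support_gap(2) w0 z) (simp add: eq)
  show 1: "norm z = 1"
  proof (rule ccontr)
    assume "norm z \<noteq> 1"
    then have "norm z < 1"
      using z by simp
    from * nondegenerate[OF w0] have "AE x in M. False"
    proof eventually_elim
      case (elim x)
      then show ?case
        using slope_bound_strict[OF \<open>norm z < 1\<close>, of x] by (simp add: sgn_if split: if_splits)
    qed
    then show False
      using not_AE_False by blast
  qed
  show "AE x in M. sgn (inner z (e x)) = sgn (inner w (e x))"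
    using * by (simp add: slope_sphere[OF 1])
qed

lemma grad_map_cong_sphere:
  assumes "norm z = 1" "norm w = 1" "AE x in M. sgn (inner z (e x)) = sgn (inner w (e x))"
  shows "grad_map z = grad_map w"
  unfolding grad_map_def slope_sphere[OF assms(1)] slope_sphere[OF assms(2)]
  using assms(3) by (intro integral_cong_AE) auto

text \<open>Strict monotonicity of a gradient: pairing the difference of the images with the
  difference of the parameters \<open>l z - l z'\<close> gives the integral of (s - t)(s/(1+|s|) -
  t/(1+|t|)), whose integrand is positive wherever s and t differ, hence almost everywhere.\<close>

lemma inj_on_grad_map: "inj_on grad_map (ball 0 1)"
proof (rule inj_onI, rule ccontr)
  fix z z' :: complex
  assume z: "z \<in> ball 0 1" "z' \<in> ball 0 1" and eq: "grad_map z = grad_map z'" and ne: "z \<noteq> z'"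
  define l where "l u = u /\<^sub>R (1 - norm u)" for u :: complex
  have sl: "slope u x = inner (l u) (e x) / (1 + \<bar>inner (l u) (e x)\<bar>)" if "u \<in> ball 0 1" for u x
  proof -
    have p: "1 - norm u > 0"
      using that by simp
    have "inner (l u) (e x) = inner u (e x) / (1 - norm u)"
      by (simp add: l_def divide_inverse mult.commute)
    moreover from p have "1 + \<bar>inner u (e x) / (1 - norm u)\<bar> = (1 - norm u + \<bar>inner u (e x)\<bar>) / (1 - norm u)"
      by (simp add: abs_divide add_divide_distrib)
    ultimately show ?thesis
      using p by (simp add: slope_def)
  qed
  have l_inv: "u = l u /\<^sub>R (1 + norm (l u))" if "u \<in> ball 0 1" for u
  proof -
    have p: "1 - norm u > 0"
      using that by simp
    have "norm (l u) = norm u / (1 - norm u)"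
      using p by (simp add: l_def divide_inverse mult.commute)
    then have "1 + norm (l u) = 1 / (1 - norm u)"
      using p by (simp add: field_simps)
    then show ?thesis
      using p by (simp add: l_def)
  qed
  have lne: "l z - l z' \<noteq> 0"
    using l_inv[OF z(1)] l_inv[OF z(2)] ne by auto
  let ?k = "\<lambda>x. inner (l z - l z') (e x) * (slope z x - slope z' x)"
  have mono: "(s - t) * (s / (1 + \<bar>s\<bar>) - t / (1 + \<bar>t\<bar>)) > 0" if "s \<noteq> t" for s t :: real
  proof -
    have *: "t / (1 + \<bar>t\<bar>) < s / (1 + \<bar>s\<bar>)" if "t < s" for s t :: real
    proof -
      have "t * (1 + \<bar>s\<bar>) < s * (1 + \<bar>t\<bar>)"
      proof -
        have "t * \<bar>s\<bar> \<le> s * \<bar>t\<bar>"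
        proof (cases "s \<ge> 0 \<and> t < 0")
          case True
          then have "t * \<bar>s\<bar> \<le> 0" "s * \<bar>t\<bar> \<ge> 0"
            by (auto intro: mult_nonpos_nonneg mult_nonneg_nonpos)
          then show ?thesis by linarith
        next
          case False
          then show ?thesis
            using that by (auto simp: abs_if)
        qed
        then show ?thesis
          using that by (simp add: distrib_left)
      qed
      then show ?thesis
        by (subst frac_less_eq) (auto simp: mult_less_0_iff divide_less_0_iff add_nonneg_eq_0_iff
            intro!: divide_neg_pos mult_pos_pos add_pos_nonneg)
    qed
    show ?thesis
      using *[of t s] *[of s t] that
      by (cases "t < s") (auto simp: mult_pos_pos mult_neg_neg)
  qed
  have nn: "?k x \<ge> 0" for x
  proof (cases "inner (l z) (e x) = inner (l z') (e x)")
    case True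
    then show ?thesis by (simp add: inner_diff_left)
  next
    case False
    then show ?thesis
      using mono[OF False] by (simp add: inner_diff_left sl[OF z(1)] sl[OF z(2)])
  qed
  have nz: "norm z \<le> 1" "norm z' \<le> 1"
    using z by simp_all
  have "AE x in M. ?k x = 0"
  proof (rule AE_zero_of_integral_zero[OF _ nn])
    show "integrable M ?k"
      unfolding right_diff_distrib by (intro Bochner_Integration.integrable_diff integrable_slope_inner nz)
    show "(LINT x|M. ?k x) = 0"
      unfolding right_diff_distrib
      using inner_grad_map[OF nz(1)] inner_grad_map[OF nz(2)] eq
      by (simp add: integrable_slope_inner nz)
  qed
  with nondegenerate[OF lne] have "AE x in M. False"
  proof eventually_elim
    case (elim x)
    then have "inner (l z) (e x) \<noteq> inner (l z') (e x)"
      by (simp add: inner_diff_left)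
    from mono[OF this] elim show ?case
      by (simp add: inner_diff_left sl[OF z(1)] sl[OF z(2)])
  qed
  then show False
    using not_AE_False by blast
qed

text \<open>The points strictly inside every supporting half plane of the zonoid mentioned at
  \<open>support_gap\<close>.\<close>

definition dual_body :: "complex set" where
  "dual_body = {p. \<forall>w. norm w = 1 \<longrightarrow> inner w p < (LINT x|M. \<bar>inner w (e x)\<bar>)}"

lemma convex_dual_body: "convex dual_body"
proof -
  have "dual_body = (\<Inter>w\<in>{w. norm w = 1}. {p. inner w p < (LINT x|M. \<bar>inner w (e x)\<bar>)})"
    by (auto simp: dual_body_def)
  then show ?thesis
    by (simp add: convex_INT convex_halfspace_lt)
qed

text \<open>A connectedness argument. The image of the open disc is open by invariance of domain. It
  is also relatively closed in \<open>dual_body\<close>, because the image of the closed disc is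
  compact and the circle is mapped outside \<open>dual_body\<close> by
  \<open>grad_map_sphere\<close>. Convexity makes \<open>dual_body\<close> connected.\<close>

lemma grad_map_ball: "grad_map ` ball 0 1 = dual_body"
proof -
  let ?B = "grad_map ` ball 0 1" and ?C = "grad_map ` cball 0 1"
  have sub: "?B \<subseteq> dual_body"
  proof (clarsimp simp: dual_body_def)
    fix z w :: complex assume z: "norm z < 1" and w: "norm w = 1"
    have w0: "w \<noteq> 0"
      using w by auto
    have "inner w (grad_map z) \<noteq> (LINT x|M. \<bar>inner w (e x)\<bar>)"
    proof
      assume "inner w (grad_map z) = (LINT x|M. \<bar>inner w (e x)\<bar>)"
      then have "AE x in M. slope z x = sgn (inner w (e x))"
        using z by (intro support_gap(2) w0) auto
      with nondegenerate[OF w0] have "AE x in M. False"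
      proof eventually_elim
        case (elim x)
        then show ?case
          using slope_bound_strict[OF z, of x] by (simp add: sgn_if split: if_splits)
      qed
      then show False
        using not_AE_False by blast
    qed
    then show "inner w (grad_map z) < (LINT x|M. \<bar>inner w (e x)\<bar>)"
      using support_gap(1)[OF w0, of z] z by simp
  qed
  have "grad_map w \<notin> dual_body" if "norm w = 1" for w
    using grad_map_sphere[OF that] that by (auto simp: dual_body_def)
  then have eq: "?B = dual_body \<inter> ?C"
    using sub by (force simp: less_le)
  have op: "open ?B"
    by (rule invariance_of_domain[OF _ open_ball inj_on_grad_map])
      (rule continuous_on_subset[OF continuous_grad_map], auto)
  have "compact ?C"
    by (rule compact_continuous_image[OF continuous_grad_map compact_cball])
  then have "closedin (top_of_set dual_body) ?B"
    unfolding eq by (intro closedin_closed_Int compact_imp_closed)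
  moreover have "openin (top_of_set dual_body) ?B"
    using op sub by (simp add: openin_open_eq open_subset)
  moreover have "?B \<noteq> {}"
    by simp
  ultimately show ?thesis
    using convex_connected[OF convex_dual_body] by (auto simp: connected_clopen)
qed

text \<open>The compact image of the closed disc is the closure of the convex image of the open
  disc. It is therefore a convex body with interior points, and any such body in the plane is
  homeomorphic to a disc.\<close>

lemma grad_map_cball_homeomorphic: "grad_map ` cball 0 1 homeomorphic cball (0 :: complex) 1"
proof -
  let ?B = "grad_map ` ball 0 1" and ?C = "grad_map ` cball 0 1"
  have C: "compact ?C"
    by (rule compact_continuous_image[OF continuous_grad_map compact_cball])
  have op: "open ?B"
    by (rule invariance_of_domain[OF _ open_ball inj_on_grad_map])
      (rule continuous_on_subset[OF continuous_grad_map], auto)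
  have BC: "?B \<subseteq> ?C"
    by (intro image_mono ball_subset_cball)
  have "grad_map ` closure (ball 0 1) \<subseteq> closure ?B"
    by (rule image_closure_subset) (auto simp: continuous_grad_map closure_subset)
  then have "?C = closure ?B"
    using closure_minimal[OF BC compact_imp_closed[OF C]] by auto
  then have "convex ?C"
    using convex_closure[OF convex_dual_body] by (simp add: grad_map_ball)
  moreover have "interior ?C \<noteq> {}"
    using interior_maximal[OF BC op] by auto
  ultimately show ?thesis
    using C homeomorphic_convex_compact_cball[of ?C 1 0] by simp
qed

end

subsection \<open>The strong operator topology\<close>

lemma Hausdorff_strong_operator_topology: "Hausdorff_space strong_operator_topology"
  unfolding Hausdorff_space_def
proof (intro allI impI)
  fix P Q :: "'a \<Rightarrow>\<^sub>L 'b"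
  assume "P \<in> topspace strong_operator_topology \<and> Q \<in> topspace strong_operator_topology \<and> P \<noteq> Q"
  then obtain u where "blinfun_apply P u \<noteq> blinfun_apply Q u"
    using blinfun_eqI by metis
  then obtain U V where UV: "open U" "open V" "blinfun_apply P u \<in> U" "blinfun_apply Q u \<in> V" "U \<inter> V = {}"
    using hausdorff by metis
  have op: "openin strong_operator_topology {R. blinfun_apply R u \<in> W}" if "open W" for W
    using openin_continuous_map_preimage[OF strong_operator_topology_continuous_evaluation, of W u] that
    by (simp add: strong_operator_topology_topspace)
  show "\<exists>U V. openin strong_operator_topology U \<and> openin strong_operator_topology V \<and> P \<in> U \<and> Q \<in> V \<and> disjnt U V"
    by (rule exI[of _ "{R. blinfun_apply R u \<in> U}"], rule exI[of _ "{R. blinfun_apply R u \<in> V}"])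
      (use UV op in \<open>auto simp: disjnt_def\<close>)
qed

text \<open>Both images are the quotient of \<open>X\<close> by the same equivalence relation:
  \<open>f\<close> is closed onto its image and thus a quotient map, and the map that
  \<open>h\<close> induces on this image is injective, continuous and closed.\<close>

lemma homeomorphic_space_of_equal_fibres:
  assumes X: "compact_space X" and Y: "Hausdorff_space Y" and Z: "Hausdorff_space Z"
    and f: "continuous_map X Y f" and h: "continuous_map X Z h"
    and fib: "\<And>x y. x \<in> topspace X \<Longrightarrow> y \<in> topspace X \<Longrightarrow> f x = f y \<longleftrightarrow> h x = h y"
  shows "subtopology Y (f ` topspace X) homeomorphic_space subtopology Z (h ` topspace X)"
proof -
  let ?Y = "subtopology Y (f ` topspace X)"
  have tY: "topspace ?Y = f ` topspace X"
    using continuous_map_image_subset_topspace[OF f] by auto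
  have f': "continuous_map X ?Y f"
    using f by (simp add: continuous_map_in_subtopology)
  have cl: "closed_map X ?Y f"
    using X f' Y by (intro continuous_imp_closed_map_gen Hausdorff_imp_kc_space Hausdorff_space_subtopology)
  have q: "quotient_map X ?Y f"
    using f' cl tY by (intro continuous_closed_imp_quotient_map) auto
  obtain g where g: "continuous_map ?Y Z g" "g ` topspace ?Y = h ` topspace X"
      "\<And>x. x \<in> topspace X \<Longrightarrow> g (f x) = h x"
    using quotient_map_lift_exists[OF q h] fib by metis
  have "inj_on g (topspace ?Y)"
    unfolding tY inj_on_def using g(3) fib by auto
  moreover have "compact_space ?Y"
    using X compact_space_subtopology image_compactin f compact_space_def by metis
  then have "closed_map ?Y Z g"
    using g(1) Z by (intro continuous_imp_closed_map_gen Hausdorff_imp_kc_space)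
  ultimately have "embedding_map ?Y Z g"
    using g(1) injective_closed_imp_embedding_map by blast
  then have "?Y homeomorphic_space subtopology Z (g ` topspace ?Y)"
    by (rule embedding_map_imp_homeomorphic_space)
  then show ?thesis
    by (simp only: g(2))
qed

lemma closure_of_continuous_image:
  assumes X: "compact_space X" and Y: "Hausdorff_space Y" and h: "continuous_map X Y h"
    and S: "S \<subseteq> topspace X" "X closure_of S = topspace X"
  shows "Y closure_of (h ` S) = h ` topspace X"
proof
  have "closedin Y (h ` topspace X)"
    using image_compactin[OF _ h] X Y by (intro compactin_imp_closedin) (auto simp: compact_space_def)
  then show "Y closure_of (h ` S) \<subseteq> h ` topspace X"
    using S(1) by (intro closure_of_minimal) auto
  show "h ` topspace X \<subseteq> Y closure_of (h ` S)"
    using continuous_map_image_closure_subset[OF h, of S] S(2) by simp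
qed

subsection \<open>Admissible pairs\<close>

lemma twice_cont_diff_atD:
  assumes "twice_cont_diff_at \<psi> x"
  shows "(\<psi> has_real_derivative deriv \<psi> x) (at x)"
    "(deriv \<psi> has_real_derivative deriv (deriv \<psi>) x) (at x)" "isCont (deriv (deriv \<psi>)) x"
proof -
  obtain U where U: "open U" "x \<in> U" "\<psi> differentiable (at x)" "deriv \<psi> differentiable (at x)"
      "continuous_on U (deriv (deriv \<psi>))"
    using assms unfolding twice_cont_diff_at_def by blast
  then show "(\<psi> has_real_derivative deriv \<psi> x) (at x)"
    "(deriv \<psi> has_real_derivative deriv (deriv \<psi>) x) (at x)" "isCont (deriv (deriv \<psi>)) x"
    by (auto simp: DERIV_deriv_iff_real_differentiable continuous_on_eq_continuous_at)
qed

lemma no_accumulation_Un: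
  "no_accumulation_points A \<Longrightarrow> no_accumulation_points B \<Longrightarrow> no_accumulation_points (A \<union> B)"
  by (simp add: no_accumulation_points_def islimpt_Un)

lemma no_accumulation_countable:
  assumes "no_accumulation_points D"
  shows "countable D"
proof -
  have "D = (\<Union>n. D \<inter> {- real n..real n})"
  proof
    show "D \<subseteq> (\<Union>n. D \<inter> {- real n..real n})"
    proof
      fix x assume x: "x \<in> D"
      obtain n :: nat where "\<bar>x\<bar> \<le> n"
        using real_arch_simple by blast
      with x show "x \<in> (\<Union>n. D \<inter> {- real n..real n})"
        by (intro UN_I[of n]) (auto simp: abs_le_iff)
    qed
  qed auto
  moreover have "countable (\<Union>n. D \<inter> {- real n..real n})"
    by (intro countable_UN countableI_type countable_finite no_accumulation_finite[OF assms] compact_Icc)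
  ultimately show ?thesis by simp
qed

lemma AE_not_in_no_accumulation:
  assumes "no_accumulation_points D"
  shows "AE x in lborel. x \<notin> D"
  by (rule AE_not_in) (intro countable_imp_null_set_lborel no_accumulation_countable assms)

locale admissible_pair_locale =
  fixes f g :: "real \<Rightarrow> real"
  assumes adm: "admissible_pair f g"
begin

text \<open>The parameter plane is identified with the complex numbers, so that the derivative of a
  combination becomes \<open>inner z (vel x)\<close>.\<close>

definition comb :: "complex \<Rightarrow> real \<Rightarrow> real" where
  "comb z x = Re z * f x + Im z * g x"

definition vel :: "real \<Rightarrow> complex" where
  "vel x = Complex (deriv f x) (deriv g x)"

definition acc :: "real \<Rightarrow> complex" where
  "acc x = Complex (deriv (deriv f) x) (deriv (deriv g) x)"

definition rough :: "real set" where
  "rough = Gamma_set f \<union> Gamma_set g"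

text \<open>For nonzero \<open>z\<close> this is closed and discrete, and off it
  \<open>comb z\<close> is twice continuously differentiable without critical points.\<close>

definition bad :: "complex \<Rightarrow> real set" where
  "bad z = rough \<union> {x. (comb z has_real_derivative 0) (at x)}"

lemma pair_span_eq: "pair_span f g = range comb"
proof
  show "pair_span f g \<subseteq> range comb"
  proof
    fix h assume "h \<in> pair_span f g"
    then obtain a b where "h = (\<lambda>x. a * f x + b * g x)"
      by (auto simp: pair_span_def)
    then have "h = comb (Complex a b)"
      by (simp add: comb_def fun_eq_iff)
    then show "h \<in> range comb" by simp
  qed
qed (auto simp: pair_span_def comb_def[abs_def])

lemma admissible_comb:
  assumes "z \<noteq> 0"
  shows "admissible (comb z)"
proof -
  have "comb z \<noteq> (\<lambda>x. 0)"
  proof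
    assume "comb z = (\<lambda>x. 0)"
    then have "\<forall>x. Re z * f x + Im z * g x = 0"
      by (simp add: comb_def fun_eq_iff)
    then have "Re z = 0 \<and> Im z = 0"
      using adm unfolding admissible_pair_def by blast
    then show False
      using assms by (simp add: complex_eq_iff)
  qed
  moreover have "comb z \<in> pair_span f g"
    by (simp add: pair_span_eq)
  ultimately show ?thesis
    using adm unfolding admissible_pair_def by blast
qed

lemma no_accumulation_rough: "no_accumulation_points rough"
proof -
  have "comb 1 = f" "comb \<i> = g"
    by (simp_all add: comb_def fun_eq_iff)
  then show ?thesis
    using admissible_comb[of 1] admissible_comb[of \<i>]
    by (auto simp: rough_def admissible_def intro: no_accumulation_Un)
qed

lemma no_accumulation_bad: "z \<noteq> 0 \<Longrightarrow> no_accumulation_points (bad z)"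
  using admissible_comb[of z] no_accumulation_rough
  by (auto simp: bad_def admissible_def intro: no_accumulation_Un)

lemma smooth:
  assumes "x \<notin> rough"
  shows "(f has_real_derivative deriv f x) (at x)" "(g has_real_derivative deriv g x) (at x)"
    "(deriv f has_real_derivative deriv (deriv f) x) (at x)" "(deriv g has_real_derivative deriv (deriv g) x) (at x)"
    "isCont (deriv (deriv f)) x" "isCont (deriv (deriv g)) x"
  using assms twice_cont_diff_atD[of f x] twice_cont_diff_atD[of g x]
  by (auto simp: rough_def Gamma_set_def)

lemma comb_deriv:
  assumes "x \<notin> rough"
  shows "(comb z has_real_derivative inner z (vel x)) (at x)"
    "((\<lambda>x. inner z (vel x)) has_real_derivative inner z (acc x)) (at x)"
  unfolding comb_def[abs_def] vel_def acc_def
  using smooth[OF assms] by (auto intro!: derivative_eq_intros simp: inner_complex_def)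

lemma isCont_vel:
  assumes "x \<notin> rough"
  shows "isCont vel x"
  unfolding vel_def[abs_def] Complex_eq
  by (intro continuous_intros DERIV_isCont[OF smooth(3)[OF assms]] DERIV_isCont[OF smooth(4)[OF assms]])

lemma isCont_acc:
  assumes "x \<notin> rough"
  shows "isCont acc x"
  unfolding acc_def[abs_def] Complex_eq
  by (intro continuous_intros smooth(5,6)[OF assms])

lemma vel_nonzero:
  assumes "x \<notin> bad z"
  shows "inner z (vel x) \<noteq> 0"
  using assms comb_deriv(1)[of x z] by (auto simp: bad_def)

lemma countable_rough: "countable rough"
  by (rule no_accumulation_countable[OF no_accumulation_rough])

lemma borel_measurable_off_rough:
  fixes k :: "real \<Rightarrow> 'b :: topological_space"
  assumes "\<And>x. x \<notin> rough \<Longrightarrow> isCont k x"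
  shows "k \<in> borel_measurable borel"
  by (rule borel_measurable_continuous_countable_exceptions[OF countable_rough])
    (auto intro!: continuous_at_imp_continuous_on assms)

lemma measurable_comb [measurable]: "comb z \<in> borel_measurable borel"
  by (rule borel_measurable_off_rough) (rule DERIV_isCont[OF comb_deriv(1)])

lemma measurable_vel [measurable]: "vel \<in> borel_measurable borel"
  by (rule borel_measurable_off_rough) (rule isCont_vel)

lemma AE_vel_nonzero:
  assumes "z \<noteq> 0"
  shows "AE x in lborel. inner z (vel x) \<noteq> 0"
  using AE_not_in_no_accumulation[OF no_accumulation_bad[OF assms]] by eventually_elim (rule vel_nonzero)

text \<open>The Cauchy distribution: a probability measure with the same null sets as Lebesgue
  measure, so that fibres defined by either measure agree.\<close>

abbreviation wmeas :: "real measure" where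
  "wmeas \<equiv> density lborel (\<lambda>x. ennreal (pker 0 1 x))"

lemma AE_wmeas: "(AE x in wmeas. P x) \<longleftrightarrow> (AE x in lborel. P x)"
proof -
  have "pker 0 1 x > 0" for x
    by (simp add: pker_def add_nonneg_pos)
  then show ?thesis
    by (subst AE_density) auto
qed

text \<open>Nondegeneracy is the admissibility of every nonzero combination: its critical points and
  the rough points have no accumulation points and so form a null set. Normalising
  \<open>vel\<close> makes it bounded without changing the sign of any inner product.\<close>

sublocale nondegenerate_directions wmeas "\<lambda>x. sgn (vel x)"
proof (intro nondegenerate_directions.intro nondegenerate_directions_axioms.intro)
  have one: "emeasure wmeas (space wmeas) = 1"
    using nn_integral_pker(1)[of 1 0] by (simp add: emeasure_density)
  show "finite_measure wmeas"
    by (rule finite_measureI) (simp only: one, simp)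
  show "emeasure wmeas (space wmeas) \<noteq> 0"
    unfolding one by simp
  show "(\<lambda>x. sgn (vel x)) \<in> borel_measurable wmeas"
    by simp
  show "norm (sgn (vel x)) \<le> 1" for x
    by (simp add: norm_sgn)
  show "AE x in wmeas. inner z (sgn (vel x)) \<noteq> 0" if "z \<noteq> 0" for z
    unfolding AE_wmeas using AE_vel_nonzero[OF that]
    by eventually_elim (auto simp: sgn_div_norm)
qed

section \<open>The parametrisation of the closure by the disc, and its fibres\<close>

definition descent :: "complex \<Rightarrow> real set" where
  "descent z = {x. inner z (vel x) < 0}"

lemma sets_descent: "descent z \<in> sets borel"
  unfolding descent_def by measurable

text \<open>The unit disc parametrises the closure: the inside is the plane, with
  $\lambda = z/(1-|z|)$, and the unit circle consists of the directions at infinity.\<close>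

definition limit_proj :: "complex \<Rightarrow> L2 \<Rightarrow>\<^sub>L L2" where
  "limit_proj z = (if norm z < 1 then proj (phase_H2 (comb (z /\<^sub>R (1 - norm z))))
     else proj (supp_L2 (descent z)))"

lemma M_set_eq: "M_set (pair_span f g) = limit_proj ` ball 0 1"
proof
  show "M_set (pair_span f g) \<subseteq> limit_proj ` ball 0 1"
  proof
    fix P assume "P \<in> M_set (pair_span f g)"
    then obtain w where P: "P = proj (phase_H2 (comb w))"
      by (auto simp: M_set_def pair_span_eq)
    \<comment> \<open>The inverse of z / (1 - |z|).\<close>
    let ?z = "w /\<^sub>R (1 + norm w)"
    have p: "1 + norm w > 0"
      by (simp add: add_pos_nonneg)
    have n: "norm ?z = norm w / (1 + norm w)"
      using p by (simp add: divide_inverse mult.commute)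
    have "1 - norm ?z = 1 / (1 + norm w)"
      unfolding n using p by (simp add: field_simps)
    then have "?z /\<^sub>R (1 - norm ?z) = w"
      using p by simp
    moreover have "norm ?z < 1"
      unfolding n using p by simp
    ultimately have "limit_proj ?z = P" "?z \<in> ball 0 1"
      by (simp_all add: limit_proj_def P)
    then show "P \<in> limit_proj ` ball 0 1"
      by blast
  qed
  show "limit_proj ` ball 0 1 \<subseteq> M_set (pair_span f g)"
    by (auto simp: M_set_def pair_span_eq limit_proj_def)
qed

lemma limit_proj_in_projections: "limit_proj z \<in> projections"
  using closed_csubspace_phase_H2[OF measurable_comb] closed_csubspace_supp_L2[OF sets_descent]
  by (auto simp: limit_proj_def projections_def)

lemma ccontraction_limit_proj: "ccontraction (blinfun_apply (limit_proj z))"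
  using closed_csubspace_phase_H2[OF measurable_comb] closed_csubspace_supp_L2[OF sets_descent]
  by (auto simp: limit_proj_def intro: ccontraction_proj)

text \<open>A phase constant almost everywhere is constant on the open set off \<open>bad w\<close>,
  as it is continuous there and a nonempty open set is not null. Its derivative, i times
  \<open>inner w (vel x)\<close> times the phase, would then vanish where \<open>vel_nonzero\<close>
  forbids it.\<close>

lemma phase_comb_nonconstant:
  assumes w: "w \<noteq> 0"
  shows "\<not> (AE x in lborel. phase (comb w) x = c)"
proof
  assume ae: "AE x in lborel. phase (comb w) x = c"
  let ?U = "- bad w"
  have U: "open ?U"
    using no_accumulation_closed[OF no_accumulation_bad[OF w]] by (rule open_Compl)
  have cont: "continuous_on ?U (phase (comb w))"
    unfolding phase_def[abs_def]
    by (intro continuous_intros continuous_at_imp_continuous_on ballI DERIV_isCont[OF comb_deriv(1)])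
      (auto simp: bad_def)
  define T where "T = ?U \<inter> phase (comb w) -` (- {c})"
  have T: "open T"
    unfolding T_def by (rule continuous_open_preimage[OF cont U open_Compl]) simp
  have "AE x in lborel. x \<notin> T"
    using ae by eventually_elim (simp add: T_def)
  then have "T \<in> null_sets lborel"
    using T by (subst (asm) AE_iff_null_sets[symmetric]) auto
  then have "negligible T"
    by (simp add: negligible_iff_null_sets null_sets_completionI)
  then have "T = {}"
    using T open_not_negligible by blast
  then have const: "phase (comb w) x = c" if "x \<in> ?U" for x
    using that by (auto simp: T_def)
  have "uncountable ?U"
    using no_accumulation_countable[OF no_accumulation_bad[OF w]] uncountable_UNIV_real
    by (metis Compl_partition countable_Un)
  then obtain x0 where x0: "x0 \<in> ?U"
    by (metis countable_empty ex_in_conv)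
  have "(comb w has_real_derivative inner w (vel x0)) (at x0)"
    using comb_deriv(1)[of x0 w] x0 by (simp add: bad_def)
  then have "((\<lambda>x. \<i> * complex_of_real (comb w x)) has_vector_derivative \<i> * of_real (inner w (vel x0))) (at x0)"
    by (intro has_vector_derivative_mult_right has_vector_derivative_of_real)
  from field_vector_diff_chain_at[OF this DERIV_exp]
  have "(phase (comb w) has_vector_derivative \<i> * of_real (inner w (vel x0)) * phase (comb w) x0) (at x0)"
    by (simp add: comp_def phase_def[abs_def])
  moreover have "(phase (comb w) has_vector_derivative 0) (at x0)"
    by (rule has_vector_derivative_transform_within_open[OF has_vector_derivative_const U x0, of c])
      (simp add: const)
  ultimately have "\<i> * of_real (inner w (vel x0)) * phase (comb w) x0 = 0"
    by (rule vector_derivative_unique_at)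
  moreover have "phase (comb w) x0 \<noteq> 0"
    using norm_phase[of "comb w" x0] by (metis norm_zero zero_neq_one)
  ultimately show False
    using vel_nonzero[of x0 w] x0 by simp
qed

text \<open>On the circle both maps remember exactly the sign of \<open>inner z (vel x)\<close> up
  to null sets: \<open>limit_proj\<close> through the set \<open>descent z\<close>,
  \<open>grad_map\<close> through the equality case of \<open>support_gap\<close>. Inside both are
  injective, and \<open>mixed\<close> shows that neither identifies an inner point with a boundary
  point.\<close>

lemma limit_proj_fibres:
  assumes z: "z \<in> cball 0 1" "z' \<in> cball 0 1"
  shows "grad_map z = grad_map z' \<longleftrightarrow> limit_proj z = limit_proj z'"
proof -
  note cH = closed_csubspace_phase_H2[OF measurable_comb] and cS = closed_csubspace_supp_L2[OF sets_descent]
  have mixed: "grad_map a \<noteq> grad_map b \<and> limit_proj a \<noteq> limit_proj b" if "norm a < 1" "norm b = 1" for a b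
    using grad_map_eq_sphere(1)[of b a] proj_inject[OF cH cS]
      phase_H2_neq_supp_L2[OF measurable_comb sets_descent] that
    by (auto simp: limit_proj_def)
  consider "norm z < 1" "norm z' < 1" | "norm z < 1" "norm z' = 1" | "norm z = 1" "norm z' < 1"
    | "norm z = 1" "norm z' = 1"
    using z by fastforce
  then show ?thesis
  proof cases
    case 1
    have "z = z'" if eq: "limit_proj z = limit_proj z'"
    proof -
      define w where "w u = u /\<^sub>R (1 - norm u)" for u :: complex
      have "phase_H2 (comb (w z)) = phase_H2 (comb (w z'))"
        using eq 1 by (intro proj_inject[OF cH cH]) (simp add: limit_proj_def w_def)
      from phase_H2_eq_imp_constant[OF measurable_comb measurable_comb this]
      obtain c where "AE x in lborel. phase (\<lambda>x. comb (w z) x - comb (w z') x) x = c"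
        by blast
      moreover have "(\<lambda>x. comb (w z) x - comb (w z') x) = comb (w z - w z')"
        by (simp add: comb_def fun_eq_iff algebra_simps)
      ultimately have weq: "w z = w z'"
        using phase_comb_nonconstant[of "w z - w z'" c] by auto
      have "u = w u /\<^sub>R (1 + norm (w u))" if "norm u < 1" for u
      proof -
        have "norm (w u) = norm u / (1 - norm u)"
          using that by (simp add: w_def divide_inverse mult.commute)
        then have "1 + norm (w u) = 1 / (1 - norm u)"
          using that by (simp add: field_simps)
        then show ?thesis
          using that by (simp add: w_def)
      qed
      then show ?thesis
        using 1 weq by metis
    qed
    moreover have "z = z'" if "grad_map z = grad_map z'"
      using inj_onD[OF inj_on_grad_map that] 1 by simp
    ultimately show ?thesis by auto
  next
    case 2
    then show ?thesis using mixed by blast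
  next
    case 3
    then show ?thesis using mixed by metis
  next
    case 4
    then have nz: "z \<noteq> 0" "z' \<noteq> 0"
      by auto
    have "limit_proj z = limit_proj z' \<longleftrightarrow> supp_L2 (descent z) = supp_L2 (descent z')"
      using 4 proj_inject[OF cS cS] by (auto simp: limit_proj_def)
    also have "\<dots> \<longleftrightarrow> (AE x in lborel. x \<in> descent z \<longleftrightarrow> x \<in> descent z')"
      by (rule supp_L2_eq_iff[OF sets_descent sets_descent])
    also have "\<dots> \<longleftrightarrow> (AE x in lborel. sgn (inner z (sgn (vel x))) = sgn (inner z' (sgn (vel x))))"
    proof -
      have s: "sgn (inner u (sgn (vel x))) = sgn (inner u (vel x))" for u x
        by (cases "vel x = 0") (simp_all add: sgn_div_norm[of "vel x"] sgn_mult)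
      have "AE x in lborel. (x \<in> descent z \<longleftrightarrow> x \<in> descent z') \<longleftrightarrow>
          sgn (inner z (sgn (vel x))) = sgn (inner z' (sgn (vel x)))"
        using AE_vel_nonzero[OF nz(1)] AE_vel_nonzero[OF nz(2)]
        by eventually_elim (simp only: s, auto simp: descent_def sgn_if)
      then show ?thesis
        by (rule eventually_subst)
    qed
    also have "\<dots> \<longleftrightarrow> grad_map z = grad_map z'"
      using grad_map_cong_sphere[of z z'] grad_map_eq_sphere(2)[of z' z] 4 by (auto simp: AE_wmeas)
    finally show ?thesis by simp
  qed
qed

text \<open>Multiplication by a phase depends on the parameter only strongly continuously, by
  dominated convergence. Since these operators are contractions, strong convergence passes to their
  composition with the converging vectors \<open>?q (z n)\<close>.\<close>

lemma continuous_on_limit_proj_ball: "continuous_on (ball 0 1) (\<lambda>z. blinfun_apply (limit_proj z) u)"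
  unfolding continuous_on_sequentially
proof (intro allI impI ballI, elim conjE)
  fix z :: "nat \<Rightarrow> complex" and a
  assume a: "a \<in> ball 0 1" and z: "\<forall>n. z n \<in> ball 0 1" "z \<longlonglongrightarrow> a"
  let ?P = "blinfun_apply (proj H2)"
  define w where "w u = u /\<^sub>R (1 - norm u)" for u :: complex
  define \<theta> where "\<theta> s u = phase (\<lambda>x. s * comb (w u) x)" for s :: real and u
  have m: "multiplier (\<theta> s u)" for s u
    unfolding \<theta>_def by (rule multiplier_phase) measurable
  have app: "blinfun_apply (limit_proj v) u = mult_L2 (\<theta> 1 v) (?P (mult_L2 (\<theta> (- 1) v) u))" if "v \<in> ball 0 1" for v
    using that by (simp add: limit_proj_def w_def \<theta>_def proj_phase_H2)
  have "(\<lambda>n. w (z n)) \<longlonglongrightarrow> w a"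
    unfolding w_def using a by (intro tendsto_intros z(2)) auto
  then have "(\<lambda>n. \<theta> s (z n) x) \<longlonglongrightarrow> \<theta> s a x" for s x
    unfolding \<theta>_def phase_def comb_def by (intro tendsto_intros)
  then have lim: "(\<lambda>n. mult_L2 (\<theta> s (z n)) v) \<longlonglongrightarrow> mult_L2 (\<theta> s a) v" for s v
    by (intro tendsto_mult_L2 m AE_I2)
  let ?q = "\<lambda>v. ?P (mult_L2 (\<theta> (- 1) v) u)"
  have q: "(\<lambda>n. ?q (z n)) \<longlonglongrightarrow> ?q a"
    by (intro bounded_linear.tendsto[OF blinfun.bounded_linear_right] lim)
  have "(\<lambda>n. mult_L2 (\<theta> 1 (z n)) (?q (z n)) - mult_L2 (\<theta> 1 (z n)) (?q a)) \<longlonglongrightarrow> 0"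
  proof (rule Lim_null_comparison[OF always_eventually], rule allI)
    show "norm (mult_L2 (\<theta> 1 (z n)) (?q (z n)) - mult_L2 (\<theta> 1 (z n)) (?q a)) \<le> norm (?q (z n) - ?q a)" for n
      using ccontraction_mult_L2[OF m[of 1 "z n"]]
      by (simp only: ccontraction_diff[symmetric]) (simp only: ccontraction_def)
    show "(\<lambda>n. norm (?q (z n) - ?q a)) \<longlonglongrightarrow> 0"
      using q by (simp only: tendsto_norm_zero_iff Lim_null[symmetric])
  qed
  from tendsto_add[OF this lim[of 1 "?q a"]]
  have "(\<lambda>n. mult_L2 (\<theta> 1 (z n)) (?q (z n))) \<longlonglongrightarrow> mult_L2 (\<theta> 1 a) (?q a)"
    by simp
  then show "((\<lambda>z. blinfun_apply (limit_proj z) u) \<circ> z) \<longlonglongrightarrow> blinfun_apply (limit_proj a) u"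
    by (simp only: comp_def app[OF a] app[OF z(1)[rule_format]])
qed

text \<open>Off the null set where \<open>inner a (vel x)\<close> vanishes, its sign is unchanged
  for nearby directions, so the indicators are eventually constant at such a point.\<close>

lemma continuous_on_limit_proj_sphere: "continuous_on (sphere 0 1) (\<lambda>z. blinfun_apply (limit_proj z) u)"
  unfolding continuous_on_sequentially
proof (intro allI impI ballI, elim conjE)
  fix z :: "nat \<Rightarrow> complex" and a
  assume a: "a \<in> sphere 0 1" and z: "\<forall>n. z n \<in> sphere 0 1" "z \<longlonglongrightarrow> a"
  have a0: "a \<noteq> 0"
    using a by auto
  have app: "blinfun_apply (limit_proj v) u = mult_L2 (indicator (descent v)) u" if "v \<in> sphere 0 1" for v
    using that by (simp add: limit_proj_def proj_supp_L2 sets_descent)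
  have "(\<lambda>n. mult_L2 (indicator (descent (z n))) u) \<longlonglongrightarrow> mult_L2 (indicator (descent a)) u"
  proof (intro tendsto_mult_L2 multiplier_indicator sets_descent)
    show "AE x in lborel. (\<lambda>n. indicator (descent (z n)) x) \<longlonglongrightarrow> (indicator (descent a) x :: complex)"
      using AE_vel_nonzero[OF a0]
    proof eventually_elim
      case (elim x)
      have lim: "(\<lambda>n. inner (z n) (vel x)) \<longlonglongrightarrow> inner a (vel x)"
        by (intro tendsto_intros z(2))
      have "\<forall>\<^sub>F n in sequentially. x \<in> descent (z n) \<longleftrightarrow> x \<in> descent a"
      proof (cases "inner a (vel x) < 0")
        case True
        then show ?thesis
          using order_tendstoD(2)[OF lim True] by (auto simp: descent_def elim: eventually_mono)
      next
        case False
        with elim have "inner a (vel x) > 0" by simp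
        from order_tendstoD(1)[OF lim this] show ?thesis
          by (rule eventually_mono) (use False in \<open>auto simp: descent_def\<close>)
      qed
      then have "\<forall>\<^sub>F n in sequentially. indicator (descent (z n)) x = (indicator (descent a) x :: complex)"
        by (rule eventually_mono) (simp add: indicator_def)
      then show ?case
        by (rule tendsto_eventually)
    qed
  qed
  then show "((\<lambda>z. blinfun_apply (limit_proj z) u) \<circ> z) \<longlonglongrightarrow> blinfun_apply (limit_proj a) u"
    by (simp only: comp_def app[OF a] app[OF z(1)[rule_format]])
qed

text \<open>With t = 1 / (1 - |z|) the phase is \<open>comb (t z *\<^sub>R z)\<close>, whose
  derivatives have order t. On a good interval compactness keeps \<open>inner a (vel x)\<close> away
  from 0, so the phase is steep with one sign throughout, and the two limit lemmas for steep phases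
  apply.\<close>

lemma tendsto_limit_proj_ind:
  assumes a: "norm a = 1" and pq: "p < q" and good: "{p..q} \<inter> bad a = {}"
  shows "((\<lambda>z. blinfun_apply (limit_proj z) (ind_L2 p q)) \<longlongrightarrow> blinfun_apply (limit_proj a) (ind_L2 p q))
    (at a within ball 0 1)"
proof -
  let ?F = "at a within ball 0 1 :: complex filter"
  define t where "t z = 1 / (1 - norm z)" for z :: complex
  have sm: "x \<notin> rough" "x \<notin> bad a" if "x \<in> {p..q}" for x
    using good that by (auto simp: bad_def)
  have cv: "continuous_on {p..q} vel" and ca: "continuous_on {p..q} acc"
    by (auto intro!: continuous_at_imp_continuous_on isCont_vel isCont_acc sm)
  have "bounded (vel ` {p..q})" "bounded (acc ` {p..q})"
    using cv ca by (auto intro: compact_continuous_image compact_imp_bounded)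
  then obtain B B' where B: "\<And>x. x \<in> {p..q} \<Longrightarrow> norm (vel x) \<le> B" "\<And>x. x \<in> {p..q} \<Longrightarrow> norm (acc x) \<le> B'"
    unfolding bounded_iff by blast
  have "continuous_on {p..q} (\<lambda>x. \<bar>inner a (vel x)\<bar>)"
    by (intro continuous_intros cv)
  then obtain x0 where x0: "x0 \<in> {p..q}" "\<And>x. x \<in> {p..q} \<Longrightarrow> \<bar>inner a (vel x0)\<bar> \<le> \<bar>inner a (vel x)\<bar>"
    using continuous_attains_inf[of "{p..q}" "\<lambda>x. \<bar>inner a (vel x)\<bar>"] pq by auto
  \<comment> \<open>Half of the minimum, so that a slope \<open>m\<close> remains after
    \<open>a\<close> is replaced by a nearby \<open>z\<close>.\<close>
  define m where "m = \<bar>inner a (vel x0)\<bar> / 2"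
  have m: "m > 0"
    using vel_nonzero[OF sm(2)[OF x0(1)]] by (simp add: m_def)
  have lb: "\<bar>inner a (vel x)\<bar> \<ge> 2 * m" if "x \<in> {p..q}" for x
    using x0(2)[OF that] by (simp add: m_def)
  have in_ball: "\<forall>\<^sub>F z in ?F. norm z < 1"
    by (simp add: eventually_at_filter)
  have near: "\<forall>\<^sub>F z in ?F. \<forall>x\<in>{p..q}. \<bar>inner z (vel x) - inner a (vel x)\<bar> \<le> m"
  proof -
    have "((\<lambda>z. norm (z - a) * B) \<longlongrightarrow> norm (a - a) * B) ?F"
      by (intro tendsto_intros)
    then have "\<forall>\<^sub>F z in ?F. norm (z - a) * B < m"
      using m by (intro order_tendstoD(2)) auto
    then show ?thesis
    proof eventually_elim
      case (elim z)
      have "\<bar>inner (z - a) (vel x)\<bar> \<le> m" if "x \<in> {p..q}" for x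
        using Cauchy_Schwarz_ineq2[of "z - a" "vel x"] mult_left_mono[OF B(1)[OF that] norm_ge_zero[of "z - a"]] elim
        by linarith
      then show ?case
        by (simp add: inner_diff_left)
    qed
  qed
  have t: "filterlim t at_top ?F"
  proof -
    have "((\<lambda>z. 1 - norm z) \<longlongrightarrow> 1 - norm a) ?F"
      by (intro tendsto_intros)
    then have "filterlim (\<lambda>z. inverse (1 - norm z)) at_top ?F"
      using in_ball a by (intro filterlim_inverse_at_top) (auto elim: eventually_mono)
    then show ?thesis
      by (simp add: t_def[abs_def] inverse_eq_divide)
  qed
  have tz: "z /\<^sub>R (1 - norm z) = t z *\<^sub>R z" for z
    by (simp add: t_def inverse_eq_divide)
  have h: "\<forall>\<^sub>F z in ?F. \<forall>x\<in>{p..q}.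
      (comb (t z *\<^sub>R z) has_real_derivative inner (t z *\<^sub>R z) (vel x)) (at x within {p..q}) \<and>
      ((\<lambda>x. inner (t z *\<^sub>R z) (vel x)) has_real_derivative inner (t z *\<^sub>R z) (acc x)) (at x within {p..q}) \<and>
      \<bar>inner (t z *\<^sub>R z) (acc x)\<bar> \<le> B' * t z"
    using in_ball
  proof eventually_elim
    case (elim z)
    have "\<bar>inner (t z *\<^sub>R z) (acc x)\<bar> \<le> B' * t z" if "x \<in> {p..q}" for x
    proof -
      have "\<bar>inner z (acc x)\<bar> \<le> norm z * norm (acc x)"
        by (rule Cauchy_Schwarz_ineq2)
      also have "\<dots> \<le> 1 * B'"
        using elim B(2)[OF that] by (intro mult_mono) auto
      finally show ?thesis
        using elim by (simp add: abs_mult t_def divide_right_mono)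
    qed
    then show ?case
      using comb_deriv[OF sm(1)] has_field_derivative_at_within by blast
  qed
  have ch2: "\<forall>\<^sub>F z in ?F. continuous_on {p..q} (\<lambda>x. inner (t z *\<^sub>R z) (acc x))"
    by (intro always_eventually allI continuous_intros ca)
  have me: "\<forall>\<^sub>F z in ?F. comb (t z *\<^sub>R z) \<in> borel_measurable borel"
    by (simp add: measurable_comb)
  note lims = tendsto_proj_phase_increasing[OF pq t m me h ch2] tendsto_proj_phase_decreasing[OF pq t m me h ch2]
  have LP: "\<forall>\<^sub>F z in ?F. blinfun_apply (proj (phase_H2 (comb (t z *\<^sub>R z)))) (ind_L2 p q) =
      blinfun_apply (limit_proj z) (ind_L2 p q)"
    using in_ball by eventually_elim (simp add: limit_proj_def tz)
  have LA: "blinfun_apply (limit_proj a) (ind_L2 p q) = abs_L2 (\<lambda>x. indicator (descent a) x * indicator {p..q} x)"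
    using a by (simp add: limit_proj_def proj_supp_L2 sets_descent ind_L2_def mult_L2_abs_L2
        multiplier_indicator square_integrable_indicator)
  have conn: "connected ((\<lambda>x. inner a (vel x)) ` {p..q})"
    by (intro connected_continuous_image continuous_intros cv) simp
  \<comment> \<open>Intermediate value theorem: a change of sign would produce a zero in the
    interval.\<close>
  have sign: "(\<forall>x\<in>{p..q}. inner a (vel x) > 0) \<or> (\<forall>x\<in>{p..q}. inner a (vel x) < 0)"
  proof (rule ccontr)
    assume "\<not> ?thesis"
    then obtain x y where xy: "x \<in> {p..q}" "y \<in> {p..q}" "inner a (vel x) \<le> 0" "inner a (vel y) \<ge> 0"
      by force
    then have "0 \<in> (\<lambda>x. inner a (vel x)) ` {p..q}"
      using connectedD_interval[OF conn, of "inner a (vel x)" "inner a (vel y)" 0] by auto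
    then show False
      using vel_nonzero[OF sm(2)] by auto
  qed
  then show ?thesis
  proof
    assume pos: "\<forall>x\<in>{p..q}. inner a (vel x) > 0"
    have "\<forall>\<^sub>F z in ?F. \<forall>x\<in>{p..q}. inner (t z *\<^sub>R z) (vel x) \<ge> m * t z"
      using near in_ball
    proof eventually_elim
      case (elim z)
      show ?case
      proof
        fix x assume x: "x \<in> {p..q}"
        then have "inner z (vel x) \<ge> m"
          using elim(1) pos lb[OF x] by (auto simp: abs_le_iff abs_if split: if_splits dest!: bspec[of _ _ x])
        then show "inner (t z *\<^sub>R z) (vel x) \<ge> m * t z"
          using elim(2) by (simp add: t_def divide_right_mono)
      qed
    qed
    from lims(1)[OF this] have "((\<lambda>z. blinfun_apply (limit_proj z) (ind_L2 p q)) \<longlongrightarrow> 0) ?F"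
      using LP by (rule Lim_transform_eventually)
    moreover have "(\<lambda>x. indicator (descent a) x * indicator {p..q} x) = (\<lambda>x. 0 :: complex)"
      using pos by (auto simp: fun_eq_iff indicator_def descent_def dest: bspec)
    ultimately show ?thesis
      unfolding LA by (simp add: zero_L2_def)
  next
    assume neg: "\<forall>x\<in>{p..q}. inner a (vel x) < 0"
    have "\<forall>\<^sub>F z in ?F. \<forall>x\<in>{p..q}. inner (t z *\<^sub>R z) (vel x) \<le> - (m * t z)"
      using near in_ball
    proof eventually_elim
      case (elim z)
      show ?case
      proof
        fix x assume x: "x \<in> {p..q}"
        then have "inner z (vel x) \<le> - m"
          using elim(1) neg lb[OF x] by (auto simp: abs_le_iff abs_if split: if_splits dest!: bspec[of _ _ x])
        then have "t z * inner z (vel x) \<le> t z * (- m)"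
          using elim(2) by (intro mult_left_mono) (simp_all add: t_def)
        then show "inner (t z *\<^sub>R z) (vel x) \<le> - (m * t z)"
          by (simp add: mult.commute)
      qed
    qed
    from lims(2)[OF this] have "((\<lambda>z. blinfun_apply (limit_proj z) (ind_L2 p q)) \<longlongrightarrow> ind_L2 p q) ?F"
      using LP by (rule Lim_transform_eventually)
    moreover have "(\<lambda>x. indicator (descent a) x * indicator {p..q} x) = (\<lambda>x. indicator {p..q} x :: complex)"
      using neg by (auto simp: fun_eq_iff indicator_def descent_def)
    ultimately show ?thesis
      unfolding LA by (simp add: ind_L2_def)
  qed
qed

text \<open>At a boundary point the approach from inside and the approach along the circle are
  treated separately. For the former, the vectors on which the projections converge form a closed
  subspace containing the indicators of all intervals that avoid \<open>bad a\<close>.\<close>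

lemma continuous_on_limit_proj: "continuous_on (cball 0 1) (\<lambda>z. blinfun_apply (limit_proj z) u)"
  unfolding continuous_on_def
proof
  let ?h = "\<lambda>z. blinfun_apply (limit_proj z) u"
  fix a :: complex assume a: "a \<in> cball 0 1"
  show "(?h \<longlongrightarrow> ?h a) (at a within cball 0 1)"
  proof (cases "norm a < 1")
    case True
    then have "isCont ?h a"
      using continuous_on_limit_proj_ball[of u] continuous_on_eq_continuous_at[OF open_ball, of 0 1 ?h]
      by (metis mem_ball_0)
    then show ?thesis
      unfolding isCont_def by (rule tendsto_within_subset) simp
  next
    case False
    with a have na: "norm a = 1" by simp
    then have a0: "a \<noteq> 0" by auto
    have "{u. ((\<lambda>z. blinfun_apply (limit_proj z) u) \<longlongrightarrow> blinfun_apply (limit_proj a) u) (at a within ball 0 1)} = UNIV"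
      by (rule closed_csubspace_eq_UNIV_intervals[OF closed_csubspace_convergence no_accumulation_bad[OF a0]])
        (auto intro!: always_eventually ccontraction_limit_proj tendsto_limit_proj_ind na)
    then have "(?h \<longlongrightarrow> ?h a) (at a within ball 0 1)"
      by blast
    moreover have "(?h \<longlongrightarrow> ?h a) (at a within sphere 0 1)"
      using continuous_on_limit_proj_sphere na unfolding continuous_on_def by simp
    ultimately have "(?h \<longlongrightarrow> ?h a) (at a within (ball 0 1 \<union> sphere 0 1))"
      by (rule Lim_Un)
    moreover have "ball 0 1 \<union> sphere 0 1 = cball (0 :: complex) 1"
      by auto
    ultimately show ?thesis
      by simp
  qed
qed

lemma continuous_map_limit_proj: "continuous_map (top_of_set (cball 0 1)) projection_topology limit_proj"
  unfolding projection_topology_def continuous_map_in_subtopology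
    continuous_on_strong_operator_topo_iff_coordinatewise
  using continuous_on_limit_proj limit_proj_in_projections by auto

lemma closure_homeomorphic_disc:
  "subtopology projection_topology (projection_topology closure_of M_set (pair_span f g))
    homeomorphic_space top_of_set (cball (0 :: complex) 1)"
proof -
  let ?X = "top_of_set (cball (0 :: complex) 1)"
  have X: "compact_space ?X"
    by (simp add: compact_space_subtopology)
  have Z: "Hausdorff_space projection_topology"
    unfolding projection_topology_def by (intro Hausdorff_space_subtopology Hausdorff_strong_operator_topology)
  have "?X closure_of ball 0 1 = topspace ?X"
    by (simp add: closure_of_subtopology Int_absorb1 ball_subset_cball)
  then have "projection_topology closure_of M_set (pair_span f g) = limit_proj ` cball 0 1"
    unfolding M_set_eq using closure_of_continuous_image[OF X Z continuous_map_limit_proj, of "ball 0 1"] by auto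
  moreover have "subtopology euclidean (grad_map ` topspace ?X) homeomorphic_space
      subtopology projection_topology (limit_proj ` topspace ?X)"
    by (rule homeomorphic_space_of_equal_fibres[OF X _ Z _ continuous_map_limit_proj])
      (simp_all add: continuous_grad_map limit_proj_fibres)
  moreover have "top_of_set (grad_map ` cball 0 1) homeomorphic_space ?X"
    using grad_map_cball_homeomorphic unfolding homeomorphic_def homeomorphic_space_def
    by (elim exE, intro exI) (auto simp: homeomorphism_def homeomorphic_maps_def)
  ultimately show ?thesis
    by (simp only: topspace_euclidean_subtopology) (meson homeomorphic_space_sym homeomorphic_space_trans)
qed

end

theorem proposition4p8:
  fixes f g :: "real \<Rightarrow> real"
  assumes "admissible_pair f g"
  shows "subtopology projection_topology (projection_topology closure_of M_set (pair_span f g))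
           homeomorphic_space top_of_set (cball (0 :: complex) 1)"
proof -
  interpret admissible_pair_locale f g
    by unfold_locales (rule assms)
  show ?thesis
    by (rule closure_homeomorphic_disc)
qed

end
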